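(* Let $H$ be a separable infinite-dimensional complex Hilbert space and let $\psi : K(H)^+ \to [0,\infty)$ be a (not necessarily linear) map. Then the following conditions are equivalent: (1) There is a monotone increasing function $\alpha:\mathbb{N}_0\to[0,\infty)$ with $\alpha(0)=0$ such that $\psi=\psi_\alpha$, the non-linear trace of Sugeno type associated with $\alpha$. (2) $\psi$ is monotonic increasing F-additive on the spectrum, unitarily invariant, monotone, positively F-homogeneous, lower semi-continuous on $K(H)^+$ in norm, and for any finite rank positive operator $a\in F(H)^+$, $\lim_{c\to\infty}\psi(ca)<+\infty$. (3) $\psi$ is comonotonic F-additive on the spectrum, unitarily invariant, monotone, positively F-homogeneous, lower semi-continuous on $K(H)^+$ in norm, and for any finite rank positive operator $a\in F(H)^+$, $\lim_{c\to\infty}\psi(ca)<+\infty$.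
   Context: $\mathbb{N}_0=\{0,1,2,\dots\}$, $\vee=\max$ (or supremum), $\wedge=\min$. $B(H)$ is the algebra of bounded linear operators on $H$; $K(H)^+$ is the set of positive compact operators and $F(H)^+$ the set of positive finite rank operators on $H$. Eigenvalue sequence: for $a\in K(H)^+$ write $a=\sum_{n=1}^\infty\lambda_n(a)p_n$ with $p_n$ mutually orthogonal one-dimensional projections and $\lambda_1(a)\ge\lambda_2(a)\ge\cdots$ the eigenvalues of $a$ in decreasing order counted with multiplicity, $\lambda_n(a)\to0$; if $a$ has infinite rank all $\lambda_n(a)\neq0$ (only nonzero eigenvalues are listed), and if $a$ has finite rank the list of nonzero eigenvalues is completed by zeros. Non-linear trace of Sugeno type: for monotone increasing $\alpha:\mathbb{N}_0\to[0,\infty)$ with $\alpha(0)=0$, $\psi_\alpha(a)=\bigvee_{i=1}^\infty(\lambda_i(a)\wedge\alpha(i))$ for $a\in K(H)^+$. Properties of $\psi:K(H)^+\to[0,\infty)$: - unitarily invariant: $\psi(uau^* )=\psi(a)$ for all $a\in K(H)^+$ and all unitaries $u\in B(H)$; - monotone: $a\le b$ implies $\psi(a)\le\psi(b)$ for $a,b\in K(H)^+$; - positively F-homogeneous: $\psi(kI\wedge a)=k\wedge\psi(a)$ for all $a\in K(H)^+$ and scalars $k\ge0$, where $kI\wedge a$ is the functional calculus of $a$ by $x\mapsto\min(k,x)$; - two real functions $f,g$ on a set $\Omega$ are comonotonic if $(f(s)-f(t))(g(s)-g(t))\ge0$ for all $s,t\in\Omega$; - comonotonic F-additive on the spectrum: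 $\psi((f\vee g)(a))=\psi(f(a))\vee\psi(g(a))$ for all $a\in K(H)^+$ and all comonotonic $f,g\in C(\sigma(a))^+$ with $f(0)=g(0)=0$, where $C(\sigma(a))^+$ denotes the non-negative continuous functions on the spectrum $\sigma(a)$, $f\vee g$ is the pointwise maximum and $f(a)$ is the functional calculus; - monotonic increasing F-additive on the spectrum: $\psi((f\vee g)(a))=\psi(f(a))\vee\psi(g(a))$ for all $a\in K(H)^+$ and all monotone increasing $f,g\in C(\sigma(a))^+$ with $f(0)=g(0)=0$; - lower semi-continuous in norm: for every $a\in K(H)^+$ and $\epsilon>0$ there is $\delta>0$ such that $x\in K(H)^+$ and $\|x-a\|<\delta$ imply $\psi(a)-\epsilon<\psi(x)$. *)

theory Defs
  imports "HOL-Analysis.Analysis" "HOL-Computational_Algebra.Polynomial"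
begin

section \<open>Complex Hilbert spaces\<close>

class complex_inner = real_normed_vector +
  fixes scaleC :: "complex \<Rightarrow> 'a \<Rightarrow> 'a"  (infixr "*\<^sub>C" 75)
    and cinner :: "'a \<Rightarrow> 'a \<Rightarrow> complex"
  assumes scaleC_add_right: "c *\<^sub>C (x + y) = c *\<^sub>C x + c *\<^sub>C y"
    and scaleC_add_left: "(c + d) *\<^sub>C x = c *\<^sub>C x + d *\<^sub>C x"
    and scaleC_scaleC: "c *\<^sub>C d *\<^sub>C x = (c * d) *\<^sub>C x"
    and scaleC_one: "1 *\<^sub>C x = x"
    and scaleC_of_real: "complex_of_real r *\<^sub>C x = r *\<^sub>R x"
    and cinner_commute: "cinner x y = cnj (cinner y x)"
    and cinner_add_left: "cinner (x + y) z = cinner x z + cinner y z"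
    and cinner_scaleC_left: "cinner (c *\<^sub>C x) y = c * cinner x y"
    and cinner_self_nonneg: "cinner x x \<in> \<real>\<^sub>\<ge>\<^sub>0"
    and cinner_self_eq_0_iff: "cinner x x = 0 \<longleftrightarrow> x = 0"
    and norm_eq_sqrt_cinner: "norm x = sqrt (Re (cinner x x))"

class complex_hilbert = complex_inner + banach

global_interpretation complex_vector:
  vector_space "scaleC :: complex \<Rightarrow> 'a \<Rightarrow> 'a::complex_inner"
  by unfold_locales (rule scaleC_add_right scaleC_add_left scaleC_scaleC scaleC_one)+

definition separable_infinite_dimensional :: "'h::complex_hilbert itself \<Rightarrow> bool" where
  "separable_infinite_dimensional _ \<longleftrightarrow>
     (\<exists>D::'h set. countable D \<and> closure D = UNIV) \<and>
     \<not> (\<exists>B::'h set. finite B \<and> complex_vector.span B = UNIV)"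


section \<open>Bounded operators\<close>

text \<open>The type \<open>'h \<Rightarrow>\<^sub>L 'h\<close> consists of the bounded \<^emph>\<open>real\<close>-linear maps with the
  operator norm; \<open>B(H)\<close> is its subset of complex-linear maps.\<close>

definition bounded_ops :: "('h::complex_hilbert \<Rightarrow>\<^sub>L 'h) set" where
  "bounded_ops = {a. \<forall>c x. blinfun_apply a (c *\<^sub>C x) = c *\<^sub>C blinfun_apply a x}"

definition adjoint_op :: "('h::complex_hilbert \<Rightarrow>\<^sub>L 'h) \<Rightarrow> ('h \<Rightarrow>\<^sub>L 'h)" where
  "adjoint_op a = (THE b. \<forall>x y. cinner (blinfun_apply a x) y = cinner x (blinfun_apply b y))"

definition unitary_ops :: "('h::complex_hilbert \<Rightarrow>\<^sub>L 'h) set" where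
  "unitary_ops = {u \<in> bounded_ops.
     u o\<^sub>L adjoint_op u = id_blinfun \<and> adjoint_op u o\<^sub>L u = id_blinfun}"

definition positive_ops :: "('h::complex_hilbert \<Rightarrow>\<^sub>L 'h) set" where
  "positive_ops = {a \<in> bounded_ops. \<forall>x. cinner (blinfun_apply a x) x \<in> \<real>\<^sub>\<ge>\<^sub>0}"

definition op_le :: "('h::complex_hilbert \<Rightarrow>\<^sub>L 'h) \<Rightarrow> ('h \<Rightarrow>\<^sub>L 'h) \<Rightarrow> bool" where
  "op_le a b \<longleftrightarrow> b - a \<in> positive_ops"

definition compact_positive_ops :: "('h::complex_hilbert \<Rightarrow>\<^sub>L 'h) set" where
  "compact_positive_ops = {a \<in> positive_ops. compact (closure (blinfun_apply a ` cball 0 1))}"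

definition finite_rank_positive_ops :: "('h::complex_hilbert \<Rightarrow>\<^sub>L 'h) set" where
  "finite_rank_positive_ops = {a \<in> positive_ops.
     \<exists>B. finite B \<and> range (blinfun_apply a) \<subseteq> complex_vector.span B}"


section \<open>Spectrum and functional calculus\<close>

definition op_spectrum :: "('h::complex_hilbert \<Rightarrow>\<^sub>L 'h) \<Rightarrow> complex set" where
  "op_spectrum a = {z. \<not> (\<exists>b \<in> bounded_ops. \<forall>x.
      blinfun_apply b (blinfun_apply a x - z *\<^sub>C x) = x \<and>
      blinfun_apply a (blinfun_apply b x) - z *\<^sub>C blinfun_apply b x = x)}"

text \<open>For positive operators the spectrum is real, so that nothing is lost by
  regarding it as a set of reals.\<close>

definition real_spectrum :: "('h::complex_hilbert \<Rightarrow>\<^sub>L 'h) \<Rightarrow> real set" where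
  "real_spectrum a = {t. complex_of_real t \<in> op_spectrum a}"

definition poly_op :: "real poly \<Rightarrow> ('h::complex_hilbert \<Rightarrow>\<^sub>L 'h) \<Rightarrow> ('h \<Rightarrow>\<^sub>L 'h)" where
  "poly_op p a = (\<Sum>i\<le>degree p. coeff p i *\<^sub>R ((\<lambda>b. a o\<^sub>L b) ^^ i) id_blinfun)"

text \<open>The continuous functional calculus \<open>f(a)\<close> of a positive operator \<open>a\<close>, for \<open>f\<close> real-valued
  and continuous on the spectrum: the norm limit of \<open>p\<^sub>n(a)\<close> for real polynomials \<open>p\<^sub>n\<close> converging
  to \<open>f\<close> uniformly on the spectrum. Values of \<open>f\<close> off the spectrum are irrelevant.\<close>

definition fun_calc :: "(real \<Rightarrow> real) \<Rightarrow> ('h::complex_hilbert \<Rightarrow>\<^sub>L 'h) \<Rightarrow> ('h \<Rightarrow>\<^sub>L 'h)" where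
  "fun_calc f a = (THE b. \<exists>p. uniform_limit (real_spectrum a) (\<lambda>n. poly (p n)) f sequentially \<and>
                              (\<lambda>n. poly_op (p n) a) \<longlonglongrightarrow> b)"


section \<open>Eigenvalue sequence and non-linear traces of Sugeno type\<close>

definition one_dim_projections :: "('h::complex_hilbert \<Rightarrow>\<^sub>L 'h) set" where
  "one_dim_projections = {p \<in> bounded_ops. p o\<^sub>L p = p \<and> adjoint_op p = p \<and>
     complex_vector.dim (range (blinfun_apply p)) = 1}"

text \<open>The sequence is indexed from 0 here. For \<open>a\<close> of infinite rank, being decreasing
  forces all its terms to be nonzero; for \<open>a\<close> of finite rank it ends in zeros.\<close>

definition eigenvalue_sequence :: "('h::complex_hilbert \<Rightarrow>\<^sub>L 'h) \<Rightarrow> (nat \<Rightarrow> real) \<Rightarrow> bool" where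
  "eigenvalue_sequence a l \<longleftrightarrow> decseq l \<and> l \<longlonglongrightarrow> 0 \<and>
     (\<exists>p. (\<forall>n. p n \<in> one_dim_projections) \<and> (\<forall>m n. m \<noteq> n \<longrightarrow> p m o\<^sub>L p n = 0) \<and>
          (\<lambda>n. l n *\<^sub>R p n) sums a)"

text \<open>\<open>eigval a n\<close> is \<open>\<lambda>\<^sub>n(a)\<close> for \<open>n \<ge> 1\<close>.\<close>

definition eigval :: "('h::complex_hilbert \<Rightarrow>\<^sub>L 'h) \<Rightarrow> nat \<Rightarrow> real" where
  "eigval a n = (THE l. eigenvalue_sequence a l) (n - 1)"

definition sugeno_trace :: "(nat \<Rightarrow> real) \<Rightarrow> ('h::complex_hilbert \<Rightarrow>\<^sub>L 'h) \<Rightarrow> real" where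
  "sugeno_trace \<alpha> a = (SUP i\<in>{1..}. min (eigval a i) (\<alpha> i))"


section \<open>Properties of functionals on the positive compact operators\<close>

text \<open>Only the values of \<open>\<psi>\<close> on \<^const>\<open>compact_positive_ops\<close> matter below.\<close>

definition unitarily_invariant :: "(('h::complex_hilbert \<Rightarrow>\<^sub>L 'h) \<Rightarrow> real) \<Rightarrow> bool" where
  "unitarily_invariant \<psi> \<longleftrightarrow>
     (\<forall>a\<in>compact_positive_ops. \<forall>u\<in>unitary_ops. \<psi> (u o\<^sub>L a o\<^sub>L adjoint_op u) = \<psi> a)"

definition monotone_functional :: "(('h::complex_hilbert \<Rightarrow>\<^sub>L 'h) \<Rightarrow> real) \<Rightarrow> bool" where
  "monotone_functional \<psi> \<longleftrightarrow>
     (\<forall>a\<in>compact_positive_ops. \<forall>b\<in>compact_positive_ops. op_le a b \<longrightarrow> \<psi> a \<le> \<psi> b)"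

definition positively_F_homogeneous :: "(('h::complex_hilbert \<Rightarrow>\<^sub>L 'h) \<Rightarrow> real) \<Rightarrow> bool" where
  "positively_F_homogeneous \<psi> \<longleftrightarrow>
     (\<forall>a\<in>compact_positive_ops. \<forall>k\<ge>0. \<psi> (fun_calc (\<lambda>x. min k x) a) = min k (\<psi> a))"

definition comonotonic_on :: "'s set \<Rightarrow> ('s \<Rightarrow> real) \<Rightarrow> ('s \<Rightarrow> real) \<Rightarrow> bool" where
  "comonotonic_on \<Omega> f g \<longleftrightarrow> (\<forall>s\<in>\<Omega>. \<forall>t\<in>\<Omega>. (f s - f t) * (g s - g t) \<ge> 0)"

definition nonneg_continuous_on :: "real set \<Rightarrow> (real \<Rightarrow> real) \<Rightarrow> bool" where
  "nonneg_continuous_on S f \<longleftrightarrow> continuous_on S f \<and> (\<forall>t\<in>S. 0 \<le> f t)"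

definition comonotonic_F_additive :: "(('h::complex_hilbert \<Rightarrow>\<^sub>L 'h) \<Rightarrow> real) \<Rightarrow> bool" where
  "comonotonic_F_additive \<psi> \<longleftrightarrow>
     (\<forall>a\<in>compact_positive_ops. \<forall>f g.
        nonneg_continuous_on (real_spectrum a) f \<longrightarrow> nonneg_continuous_on (real_spectrum a) g \<longrightarrow>
        comonotonic_on (real_spectrum a) f g \<longrightarrow> f 0 = 0 \<longrightarrow> g 0 = 0 \<longrightarrow>
        \<psi> (fun_calc (\<lambda>x. max (f x) (g x)) a) = max (\<psi> (fun_calc f a)) (\<psi> (fun_calc g a)))"

definition monotonic_increasing_F_additive :: "(('h::complex_hilbert \<Rightarrow>\<^sub>L 'h) \<Rightarrow> real) \<Rightarrow> bool" where
  "monotonic_increasing_F_additive \<psi> \<longleftrightarrow>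
     (\<forall>a\<in>compact_positive_ops. \<forall>f g.
        nonneg_continuous_on (real_spectrum a) f \<longrightarrow> nonneg_continuous_on (real_spectrum a) g \<longrightarrow>
        mono_on (real_spectrum a) f \<longrightarrow> mono_on (real_spectrum a) g \<longrightarrow> f 0 = 0 \<longrightarrow> g 0 = 0 \<longrightarrow>
        \<psi> (fun_calc (\<lambda>x. max (f x) (g x)) a) = max (\<psi> (fun_calc f a)) (\<psi> (fun_calc g a)))"

definition lower_semicontinuous_norm :: "(('h::complex_hilbert \<Rightarrow>\<^sub>L 'h) \<Rightarrow> real) \<Rightarrow> bool" where
  "lower_semicontinuous_norm \<psi> \<longleftrightarrow>
     (\<forall>a\<in>compact_positive_ops. \<forall>\<epsilon>>0. \<exists>\<delta>>0. \<forall>x\<in>compact_positive_ops.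
        norm (x - a) < \<delta> \<longrightarrow> \<psi> a - \<epsilon> < \<psi> x)"

definition finite_limit_on_finite_rank :: "(('h::complex_hilbert \<Rightarrow>\<^sub>L 'h) \<Rightarrow> real) \<Rightarrow> bool" where
  "finite_limit_on_finite_rank \<psi> \<longleftrightarrow>
     (\<forall>a\<in>finite_rank_positive_ops. \<exists>L::real. ((\<lambda>c::real. \<psi> (c *\<^sub>R a)) \<longlongrightarrow> L) at_top)"

end

theory Submission
  imports Defs
begin

text \<open>Both the Sugeno trace and an arbitrary functional with the listed properties are controlled by
  the counting function \<open>N\<^sub>a(t)\<close>, the number of eigenvalues of \<open>a\<close> that are at least \<open>t\<close>. It is the
  largest dimension of a subspace on which the form of \<open>a\<close> dominates \<open>t\<close>, hence monotone in \<open>a\<close>,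
  and \<open>\<psi>\<^sub>\<alpha>(a) > r\<close> holds iff \<open>\<alpha>(N\<^sub>a(t)) > r\<close> for some \<open>t > r\<close>. Every property of \<open>\<psi>\<^sub>\<alpha>\<close> is read off
  from this; in particular \<open>\<psi>\<^sub>\<alpha>\<close> is 1-Lipschitz in norm. Conversely, \<open>\<alpha>(n)\<close> is the limit of
  \<open>\<psi>(c q\<^sub>n)\<close> for a projection \<open>q\<^sub>n\<close> of rank \<open>n\<close>; homogeneity gives \<open>\<psi>(c q\<^sub>n) = min c (\<alpha>(n))\<close>, unitary
  invariance makes this independent of \<open>q\<^sub>n\<close>, additivity extends \<open>\<psi> = \<psi>\<^sub>\<alpha>\<close> to finite maxima of step
  functions of \<open>a\<close>, and these approximate \<open>a\<close> in norm from below.\<close>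

section \<open>Inner product spaces\<close>

text \<open>All computations take place in one normal form, \<open>diag_op e l\<close> with an
  orthonormal sequence \<open>e\<close> and a null sequence \<open>l\<close>. The sequence
  \<open>e\<close> may be incomplete, its orthogonal complement being part of the kernel: so an
  infinite rank operator with a kernel can list nonzero eigenvalues only. The price is that identity
  terms have to be split off from polynomials and resolvents, while functions with
  \<open>f 0 = 0\<close> stay within the normal form. Suprema are compared through their strict
  lower bounds only, which turns each property of the trace into an inequality between counts. In
  the converse direction additivity speaks of continuous increasing functions, whereas projections
  arise from jumps; as the nonzero points of the spectrum are isolated, a jump can be smoothed
  inside a gap. The finite limit on finite rank operators is what makes \<alpha>(n) a real number.
  The last passage, from approximants to \<open>a\<close>, is symmetric in \<psi> and the trace:
  lower semicontinuity of one and monotonicity of the other give one of the two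
  inequalities.\<close>

lemma cinner_add_right: "cinner x (y + z) = cinner x y + cinner (x::'a::complex_inner) z"
  by (metis cinner_add_left cinner_commute complex_cnj_add)

lemma cinner_scaleC_right: "cinner x (c *\<^sub>C y) = cnj c * cinner (x::'a::complex_inner) y"
  by (metis cinner_commute cinner_scaleC_left complex_cnj_mult)

lemma cinner_scaleR_left: "cinner (r *\<^sub>R x) y = of_real r * cinner (x::'a::complex_inner) y"
  by (metis cinner_scaleC_left scaleC_of_real)

lemma cinner_scaleR_right: "cinner x (r *\<^sub>R y) = of_real r * cinner (x::'a::complex_inner) y"
  by (metis cinner_scaleC_right scaleC_of_real complex_cnj_complex_of_real)

lemma cinner_zero_left [simp]: "cinner 0 (y::'a::complex_inner) = 0"
  using cinner_scaleR_left[of 0 0 y] by simp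

lemma cinner_zero_right [simp]: "cinner (y::'a::complex_inner) 0 = 0"
  using cinner_scaleR_right[of y 0 0] by simp

lemma cinner_minus_left: "cinner (- x) (y::'a::complex_inner) = - cinner x y"
  using cinner_scaleR_left[of "-1" x y] by simp

lemma cinner_minus_right: "cinner x (- y::'a::complex_inner) = - cinner x y"
  using cinner_scaleR_right[of x "-1" y] by simp

lemma cinner_diff_left: "cinner (x - z) (y::'a::complex_inner) = cinner x y - cinner z y"
  using cinner_add_left[of x "- z" y] by (simp add: cinner_minus_left)

lemma cinner_diff_right: "cinner x (y - z::'a::complex_inner) = cinner x y - cinner x z"
  using cinner_add_right[of x y "- z"] by (simp add: cinner_minus_right)

lemmas cinner_simps = cinner_add_left cinner_add_right cinner_diff_left cinner_diff_right
  cinner_minus_left cinner_minus_right cinner_scaleC_left cinner_scaleC_right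
  cinner_scaleR_left cinner_scaleR_right

lemma cinner_sum_left: "cinner (\<Sum>i\<in>I. f i) (y::'a::complex_inner) = (\<Sum>i\<in>I. cinner (f i) y)"
  by (induction I rule: infinite_finite_induct) (auto simp: cinner_add_left)

lemma cinner_sum_right: "cinner (y::'a::complex_inner) (\<Sum>i\<in>I. f i) = (\<Sum>i\<in>I. cinner y (f i))"
  by (induction I rule: infinite_finite_induct) (auto simp: cinner_add_right)

lemma cinner_self: "cinner x x = of_real ((norm (x::'a::complex_inner))\<^sup>2)"
proof -
  have "Im (cinner x x) = 0" "0 \<le> Re (cinner x x)"
    using cinner_self_nonneg[of x] by (auto simp: complex_nonneg_Reals_iff)
  then show ?thesis by (simp add: norm_eq_sqrt_cinner complex_eq_iff)
qed

lemma power2_norm_eq_cinner: "(norm (x::'a::complex_inner))\<^sup>2 = Re (cinner x x)"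
  by (simp add: cinner_self)

lemma mult_cnj_cmod: "z * cnj z = (complex_of_real (cmod z))\<^sup>2"
  by (metis complex_norm_square of_real_power)

lemma norm_scaleC: "norm (c *\<^sub>C x) = cmod c * norm (x::'a::complex_inner)"
proof -
  have "cinner (c *\<^sub>C x) (c *\<^sub>C x) = (c * cnj c) * cinner x x"
    by (simp add: cinner_simps)
  also have "\<dots> = of_real ((cmod c * norm x)\<^sup>2)"
    by (simp only: mult_cnj_cmod cinner_self) (simp add: power_mult_distrib)
  finally have "(norm (c *\<^sub>C x))\<^sup>2 = (cmod c * norm x)\<^sup>2"
    unfolding power2_norm_eq_cinner by (metis Re_complex_of_real)
  then show ?thesis by simp
qed

lemma scaleC_scaleR: "c *\<^sub>C (r *\<^sub>R x) = r *\<^sub>R (c *\<^sub>C (x::'a::complex_inner))"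
  by (metis mult.commute scaleC_of_real scaleC_scaleC)

lemma cinner_Cauchy_Schwarz: "cmod (cinner x y) \<le> norm x * norm (y::'a::complex_inner)"
proof (cases "y = 0")
  case False
  \<comment> \<open>The coefficient of the orthogonal projection of \<open>x\<close> onto the line
    of \<open>y\<close>; with it the three terms of the expansion that contain \<open>c\<close> have
    the same value.\<close>
  define c where "c = cinner x y / of_real ((norm y)\<^sup>2)"
  have ny: "norm y > 0" using False by simp
  have "cinner (x - c *\<^sub>C y) (x - c *\<^sub>C y)
      = cinner x x - cnj c * cinner x y - c * cinner y x + c * cnj c * cinner y y"
    by (simp add: cinner_simps algebra_simps)
  also have "\<dots> = of_real ((norm x)\<^sup>2 - (cmod (cinner x y))\<^sup>2 / (norm y)\<^sup>2)"
  proof -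
    have 1: "cnj c * cinner x y = of_real ((cmod (cinner x y))\<^sup>2 / (norm y)\<^sup>2)"
      by (simp add: c_def mult_cnj_cmod mult.commute)
    have 2: "c * cinner y x = of_real ((cmod (cinner x y))\<^sup>2 / (norm y)\<^sup>2)"
      by (simp add: c_def mult_cnj_cmod cinner_commute[of y x])
    have 3: "c * cnj c * cinner y y = of_real ((cmod (cinner x y))\<^sup>2 / (norm y)\<^sup>2)"
      using ny by (simp add: c_def mult_cnj_cmod cinner_self field_simps power2_eq_square)
    show ?thesis unfolding 1 2 3 by (simp add: cinner_self)
  qed
  finally have "(norm (x - c *\<^sub>C y))\<^sup>2 = (norm x)\<^sup>2 - (cmod (cinner x y))\<^sup>2 / (norm y)\<^sup>2"
    unfolding power2_norm_eq_cinner by (metis Re_complex_of_real power2_norm_eq_cinner)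
  then have "(cmod (cinner x y))\<^sup>2 / (norm y)\<^sup>2 \<le> (norm x)\<^sup>2"
    by (metis diff_ge_0_iff_ge zero_le_power2)
  then have "(cmod (cinner x y))\<^sup>2 \<le> (norm x * norm y)\<^sup>2"
    using ny by (simp add: field_simps)
  then show ?thesis by (simp add: abs_le_square_iff[symmetric])
qed simp

text \<open>\<open>bounded_linear\<close> means real linearity here. Limits and continuity are drawn
  from it, and complex homogeneity is carried separately.\<close>

lemma bounded_linear_cinner_left: "bounded_linear (\<lambda>x. cinner x (y::'a::complex_inner))"
  by (rule bounded_linear_intro[of _ "norm y"])
    (auto simp: cinner_simps scaleR_conv_of_real cinner_Cauchy_Schwarz)

lemma bounded_linear_scaleC: "bounded_linear (\<lambda>x. c *\<^sub>C (x::'a::complex_inner))"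
  by (rule bounded_linear_intro[of _ "cmod c"])
    (auto simp: scaleC_add_right scaleC_scaleR norm_scaleC)

lemma bounded_linear_scaleC_left: "bounded_linear (\<lambda>c. c *\<^sub>C (x::'a::complex_inner))"
  by (rule bounded_linear_intro[of _ "norm x"])
    (auto simp: scaleC_add_left norm_scaleC scaleR_conv_of_real simp flip: scaleC_of_real)

lemma bounded_bilinear_cinner: "bounded_bilinear (cinner :: 'a::complex_inner \<Rightarrow> _)"
  by (rule bounded_bilinear.intro)
    (auto simp: cinner_simps scaleR_conv_of_real intro!: exI[of _ 1] cinner_Cauchy_Schwarz)

lemmas tendsto_cinner = bounded_bilinear.tendsto[OF bounded_bilinear_cinner]

lemma cinner_ext_right: "(\<And>y. cinner y x = cinner (y::'a::complex_inner) z) \<Longrightarrow> x = z"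
  by (metis cinner_diff_right cinner_self_eq_0_iff eq_iff_diff_eq_0)

lemma power2_norm_diff:
  "(norm (x - y))\<^sup>2 = (norm x)\<^sup>2 - 2 * Re (cinner x y) + (norm (y::'a::complex_inner))\<^sup>2"
proof -
  have "Re (cinner y x) = Re (cinner x y)" by (metis cinner_commute complex_cnj(1) complex.sel(1) complex_surj)
  then show ?thesis by (simp add: power2_norm_eq_cinner cinner_simps)
qed

lemma power2_norm_add:
  "(norm (x + y))\<^sup>2 = (norm x)\<^sup>2 + 2 * Re (cinner x y) + (norm (y::'a::complex_inner))\<^sup>2"
  using power2_norm_diff[of x "- y"] by (simp add: cinner_simps)

lemma parallelogram_law:
  "(norm (x + y))\<^sup>2 + (norm (x - y))\<^sup>2 = 2 * (norm x)\<^sup>2 + 2 * (norm (y::'a::complex_inner))\<^sup>2"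
  by (simp add: power2_norm_diff power2_norm_add)

section \<open>The Riesz representation theorem and adjoints\<close>

text \<open>The parallelogram law makes a minimising sequence Cauchy: midpoints stay in
  \<open>S\<close>, so their norm is at least \<open>d\<close>, and this leaves little room for the
  differences.\<close>

lemma minimal_norm_point:
  fixes S :: "'a::complex_hilbert set"
  assumes "closed S" "convex S" "S \<noteq> {}"
  obtains m where "m \<in> S" "\<And>x. x \<in> S \<Longrightarrow> norm m \<le> norm x"
proof -
  define d where "d = (INF x\<in>S. norm x)"
  have bdd: "bdd_below (norm ` S)" by (auto intro!: bdd_belowI[of _ 0])
  have d: "d \<le> norm x" if "x \<in> S" for x unfolding d_def by (rule cINF_lower[OF bdd that])
  have d0: "0 \<le> d" unfolding d_def using assms(3) by (intro cINF_greatest) auto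
  have "\<exists>x\<in>S. norm x < d + 1 / real (Suc n)" for n
    using cINF_less_iff[OF assms(3) bdd, of "d + 1 / real (Suc n)"] by (simp add: d_def)
  then obtain x where xS: "\<And>n. x n \<in> S" and x: "\<And>n. norm (x n) < d + 1 / real (Suc n)" by metis
  have lim: "(\<lambda>n. norm (x n)) \<longlonglongrightarrow> d"
  proof (rule tendsto_sandwich[of "\<lambda>_. d" _ _ "\<lambda>n. d + 1 / real (Suc n)"])
    show "(\<lambda>n. d + 1 / real (Suc n)) \<longlonglongrightarrow> d"
      using tendsto_add[OF tendsto_const LIMSEQ_inverse_real_of_nat, of d] by (simp add: inverse_eq_divide)
  qed (use d xS x less_imp_le in \<open>blast intro: always_eventually\<close>)+
  have "Cauchy x"
  proof (rule CauchyI)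
    fix e :: real assume e: "e > 0"
    have "(\<lambda>n. (norm (x n))\<^sup>2) \<longlonglongrightarrow> d\<^sup>2" by (intro tendsto_intros lim)
    moreover have "d\<^sup>2 < d\<^sup>2 + e\<^sup>2 / 4" using e by simp
    ultimately have "\<forall>\<^sub>F n in sequentially. (norm (x n))\<^sup>2 < d\<^sup>2 + e\<^sup>2 / 4"
      by (rule order_tendstoD)
    \<comment> \<open>If both squared norms are below \<open>d\<^sup>2 + e\<^sup>2 / 4\<close>, the
      parallelogram law leaves less than \<open>e\<^sup>2\<close> for the squared
      difference.\<close>
    then obtain N where N: "\<And>n. n \<ge> N \<Longrightarrow> (norm (x n))\<^sup>2 < d\<^sup>2 + e\<^sup>2 / 4"
      by (auto simp: eventually_sequentially)
    have "norm (x m - x n) < e" if "m \<ge> N" "n \<ge> N" for m n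
    proof -
      have "(1/2) *\<^sub>R x m + (1/2) *\<^sub>R x n \<in> S"
        using convexD[OF assms(2) xS xS, of "1/2" "1/2"] by simp
      then have "d \<le> norm ((1/2) *\<^sub>R (x m + x n))" using d by (simp add: scaleR_add_right)
      then have "2 * d \<le> norm (x m + x n)" by simp
      then have "(2 * d)\<^sup>2 \<le> (norm (x m + x n))\<^sup>2" using d0 by (intro power_mono) auto
      then have "(norm (x m - x n))\<^sup>2 < e\<^sup>2"
        using parallelogram_law[of "x m" "x n"] N[OF that(1)] N[OF that(2)]
        by (simp add: power_mult_distrib)
      then show ?thesis using e by (simp add: power_less_imp_less_base)
    qed
    then show "\<exists>M. \<forall>m\<ge>M. \<forall>n\<ge>M. norm (x m - x n) < e" by blast
  qed
  then obtain m where m: "x \<longlonglongrightarrow> m" using Cauchy_convergent_iff convergent_def by blast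
  then have "m \<in> S" using assms(1) xS closed_sequentially by blast
  moreover have "norm m = d" using LIMSEQ_unique[OF tendsto_norm[OF m] lim] .
  ultimately show ?thesis using that d by auto
qed

text \<open>The representing vector is orthogonal to the kernel of \<phi>. It is found as the
  shortest point \<open>m\<close> of the affine hyperplane on which \<phi> equals 1, divided by
  \<open>(norm m)\<^sup>2\<close>.\<close>

lemma Riesz_representation:
  fixes \<phi> :: "'a::complex_hilbert \<Rightarrow> complex"
  assumes bl: "bounded_linear \<phi>" and cl: "\<And>c x. \<phi> (c *\<^sub>C x) = c * \<phi> x"
  obtains z where "\<And>x. \<phi> x = cinner x z"
proof (cases "\<forall>x. \<phi> x = 0")
  case True
  then show ?thesis using that[of 0] by simp
next
  case False
  interpret bounded_linear \<phi> by fact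
  from False obtain y where y: "\<phi> y \<noteq> 0" by blast
  define S where "S = {x. \<phi> x = 1}"
  have "closed S" unfolding S_def
    by (intro closed_Collect_eq continuous_on_const linear_continuous_on bl)
  moreover have "convex S"
    unfolding S_def convex_def by (auto simp: add scaleR simp flip: scaleR_left_distrib)
  moreover have "(1 / \<phi> y) *\<^sub>C y \<in> S" using y by (simp add: S_def cl)
  ultimately obtain m where m: "m \<in> S" "\<And>x. x \<in> S \<Longrightarrow> norm m \<le> norm x"
    using minimal_norm_point[of S] by blast
  \<comment> \<open>If a kernel vector \<open>k\<close> were not orthogonal to \<open>m\<close>,
    subtracting from \<open>m\<close> its projection onto \<open>k\<close> would give a shorter
    point of \<open>S\<close>.\<close>
  have orth: "cinner k m = 0" if k: "\<phi> k = 0" for k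
  proof (rule ccontr)
    assume ne: "cinner k m \<noteq> 0"
    then have nk: "norm k > 0" by auto
    define c where "c = cinner m k / of_real ((norm k)\<^sup>2)"
    have "m - c *\<^sub>C k \<in> S" using m(1) k by (simp add: S_def diff cl)
    then have le: "(norm m)\<^sup>2 \<le> (norm (m - c *\<^sub>C k))\<^sup>2" using m(2) by (intro power_mono) auto
    have r: "cinner m (c *\<^sub>C k) = of_real ((cmod (cinner m k))\<^sup>2 / (norm k)\<^sup>2)"
      by (simp add: c_def cinner_simps mult_cnj_cmod mult.commute)
    have n: "(norm (c *\<^sub>C k))\<^sup>2 = (cmod (cinner m k))\<^sup>2 / (norm k)\<^sup>2"
      using nk by (simp add: c_def norm_scaleC norm_divide power_divide field_simps norm_power)
    have "(cmod (cinner m k))\<^sup>2 / (norm k)\<^sup>2 \<le> 0"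
      using le unfolding power2_norm_diff r n by simp
    then have "cinner m k = 0" using nk by (simp add: divide_le_0_iff)
    then show False using ne by (metis cinner_commute complex_cnj_zero)
  qed
  have m0: "m \<noteq> 0" using m(1) zero by (auto simp: S_def)
  have "\<phi> x = cinner x ((1 / (norm m)\<^sup>2) *\<^sub>R m)" for x
  proof -
    have "\<phi> (x - \<phi> x *\<^sub>C m) = 0" using m(1) by (simp add: diff cl S_def)
    from orth[OF this] have "cinner x m = \<phi> x * cinner m m" by (simp add: cinner_simps)
    then show ?thesis using m0 by (simp add: cinner_simps cinner_self)
  qed
  then show ?thesis by (rule that)
qed

lemma bounded_opsD: "a \<in> bounded_ops \<Longrightarrow> blinfun_apply a (c *\<^sub>C x) = c *\<^sub>C blinfun_apply a x"
  by (simp add: bounded_ops_def)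

text \<open>Riesz gives the value at each \<open>y\<close>. Linearity follows from the uniqueness of
  the representing vector, and boundedness from pairing \<open>f x\<close> with itself.\<close>

lemma adjoint_op_exists:
  fixes a :: "'h::complex_hilbert \<Rightarrow>\<^sub>L 'h"
  assumes a: "a \<in> bounded_ops"
  obtains b where "\<And>x y. cinner (blinfun_apply a x) y = cinner x (blinfun_apply b y)"
proof -
  have "\<exists>z. \<forall>x. cinner (blinfun_apply a x) y = cinner x z" for y
  proof -
    have "bounded_linear (\<lambda>x. cinner (blinfun_apply a x) y)"
      by (rule bounded_linear_compose[OF bounded_linear_cinner_left blinfun.bounded_linear_right])
    then show ?thesis
      by (rule Riesz_representation) (auto simp: bounded_opsD[OF a] cinner_simps)
  qed
  then obtain f where f: "\<And>x y. cinner (blinfun_apply a x) y = cinner x (f y)" by metis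
  have "bounded_linear f"
  proof (rule bounded_linear_intro[of _ "norm a"])
    show "f (x + y) = f x + f y" for x y
      by (rule cinner_ext_right) (simp add: cinner_simps flip: f)
    show "f (r *\<^sub>R x) = r *\<^sub>R f x" for r x
      by (rule cinner_ext_right) (simp add: cinner_simps flip: f)
    show "norm (f x) \<le> norm x * norm a" for x
    proof (cases "f x = 0")
      case False
      have "(norm (f x))\<^sup>2 = Re (cinner (blinfun_apply a (f x)) x)"
        by (simp add: f power2_norm_eq_cinner)
      also have "\<dots> \<le> norm (blinfun_apply a (f x)) * norm x"
        by (rule order_trans[OF complex_Re_le_cmod cinner_Cauchy_Schwarz])
      also have "\<dots> \<le> (norm a * norm (f x)) * norm x"
        by (intro mult_right_mono norm_blinfun) auto
      finally show ?thesis using False by (simp add: power2_eq_square mult.commute mult.left_commute)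
    qed simp
  qed
  then have "blinfun_apply (Blinfun f) = f" by (rule bounded_linear_Blinfun_apply)
  then show ?thesis using that[of "Blinfun f"] f by simp
qed

lemma adjoint_op_eqI:
  assumes "\<And>x y. cinner (blinfun_apply a x) y = cinner x (blinfun_apply b y)"
  shows "adjoint_op a = b"
  unfolding adjoint_op_def
proof (rule the_equality)
  fix b' assume "\<forall>x y. cinner (blinfun_apply a x) y = cinner x (blinfun_apply b' y)"
  then show "b' = b" using assms by (intro blinfun_eqI cinner_ext_right) metis
qed (use assms in blast)

lemma cinner_adjoint_op:
  "a \<in> bounded_ops \<Longrightarrow> cinner (blinfun_apply a x) y = cinner x (blinfun_apply (adjoint_op a) y)"
  using adjoint_op_exists[of a] adjoint_op_eqI by metis

text \<open>Polarisation: the form is real at \<open>x + y\<close> and at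
  \<open>x + \<i> *\<^sub>C y\<close>, and the two facts give the imaginary and the real part of the
  symmetry.\<close>

lemma positive_ops_symmetric:
  fixes a :: "'h::complex_hilbert \<Rightarrow>\<^sub>L 'h"
  assumes a: "a \<in> positive_ops"
  shows "cinner (blinfun_apply a x) y = cinner x (blinfun_apply a y)"
proof -
  let ?a = "blinfun_apply a"
  have sc: "?a (c *\<^sub>C x) = c *\<^sub>C ?a x" for c x
    using a by (simp add: positive_ops_def bounded_ops_def)
  have re: "Im (cinner (?a x) x) = 0" for x
    using a by (auto simp: positive_ops_def complex_nonneg_Reals_iff)
  have i1: "Im (cinner (?a x) y) + Im (cinner (?a y) x) = 0" for x y
    using re[of "x + y"] re[of x] re[of y] by (simp add: cinner_simps blinfun.add_right)
  have i2: "Re (cinner (?a x) y) = Re (cinner (?a y) x)" for x y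
    using i1[of x "\<i> *\<^sub>C y"] by (simp add: cinner_simps sc)
  have "cinner (?a x) y = cnj (cinner (?a y) x)"
    using i1[of x y] i2[of x y] by (simp add: complex_eq_iff)
  then show ?thesis by (simp add: cinner_commute[of x])
qed

section \<open>Orthonormal families\<close>

text \<open>Indexed families instead of sets: one notion serves infinite sequences, finite pieces of
  them and, with the identity as the family, finite sets.\<close>

definition orthonormal_on :: "'i set \<Rightarrow> ('i \<Rightarrow> 'a::complex_inner) \<Rightarrow> bool" where
  "orthonormal_on I e \<longleftrightarrow> (\<forall>i\<in>I. \<forall>j\<in>I. cinner (e i) (e j) = (if i = j then 1 else 0))"

abbreviation orthonormal :: "('i \<Rightarrow> 'a::complex_inner) \<Rightarrow> bool" where
  "orthonormal \<equiv> orthonormal_on UNIV"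

lemma orthonormal_onD:
  "orthonormal_on I e \<Longrightarrow> i \<in> I \<Longrightarrow> j \<in> I \<Longrightarrow> cinner (e i) (e j) = (if i = j then 1 else 0)"
  by (simp add: orthonormal_on_def)

lemma orthonormal_on_subset: "orthonormal_on J e \<Longrightarrow> I \<subseteq> J \<Longrightarrow> orthonormal_on I e"
  unfolding orthonormal_on_def by blast

lemma orthonormal_on_norm: "orthonormal_on I e \<Longrightarrow> i \<in> I \<Longrightarrow> norm (e i) = 1"
  by (simp add: norm_eq_sqrt_cinner orthonormal_onD)

lemma cinner_orthonormal_sum:
  assumes "orthonormal_on I e" "finite I" "j \<in> I"
  shows "cinner (\<Sum>i\<in>I. c i *\<^sub>C e i) (e j) = c j"
proof -
  have "cinner (\<Sum>i\<in>I. c i *\<^sub>C e i) (e j) = (\<Sum>i\<in>I. if i = j then c i else 0)"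
    unfolding cinner_sum_left by (rule sum.cong) (auto simp: cinner_simps orthonormal_onD[OF assms(1) _ assms(3)])
  then show ?thesis using assms by simp
qed

lemma norm_orthonormal_sum:
  assumes "orthonormal_on I e" "finite I"
  shows "(norm (\<Sum>i\<in>I. c i *\<^sub>C e i))\<^sup>2 = (\<Sum>i\<in>I. (cmod (c i))\<^sup>2)"
proof -
  have "cinner (\<Sum>i\<in>I. c i *\<^sub>C e i) (\<Sum>i\<in>I. c i *\<^sub>C e i) = (\<Sum>i\<in>I. of_real ((cmod (c i))\<^sup>2))"
    unfolding cinner_sum_right[of _ _ I]
    by (rule sum.cong) (auto simp: cinner_simps cinner_orthonormal_sum[OF assms] mult.commute[of "cnj _"] mult_cnj_cmod)
  then show ?thesis unfolding power2_norm_eq_cinner by simp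
qed

lemma orthonormal_residual:
  assumes "orthonormal_on I e" "finite I" "j \<in> I"
  shows "cinner (x - (\<Sum>i\<in>I. cinner x (e i) *\<^sub>C e i)) (e j) = 0"
  by (simp add: cinner_diff_left cinner_orthonormal_sum[OF assms])

text \<open>Both bounds come from one Pythagorean identity. The bound on the residual controls the
  tail of the spectral expansion later.\<close>

lemma Bessel_inequality:
  assumes "orthonormal_on I e" "finite I"
  shows "(\<Sum>i\<in>I. (cmod (cinner x (e i)))\<^sup>2) \<le> (norm x)\<^sup>2"
    and "norm (x - (\<Sum>i\<in>I. cinner x (e i) *\<^sub>C e i)) \<le> norm x"
proof -
  let ?p = "\<Sum>i\<in>I. cinner x (e i) *\<^sub>C e i"
  have "cinner (x - ?p) ?p = (\<Sum>i\<in>I. cnj (cinner x (e i)) * cinner (x - ?p) (e i))"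
    by (simp add: cinner_sum_right cinner_scaleC_right)
  also have "\<dots> = 0" by (rule sum.neutral) (simp add: orthonormal_residual[OF assms])
  finally have *: "(norm x)\<^sup>2 = (norm (x - ?p))\<^sup>2 + (norm ?p)\<^sup>2"
    using power2_norm_add[of "x - ?p" ?p] by simp
  then show "(\<Sum>i\<in>I. (cmod (cinner x (e i)))\<^sup>2) \<le> (norm x)\<^sup>2"
    unfolding norm_orthonormal_sum[OF assms] by simp
  from * have "(norm (x - ?p))\<^sup>2 \<le> (norm x)\<^sup>2" by simp
  then show "norm (x - ?p) \<le> norm x" by (rule power2_le_imp_le) simp
qed

lemma orthonormal_sum_in_span:
  "(\<Sum>i\<in>I. c i *\<^sub>C e i) \<in> complex_vector.span (e ` I)"
  by (intro complex_vector.span_sum complex_vector.span_scale complex_vector.span_base) auto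

lemma orthonormal_span_expansion:
  assumes "orthonormal_on I e" "finite I" "x \<in> complex_vector.span (e ` I)"
  shows "x = (\<Sum>i\<in>I. cinner x (e i) *\<^sub>C e i)"
  using assms(3)
proof (induction rule: complex_vector.span_induct_alt)
  case (step c b y)
  then obtain j where j: "j \<in> I" "b = e j" by blast
  have "(\<Sum>i\<in>I. cinner (c *\<^sub>C b + y) (e i) *\<^sub>C e i)
      = c *\<^sub>C (\<Sum>i\<in>I. cinner b (e i) *\<^sub>C e i) + (\<Sum>i\<in>I. cinner y (e i) *\<^sub>C e i)"
    by (simp add: cinner_simps scaleC_add_left sum.distrib complex_vector.scale_sum_right scaleC_scaleC)
  also have "(\<Sum>i\<in>I. cinner b (e i) *\<^sub>C e i) = (\<Sum>i\<in>I. if i = j then e i else 0)"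
    unfolding j by (rule sum.cong) (auto simp: orthonormal_onD[OF assms(1) j(1)] scaleC_one)
  also have "\<dots> = b" using j assms by simp
  finally show ?case using step by simp
qed simp

lemma Gram_Schmidt:
  fixes B :: "'a::complex_inner set"
  assumes "finite B"
  obtains E where "finite E" "orthonormal_on E (\<lambda>x. x)" "B \<subseteq> complex_vector.span E"
  using assms
proof (induction B arbitrary: thesis)
  case empty
  then show ?case by (auto simp: orthonormal_on_def)
next
  case (insert b B)
  obtain E where E: "finite E" "orthonormal_on E (\<lambda>x. x)" "B \<subseteq> complex_vector.span E"
    using insert.IH by blast
  let ?p = "\<Sum>i\<in>E. cinner b i *\<^sub>C i"
  \<comment> \<open>The residual is the new direction; if it vanishes, \<open>b\<close> already lies
    in the span and nothing is added.\<close>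
  define r where "r = b - ?p"
  have p: "?p \<in> complex_vector.span E"
    using orthonormal_sum_in_span[of _ "\<lambda>x. x" E] by simp
  show ?case
  proof (cases "r = 0")
    case True
    then have "b \<in> complex_vector.span E" using p by (simp add: r_def)
    then show ?thesis using insert.prems[OF E(1,2)] E(3) by simp
  next
    case False
    define u where "u = (1 / norm r) *\<^sub>R r"
    have orth: "cinner r j = 0" if "j \<in> E" for j
      using orthonormal_residual[OF E(2,1) that, of b] by (simp add: r_def)
    have orth': "cinner u j = 0" "cinner j u = 0" if "j \<in> E" for j
      using orth[OF that] cinner_commute[of j r] by (simp_all add: u_def cinner_simps)
    have uu: "cinner u u = 1"
      using False by (simp add: u_def cinner_simps cinner_self power2_eq_square)
    have "orthonormal_on (insert u E) (\<lambda>x. x)"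
      using E(2) orth' uu by (auto simp: orthonormal_on_def)
    moreover define p where "p = ?p"
    have b: "b = p + complex_of_real (norm r) *\<^sub>C u"
      using False by (simp add: r_def u_def scaleC_of_real p_def)
    have "b \<in> complex_vector.span (insert u E)"
      unfolding b using p[folded p_def] complex_vector.span_mono[of E "insert u E"]
      by (blast intro: complex_vector.span_add complex_vector.span_scale complex_vector.span_base)
    moreover have "B \<subseteq> complex_vector.span (insert u E)"
      using E(3) complex_vector.span_mono[of E "insert u E"] by blast
    ultimately show ?thesis using insert.prems[of "insert u E"] E(1) by simp
  qed
qed

text \<open>Infinite dimension enters here: a finite family never spans the space, so the choice of
  further eigenvectors never stops.\<close>

lemma exists_unit_orthogonal:
  fixes e :: "'i \<Rightarrow> 'a::complex_inner"
  assumes inf: "\<nexists>B::'a set. finite B \<and> complex_vector.span B = UNIV"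
    and "orthonormal_on I e" "finite I"
  obtains v where "norm v = 1" "\<And>i. i \<in> I \<Longrightarrow> cinner v (e i) = 0"
proof -
  have "complex_vector.span (e ` I) \<noteq> UNIV" using inf assms(3) by blast
  then obtain b where b: "b \<notin> complex_vector.span (e ` I)" by blast
  define r where "r = b - (\<Sum>i\<in>I. cinner b (e i) *\<^sub>C e i)"
  have r0: "r \<noteq> 0" using b orthonormal_sum_in_span[of "\<lambda>i. cinner b (e i)" e I] by (auto simp: r_def)
  have "cinner ((1 / norm r) *\<^sub>R r) (e i) = 0" if "i \<in> I" for i
    using orthonormal_residual[OF assms(2,3) that, of b] by (simp add: r_def cinner_simps)
  moreover have "norm ((1 / norm r) *\<^sub>R r) = 1" using r0 by simp
  ultimately show ?thesis using that by blast
qed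

text \<open>The dimension count behind the upper half of the minimax principle. Injectivity on the
  span of \<open>B\<close> would produce more independent vectors in the span of \<open>C\<close>
  than \<open>C\<close> has elements.\<close>

lemma complex_linear_kernel_nontrivial:
  fixes f :: "'a::complex_inner \<Rightarrow> 'b::complex_inner"
  assumes add: "\<And>x y. f (x + y) = f x + f y" and scale: "\<And>c x. f (c *\<^sub>C x) = c *\<^sub>C f x"
    and B: "complex_vector.independent B" and C: "finite C" "card C < card B"
    and sub: "f ` B \<subseteq> complex_vector.span C"
  obtains v where "v \<in> complex_vector.span B" "v \<noteq> 0" "f v = 0"
proof -
  interpret P: vector_space_pair "scaleC :: _ \<Rightarrow> 'a \<Rightarrow> _" "scaleC :: _ \<Rightarrow> 'b \<Rightarrow> _"
    by unfold_locales
  interpret L: Vector_Spaces.linear "scaleC :: _ \<Rightarrow> 'a \<Rightarrow> _" "scaleC :: _ \<Rightarrow> 'b \<Rightarrow> _" f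
    by unfold_locales (use add scale in auto)
  show ?thesis
  proof (cases "inj_on f (complex_vector.span B)")
    case True
    then have "complex_vector.independent (f ` B)"
      by (rule L.independent_injective_image[OF B])
    then have "card (f ` B) \<le> card C"
      using complex_vector.independent_span_bound[OF C(1) _ sub] by blast
    moreover have "card (f ` B) = card B"
      by (rule card_image) (rule inj_on_subset[OF True complex_vector.span_superset])
    ultimately show ?thesis using C by simp
  next
    case False
    then obtain x y where xy: "x \<in> complex_vector.span B" "y \<in> complex_vector.span B" "x \<noteq> y" "f x = f y"
      by (auto simp: inj_on_def)
    then show ?thesis
      using that[of "x - y"] by (auto intro: complex_vector.span_diff simp: L.diff)
  qed
qed

section \<open>Diagonal operators\<close>

definition proj1 :: "'h::complex_hilbert \<Rightarrow> 'h \<Rightarrow>\<^sub>L 'h" where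
  "proj1 e = Blinfun (\<lambda>x. cinner x e *\<^sub>C e)"

lemma proj1_apply [simp]: "blinfun_apply (proj1 e) x = cinner x e *\<^sub>C e"
  unfolding proj1_def
  by (subst bounded_linear_Blinfun_apply)
    (auto intro: bounded_linear_compose[OF bounded_linear_scaleC_left bounded_linear_cinner_left])

section \<open>Complex linearity under algebraic operations and norm limits\<close>

lemma bounded_ops_proj1: "proj1 e \<in> bounded_ops"
  by (simp add: bounded_ops_def cinner_simps scaleC_scaleC)

lemma bounded_ops_add: "a \<in> bounded_ops \<Longrightarrow> b \<in> bounded_ops \<Longrightarrow> a + b \<in> bounded_ops"
  by (simp add: bounded_ops_def blinfun.add_left scaleC_add_right)

lemma bounded_ops_scaleR: "a \<in> bounded_ops \<Longrightarrow> r *\<^sub>R a \<in> bounded_ops"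
  by (simp add: bounded_ops_def blinfun.scaleR_left scaleC_scaleR)

lemma bounded_ops_diff: "a \<in> bounded_ops \<Longrightarrow> b \<in> bounded_ops \<Longrightarrow> a - b \<in> bounded_ops"
  by (simp add: bounded_ops_def blinfun.diff_left complex_vector.scale_right_diff_distrib)

lemma bounded_ops_id: "id_blinfun \<in> bounded_ops"
  by (simp add: bounded_ops_def)

lemma bounded_ops_compose: "a \<in> bounded_ops \<Longrightarrow> b \<in> bounded_ops \<Longrightarrow> a o\<^sub>L b \<in> bounded_ops"
  by (simp add: bounded_ops_def)

lemma bounded_ops_zero: "0 \<in> bounded_ops"
  by (simp add: bounded_ops_def)

lemma bounded_ops_sum: "(\<And>i. i \<in> I \<Longrightarrow> a i \<in> bounded_ops) \<Longrightarrow> sum a I \<in> bounded_ops"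
  by (induction I rule: infinite_finite_induct) (auto intro: bounded_ops_add bounded_ops_zero)

lemma blinfun_apply_tendsto:
  "(a \<longlongrightarrow> b) F \<Longrightarrow> ((\<lambda>n. blinfun_apply (a n) x) \<longlongrightarrow> blinfun_apply b x) F"
  by (rule bounded_linear.tendsto[OF blinfun.bounded_linear_left])

lemma bounded_ops_limit:
  assumes "\<And>n. a n \<in> bounded_ops" "a \<longlonglongrightarrow> b"
  shows "b \<in> bounded_ops"
  unfolding bounded_ops_def
proof (intro CollectI allI)
  fix c x
  have "(\<lambda>n. blinfun_apply (a n) (c *\<^sub>C x)) \<longlonglongrightarrow> blinfun_apply b (c *\<^sub>C x)"
    by (intro blinfun_apply_tendsto assms)
  moreover have "(\<lambda>n. blinfun_apply (a n) (c *\<^sub>C x)) \<longlonglongrightarrow> c *\<^sub>C blinfun_apply b x"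
    unfolding bounded_opsD[OF assms(1)]
    by (intro bounded_linear.tendsto[OF bounded_linear_scaleC] blinfun_apply_tendsto assms)
  ultimately show "blinfun_apply b (c *\<^sub>C x) = c *\<^sub>C blinfun_apply b x" by (rule LIMSEQ_unique)
qed

text \<open>The sequence \<open>e\<close> may be incomplete, and vectors orthogonal to it are sent
  to 0. The infinite sum is taken in operator norm and converges for orthonormal \<open>e\<close>
  and null \<open>c\<close>.\<close>

definition diag_op :: "(nat \<Rightarrow> 'h::complex_hilbert) \<Rightarrow> (nat \<Rightarrow> real) \<Rightarrow> 'h \<Rightarrow>\<^sub>L 'h" where
  "diag_op e c = (\<Sum>n. c n *\<^sub>R proj1 (e n))"

text \<open>By orthogonality the norm depends on the largest coefficient and not on the number of
  terms. This is why a null sequence suffices for convergence in norm.\<close>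

lemma norm_finite_diag_le:
  assumes e: "orthonormal_on I e" and I: "finite I" and c: "\<And>n. n \<in> I \<Longrightarrow> \<bar>c n\<bar> \<le> M" and M: "0 \<le> M"
  shows "norm (\<Sum>n\<in>I. c n *\<^sub>R proj1 (e n)) \<le> M"
proof (rule norm_blinfun_bound[OF M])
  fix x
  have "blinfun_apply (\<Sum>n\<in>I. c n *\<^sub>R proj1 (e n)) x = (\<Sum>n\<in>I. (of_real (c n) * cinner x (e n)) *\<^sub>C e n)"
    by (simp add: blinfun.sum_left blinfun.scaleR_left scaleC_scaleC flip: scaleC_of_real)
  then have "(norm (blinfun_apply (\<Sum>n\<in>I. c n *\<^sub>R proj1 (e n)) x))\<^sup>2
      = (\<Sum>n\<in>I. \<bar>c n\<bar>\<^sup>2 * (cmod (cinner x (e n)))\<^sup>2)"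
    by (simp add: norm_orthonormal_sum[OF e I] norm_mult power_mult_distrib)
  also have "\<dots> \<le> (\<Sum>n\<in>I. M\<^sup>2 * (cmod (cinner x (e n)))\<^sup>2)"
    by (intro sum_mono mult_right_mono power_mono c) auto
  also have "\<dots> \<le> M\<^sup>2 * (norm x)\<^sup>2"
    unfolding sum_distrib_left[symmetric] by (intro mult_left_mono Bessel_inequality[OF e I]) auto
  finally have "(norm (blinfun_apply (\<Sum>n\<in>I. c n *\<^sub>R proj1 (e n)) x))\<^sup>2 \<le> (M * norm x)\<^sup>2"
    by (simp add: power_mult_distrib)
  then show "norm (blinfun_apply (\<Sum>n\<in>I. c n *\<^sub>R proj1 (e n)) x) \<le> M * norm x"
    by (rule power2_le_imp_le) (use M in auto)
qed

lemma diag_op_sums: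
  assumes e: "orthonormal e" and c: "c \<longlonglongrightarrow> 0"
  shows "(\<lambda>n. c n *\<^sub>R proj1 (e n)) sums diag_op e c"
  unfolding diag_op_def
proof (rule summable_sums, subst summable_Cauchy, intro allI impI)
  fix r :: real assume r: "r > 0"
  from LIMSEQ_D[OF c, of "r/2"] r obtain N where N: "\<And>n. n \<ge> N \<Longrightarrow> \<bar>c n\<bar> < r/2" by auto
  have "norm (\<Sum>k=m..<n. c k *\<^sub>R proj1 (e k)) < r" if "m \<ge> N" for m n
    using norm_finite_diag_le[OF orthonormal_on_subset[OF e], of "{m..<n}" c "r/2"] N r that
    by (force intro: less_imp_le)
  then show "\<exists>N. \<forall>m\<ge>N. \<forall>n. norm (\<Sum>k=m..<n. c k *\<^sub>R proj1 (e k)) < r" by blast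
qed

lemma diag_op_eqI: "(\<lambda>n. c n *\<^sub>R proj1 (e n)) sums a \<Longrightarrow> diag_op e c = a"
  unfolding diag_op_def by (rule sums_unique[symmetric])

lemma diag_op_apply_sums:
  assumes "orthonormal e" "c \<longlonglongrightarrow> 0"
  shows "(\<lambda>n. (of_real (c n) * cinner x (e n)) *\<^sub>C e n) sums blinfun_apply (diag_op e c) x"
  using bounded_linear.sums[OF blinfun.bounded_linear_left diag_op_sums[OF assms], of x]
  by (simp add: blinfun.scaleR_left scaleC_scaleC flip: scaleC_of_real)

lemma diag_op_basis:
  assumes "orthonormal e" "c \<longlonglongrightarrow> 0"
  shows "blinfun_apply (diag_op e c) (e m) = c m *\<^sub>R e m"
proof -
  have "(\<lambda>n. (of_real (c n) * cinner (e m) (e n)) *\<^sub>C e n) = (\<lambda>n. if n = m then c m *\<^sub>R e m else 0)"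
    using assms(1) by (auto simp: orthonormal_onD scaleC_of_real)
  then have "(\<lambda>n. if n = m then c m *\<^sub>R e m else 0) sums blinfun_apply (diag_op e c) (e m)"
    using diag_op_apply_sums[OF assms, of "e m"] by simp
  then show ?thesis using sums_single[of m "\<lambda>_. c m *\<^sub>R e m"] sums_unique2 by blast
qed

lemma diag_op_quadratic_form_sums:
  assumes "orthonormal e" "c \<longlonglongrightarrow> 0"
  shows "(\<lambda>n. of_real (c n * (cmod (cinner x (e n)))\<^sup>2)) sums cinner (blinfun_apply (diag_op e c) x) x"
proof -
  have "cinner ((of_real (c n) * cinner x (e n)) *\<^sub>C e n) x = of_real (c n * (cmod (cinner x (e n)))\<^sup>2)" for n
    using cinner_commute[of "e n" x] mult_cnj_cmod[of "cinner x (e n)"] by (simp add: cinner_simps)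
  then show ?thesis
    using bounded_linear.sums[OF bounded_linear_cinner_left diag_op_apply_sums[OF assms], of x x]
    by simp
qed

lemma norm_diag_op_le:
  assumes "orthonormal e" "c \<longlonglongrightarrow> 0" "\<And>n. \<bar>c n\<bar> \<le> M"
  shows "norm (diag_op e c) \<le> M"
proof -
  have "0 \<le> M" using assms(3)[of 0] by linarith
  moreover have "(\<lambda>n. norm (\<Sum>k<n. c k *\<^sub>R proj1 (e k))) \<longlonglongrightarrow> norm (diag_op e c)"
    using diag_op_sums[OF assms(1,2)] by (intro tendsto_norm) (simp add: sums_def)
  ultimately show ?thesis
    using norm_finite_diag_le[OF orthonormal_on_subset[OF assms(1)] _ assms(3)]
    by (intro LIMSEQ_le_const2[of _ "norm (diag_op e c)"]) auto
qed

lemma diag_op_add: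
  assumes "orthonormal e" "c \<longlonglongrightarrow> 0" "d \<longlonglongrightarrow> 0"
  shows "diag_op e (\<lambda>n. c n + d n) = diag_op e c + diag_op e d"
  using sums_add[OF diag_op_sums[OF assms(1,2)] diag_op_sums[OF assms(1,3)]]
  by (intro diag_op_eqI) (simp add: scaleR_left_distrib)

lemma diag_op_diff:
  assumes "orthonormal e" "c \<longlonglongrightarrow> 0" "d \<longlonglongrightarrow> 0"
  shows "diag_op e (\<lambda>n. c n - d n) = diag_op e c - diag_op e d"
  using sums_diff[OF diag_op_sums[OF assms(1,2)] diag_op_sums[OF assms(1,3)]]
  by (intro diag_op_eqI) (simp add: scaleR_left_diff_distrib)

lemma diag_op_scaleR:
  assumes "orthonormal e" "c \<longlonglongrightarrow> 0"
  shows "diag_op e (\<lambda>n. r * c n) = r *\<^sub>R diag_op e c"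
  using sums_scaleR_right[OF diag_op_sums[OF assms], of r]
  by (intro diag_op_eqI) simp

lemma diag_op_zero: "diag_op e (\<lambda>n. 0) = 0"
  by (rule diag_op_eqI) simp

lemma bounded_ops_diag_op:
  assumes "orthonormal e" "c \<longlonglongrightarrow> 0"
  shows "diag_op e c \<in> bounded_ops"
  by (rule bounded_ops_limit[OF _ diag_op_sums[OF assms, unfolded sums_def]])
    (intro bounded_ops_sum bounded_ops_scaleR bounded_ops_proj1)

lemma diag_op_compose:
  assumes e: "orthonormal e" and c: "c \<longlonglongrightarrow> 0" and d: "d \<longlonglongrightarrow> 0"
  shows "diag_op e c o\<^sub>L diag_op e d = diag_op e (\<lambda>n. c n * d n)"
proof -
  have "diag_op e c o\<^sub>L proj1 (e n) = c n *\<^sub>R proj1 (e n)" for n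
    by (rule blinfun_eqI) (simp add: bounded_opsD[OF bounded_ops_diag_op[OF e c]] diag_op_basis[OF e c] scaleC_scaleR blinfun.scaleR_left)
  then have "diag_op e c o\<^sub>L (d n *\<^sub>R proj1 (e n)) = (c n * d n) *\<^sub>R proj1 (e n)" for n
    by (simp add: bounded_bilinear.scaleR_right[OF bounded_bilinear_blinfun_compose] mult.commute)
  then show ?thesis
    using bounded_linear.sums[OF bounded_bilinear.bounded_linear_right[OF bounded_bilinear_blinfun_compose]
        diag_op_sums[OF e d], of "diag_op e c"]
    by (intro diag_op_eqI[symmetric]) simp
qed

lemma positive_ops_diag_op:
  assumes "orthonormal e" "c \<longlonglongrightarrow> 0" "\<And>n. 0 \<le> c n"
  shows "diag_op e c \<in> positive_ops"
proof -
  have "cinner (blinfun_apply (diag_op e c) x) x \<in> \<real>\<^sub>\<ge>\<^sub>0" for x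
  proof -
    note s = diag_op_quadratic_form_sums[OF assms(1,2), of x]
    have "0 \<le> Re (cinner (blinfun_apply (diag_op e c) x) x)"
      using sums_Re[OF s] by (rule sums_le[OF _ sums_zero, rotated]) (use assms in auto)
    moreover have "Im (cinner (blinfun_apply (diag_op e c) x) x) = 0"
      using sums_unique2[OF sums_Im[OF s]] by simp
    ultimately show ?thesis by (simp add: complex_nonneg_Reals_iff)
  qed
  then show ?thesis using bounded_ops_diag_op[OF assms(1,2)] by (simp add: positive_ops_def)
qed

lemma diag_op_finite:
  assumes "\<And>n. n \<ge> N \<Longrightarrow> c n = 0"
  shows "diag_op e c = (\<Sum>n<N. c n *\<^sub>R proj1 (e n))"
  by (rule diag_op_eqI, rule sums_finite) (use assms in \<open>auto simp: not_less\<close>)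

section \<open>Compactness of diagonal and finite rank operators\<close>

lemma compact_finite_combinations:
  fixes e :: "'i \<Rightarrow> 'a::complex_inner"
  assumes "finite I"
  shows "compact {\<Sum>i\<in>I. z i *\<^sub>C e i |z. \<forall>i\<in>I. cmod (z i) \<le> M}"
  using assms
proof (induction I)
  case (insert i I)
  let ?S = "{\<Sum>i\<in>I. z i *\<^sub>C e i |z. \<forall>i\<in>I. cmod (z i) \<le> M}"
  \<comment> \<open>A new index contributes the multiples of \<open>e i\<close> by a disc, so the
    set grows by a Minkowski sum of compact sets.\<close>
  let ?T = "(\<lambda>w. w *\<^sub>C e i) ` cball 0 M"
  have "compact ?T"
    by (intro compact_continuous_image linear_continuous_on bounded_linear_scaleC_left) auto
  then have "compact {x + y |x y. x \<in> ?T \<and> y \<in> ?S}" using insert.IH by (rule compact_sums)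
  moreover have "{x + y |x y. x \<in> ?T \<and> y \<in> ?S} = {\<Sum>j\<in>insert i I. z j *\<^sub>C e j |z. \<forall>j\<in>insert i I. cmod (z j) \<le> M}"
  proof (intro equalityI subsetI)
    fix v assume "v \<in> {x + y |x y. x \<in> ?T \<and> y \<in> ?S}"
    then obtain w z where wz: "cmod w \<le> M" "\<forall>j\<in>I. cmod (z j) \<le> M" "v = w *\<^sub>C e i + (\<Sum>j\<in>I. z j *\<^sub>C e j)"
      by auto
    have "(\<Sum>j\<in>insert i I. (z(i := w)) j *\<^sub>C e j) = v"
      using insert.hyps unfolding wz by simp (intro sum.cong, auto)
    then show "v \<in> {\<Sum>j\<in>insert i I. z j *\<^sub>C e j |z. \<forall>j\<in>insert i I. cmod (z j) \<le> M}"
      using wz by (intro CollectI exI[of _ "z(i := w)"]) auto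
  next
    fix v assume "v \<in> {\<Sum>j\<in>insert i I. z j *\<^sub>C e j |z. \<forall>j\<in>insert i I. cmod (z j) \<le> M}"
    then obtain z where z: "v = (\<Sum>j\<in>insert i I. z j *\<^sub>C e j)" "\<forall>j\<in>insert i I. cmod (z j) \<le> M" by blast
    then have "v = z i *\<^sub>C e i + (\<Sum>j\<in>I. z j *\<^sub>C e j)" using insert.hyps by simp
    moreover have "z i *\<^sub>C e i \<in> ?T" using z(2) by auto
    moreover have "(\<Sum>j\<in>I. z j *\<^sub>C e j) \<in> ?S" using z(2) by blast
    ultimately show "v \<in> {x + y |x y. x \<in> ?T \<and> y \<in> ?S}" by blast
  qed
  ultimately show ?case by simp
qed simp

text \<open>A finite truncation within \<open>r/4\<close> in norm maps the unit ball into a compact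
  set. An \<open>r/4\<close>-net of that set is an \<open>r/2\<close>-net of the full image.\<close>

lemma compact_diag_op:
  assumes e: "orthonormal e" and c: "c \<longlonglongrightarrow> 0"
  shows "compact (closure (blinfun_apply (diag_op e c) ` cball 0 1))"
  unfolding compact_eq_totally_bounded
proof (intro conjI allI impI)
  show "complete (closure (blinfun_apply (diag_op e c) ` cball 0 1))"
    by (simp add: complete_eq_closed)
next
  fix r :: real assume r: "r > 0"
  from Bseq_conv_Bfun convergent_imp_Bseq[of c] c obtain M where M: "\<And>n. \<bar>c n\<bar> \<le> M"
    by (auto simp: Bseq_def convergent_def)
  have "\<forall>\<^sub>F n in sequentially. dist (\<Sum>k<n. c k *\<^sub>R proj1 (e k)) (diag_op e c) < r/4"
    using diag_op_sums[OF e c] r unfolding sums_def by (intro tendstoD) auto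
  then obtain n where n: "dist (\<Sum>k<n. c k *\<^sub>R proj1 (e k)) (diag_op e c) < r/4"
    by (auto simp: eventually_sequentially)
  let ?f = "\<Sum>k<n. c k *\<^sub>R proj1 (e k)"
  let ?K = "{\<Sum>k<n. z k *\<^sub>C e k |z. \<forall>k\<in>{..<n}. cmod (z k) \<le> M}"
  have "compact ?K" by (rule compact_finite_combinations) simp
  then obtain k where k: "finite k" "?K \<subseteq> (\<Union>x\<in>k. ball x (r/4))"
    using r unfolding compact_eq_totally_bounded by (meson divide_pos_pos zero_less_numeral)
  have inK: "blinfun_apply ?f x \<in> ?K" if "norm x \<le> 1" for x
  proof -
    have "cmod (of_real (c k) * cinner x (e k)) \<le> M" for k
    proof -
      have "cmod (cinner x (e k)) \<le> 1"
        using cinner_Cauchy_Schwarz[of x "e k"] orthonormal_on_norm[OF e, of k] that by simp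
      then have "\<bar>c k\<bar> * cmod (cinner x (e k)) \<le> \<bar>c k\<bar>" by (simp add: mult_left_le)
      then show ?thesis using M[of k] by (simp add: norm_mult)
    qed
    moreover have "blinfun_apply ?f x = (\<Sum>k<n. (of_real (c k) * cinner x (e k)) *\<^sub>C e k)"
      by (simp add: blinfun.sum_left blinfun.scaleR_left scaleC_scaleC flip: scaleC_of_real)
    ultimately show ?thesis by (intro CollectI exI[of _ "\<lambda>k. of_real (c k) * cinner x (e k)"]) auto
  qed
  \<comment> \<open>Closed balls, so that the covering survives the passage to the closure;
    afterwards the radius grows to \<open>r\<close> to obtain open balls.\<close>
  have "blinfun_apply (diag_op e c) ` cball 0 1 \<subseteq> (\<Union>x\<in>k. cball x (r/2))"
  proof (intro image_subsetI)
    fix x :: 'a assume "x \<in> cball 0 1"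
    then have x: "norm x \<le> 1" by simp
    obtain y where y: "y \<in> k" "dist y (blinfun_apply ?f x) < r/4" using inK[OF x] k(2) by auto
    have "dist (blinfun_apply ?f x) (blinfun_apply (diag_op e c) x) \<le> norm (?f - diag_op e c) * norm x"
      unfolding dist_norm blinfun.diff_left[symmetric] by (rule norm_blinfun)
    also have "\<dots> \<le> norm (?f - diag_op e c)" using x by (simp add: mult_left_le)
    finally have "dist (blinfun_apply ?f x) (blinfun_apply (diag_op e c) x) \<le> r/4"
      using n by (simp add: dist_norm)
    then have "dist y (blinfun_apply (diag_op e c) x) \<le> r/2"
      using y(2) dist_triangle[of y "blinfun_apply (diag_op e c) x" "blinfun_apply ?f x"] by linarith
    then show "blinfun_apply (diag_op e c) x \<in> (\<Union>x\<in>k. cball x (r/2))" using y(1) by auto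
  qed
  then have "closure (blinfun_apply (diag_op e c) ` cball 0 1) \<subseteq> (\<Union>x\<in>k. cball x (r/2))"
    using k(1) by (intro closure_minimal closed_UN) auto
  also have "\<dots> \<subseteq> (\<Union>x\<in>k. ball x r)" using r by fastforce
  finally show "\<exists>k. finite k \<and> closure (blinfun_apply (diag_op e c) ` cball 0 1) \<subseteq> (\<Union>x\<in>k. ball x r)"
    using k(1) by blast
qed

lemma compact_positive_diag_op:
  assumes "orthonormal e" "c \<longlonglongrightarrow> 0" "\<And>n. 0 \<le> c n"
  shows "diag_op e c \<in> compact_positive_ops"
  using positive_ops_diag_op[OF assms] compact_diag_op[OF assms(1,2)]
  by (simp add: compact_positive_ops_def)

text \<open>With an orthonormal basis of a finite-dimensional space containing the range, every
  coefficient of \<open>a x\<close> is bounded by \<open>norm a\<close>, so the image of the unit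
  ball lies in a compact set.\<close>

lemma finite_rank_positive_imp_compact:
  assumes "a \<in> finite_rank_positive_ops"
  shows "a \<in> compact_positive_ops"
proof -
  from assms obtain B where B: "finite B" "range (blinfun_apply a) \<subseteq> complex_vector.span B"
    and a: "a \<in> positive_ops" by (auto simp: finite_rank_positive_ops_def)
  obtain E where E: "finite E" "orthonormal_on E (\<lambda>x. x)" "B \<subseteq> complex_vector.span E"
    using Gram_Schmidt[OF B(1)] by blast
  have sp: "blinfun_apply a x \<in> complex_vector.span E" for x
    using B(2) complex_vector.span_mono[OF E(3)] by (auto simp: complex_vector.span_span)
  let ?K = "{\<Sum>i\<in>E. z i *\<^sub>C i |z. \<forall>i\<in>E. cmod (z i) \<le> norm a}"
  have K: "compact ?K" using compact_finite_combinations[OF E(1), of "\<lambda>x. x"] .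
  have "blinfun_apply a ` cball 0 1 \<subseteq> ?K"
  proof (intro image_subsetI)
    fix x :: 'a assume "x \<in> cball 0 1"
    then have x: "norm x \<le> 1" by simp
    have "cmod (cinner (blinfun_apply a x) i) \<le> norm a" if "i \<in> E" for i
    proof -
      have "cmod (cinner (blinfun_apply a x) i) \<le> norm (blinfun_apply a x) * norm i"
        by (rule cinner_Cauchy_Schwarz)
      also have "norm i = 1" using orthonormal_on_norm[OF E(2) that] .
      also have "norm (blinfun_apply a x) * 1 \<le> norm a * norm x" by (simp add: norm_blinfun)
      also have "\<dots> \<le> norm a" using x by (simp add: mult_left_le)
      finally show ?thesis .
    qed
    moreover have "blinfun_apply a x = (\<Sum>i\<in>E. cinner (blinfun_apply a x) i *\<^sub>C i)"
      using orthonormal_span_expansion[OF E(2,1)] sp by simp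
    ultimately show "blinfun_apply a x \<in> ?K" by blast
  qed
  then have "closure (blinfun_apply a ` cball 0 1) \<subseteq> ?K"
    using K by (intro closure_minimal compact_imp_closed)
  then have "compact (closure (blinfun_apply a ` cball 0 1))"
    using compact_Int_closed[OF K closed_closure[of "blinfun_apply a ` cball 0 1"]]
    by (simp only: Int_absorb1)
  then show ?thesis using a by (simp add: compact_positive_ops_def)
qed

section \<open>The spectral theorem for positive compact operators\<close>

text \<open>The form is nonnegative at \<open>x - (1/K) *\<^sub>R B x\<close>, and the step
  \<open>1/K\<close> optimises the resulting bound. The statement is relative to an invariant
  subspace \<open>S\<close> because it will be applied to \<mu> minus \<open>a\<close>, whose form
  is known to be nonnegative only on a complement.\<close>

lemma norm_power2_le_quadratic_form:
  fixes B :: "'h::complex_hilbert \<Rightarrow>\<^sub>L 'h"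
  assumes sym: "\<And>x y. cinner (blinfun_apply B x) y = cinner x (blinfun_apply B y)"
    and S: "\<And>x y r. x \<in> S \<Longrightarrow> y \<in> S \<Longrightarrow> x - r *\<^sub>R y \<in> S"
    and B: "\<And>x. x \<in> S \<Longrightarrow> blinfun_apply B x \<in> S"
    and nonneg: "\<And>x. x \<in> S \<Longrightarrow> 0 \<le> Re (cinner (blinfun_apply B x) x)"
    and bound: "\<And>x. x \<in> S \<Longrightarrow> Re (cinner (blinfun_apply B x) x) \<le> K * (norm x)\<^sup>2"
    and K: "0 < K" and x: "x \<in> S"
  shows "(norm (blinfun_apply B x))\<^sup>2 \<le> K * Re (cinner (blinfun_apply B x) x)"
proof -
  define y where "y = blinfun_apply B x"
  have yS: "y \<in> S" using B[OF x] by (simp add: y_def)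
  have "Re (cinner (blinfun_apply B y) x) = Re (cinner y y)"
    by (simp add: sym y_def[symmetric])
  then have "Re (cinner (blinfun_apply B (x - (1/K) *\<^sub>R y)) (x - (1/K) *\<^sub>R y))
      = Re (cinner y x) - 2 * (1/K) * (norm y)\<^sup>2 + (1/K)\<^sup>2 * Re (cinner (blinfun_apply B y) y)"
    unfolding power2_norm_eq_cinner
    by (simp add: blinfun.diff_right blinfun.scaleR_right cinner_simps y_def[symmetric]
        power2_eq_square algebra_simps)
  moreover have "(1/K)\<^sup>2 * Re (cinner (blinfun_apply B y) y) \<le> (1/K)\<^sup>2 * (K * (norm y)\<^sup>2)"
    by (intro mult_left_mono bound yS) auto
  moreover have "(1/K)\<^sup>2 * (K * (norm y)\<^sup>2) = (1/K) * (norm y)\<^sup>2"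
    using K by (simp add: power2_eq_square)
  ultimately have "0 \<le> Re (cinner y x) - (1/K) * (norm y)\<^sup>2"
    using nonneg[OF S[OF x yS, of "1/K"]] by linarith
  then show ?thesis using K by (simp add: y_def[symmetric] field_simps)
qed

lemma positive_ops_Re_nonneg: "a \<in> positive_ops \<Longrightarrow> 0 \<le> Re (cinner (blinfun_apply a x) x)"
  by (auto simp: positive_ops_def complex_nonneg_Reals_iff)

lemma Re_quadratic_form_le: "Re (cinner (blinfun_apply a x) x) \<le> norm a * (norm (x::'h::complex_hilbert))\<^sup>2"
proof -
  have "Re (cinner (blinfun_apply a x) x) \<le> norm (blinfun_apply a x) * norm x"
    by (rule order_trans[OF complex_Re_le_cmod cinner_Cauchy_Schwarz])
  also have "\<dots> \<le> (norm a * norm x) * norm x" by (intro mult_right_mono norm_blinfun) auto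
  finally show ?thesis by (simp add: power2_eq_square mult.assoc)
qed

text \<open>The constant is \<open>norm a + 1\<close> rather than \<open>norm a\<close>, so that it
  is positive for \<open>a = 0\<close> as well.\<close>

lemma positive_ops_norm_power2_le:
  assumes "a \<in> positive_ops"
  shows "(norm (blinfun_apply a x))\<^sup>2 \<le> (norm a + 1) * Re (cinner (blinfun_apply a x) x)"
proof (rule norm_power2_le_quadratic_form[where S = UNIV])
  show "Re (cinner (blinfun_apply a x) x) \<le> (norm a + 1) * (norm x)\<^sup>2" for x
    using Re_quadratic_form_le[of a x] by (simp add: distrib_right add_increasing2)
  show "0 < norm a + 1" by (simp add: add_nonneg_pos)
qed (use positive_ops_symmetric[OF assms] positive_ops_Re_nonneg[OF assms] in auto)

text \<open>\<mu> is the supremum of the form over the unit vectors of the complement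
  \<open>S\<close>. It is attained: along a maximising sequence
  \<open>\<mu> *\<^sub>R x - a x\<close> tends to 0, while compactness makes \<open>a x\<close>
  converge on a subsequence.\<close>

lemma maximal_eigenvector_on_complement:
  fixes a :: "'h::complex_hilbert \<Rightarrow>\<^sub>L 'h"
  assumes inf: "\<nexists>B::'h set. finite B \<and> complex_vector.span B = UNIV"
    and a: "a \<in> compact_positive_ops"
    and e: "orthonormal_on I e" "finite I" and eig: "\<And>i. i \<in> I \<Longrightarrow> blinfun_apply a (e i) = l i *\<^sub>R e i"
  obtains v \<mu> where "norm v = 1" "\<And>i. i \<in> I \<Longrightarrow> cinner v (e i) = 0" "0 \<le> \<mu>"
    "blinfun_apply a v = \<mu> *\<^sub>R v"
    "\<And>x. (\<And>i. i \<in> I \<Longrightarrow> cinner x (e i) = 0) \<Longrightarrow> Re (cinner (blinfun_apply a x) x) \<le> \<mu> * (norm x)\<^sup>2"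
proof -
  have pos: "a \<in> positive_ops" using a by (simp add: compact_positive_ops_def)
  define q where "q x = Re (cinner (blinfun_apply a x) x)" for x
  define S where "S = {x. \<forall>i\<in>I. cinner x (e i) = 0}"
  obtain v0 where v0: "norm v0 = 1" "v0 \<in> S"
    by (rule exists_unit_orthogonal[OF inf e]) (auto simp: S_def)
  define R where "R = q ` {x\<in>S. norm x = 1}"
  have Rne: "R \<noteq> {}" using v0 by (auto simp: R_def)
  have "q x \<le> norm a" if "norm x = 1" for x
    using Re_quadratic_form_le[of a x] that by (simp add: q_def)
  then have bdd: "bdd_above R" by (auto simp: R_def intro!: bdd_aboveI)
  define \<mu> where "\<mu> = Sup R"
  have q0: "0 \<le> q x" for x using positive_ops_Re_nonneg[OF pos] by (simp add: q_def)
  have up1: "q x \<le> \<mu>" if "x \<in> S" "norm x = 1" for x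
    unfolding \<mu>_def using that by (intro cSup_upper bdd) (auto simp: R_def)
  have \<mu>0: "0 \<le> \<mu>" using q0[of v0] up1[OF v0(2,1)] by linarith
  have S_diff: "x - r *\<^sub>R y \<in> S" if "x \<in> S" "y \<in> S" for x y r
    using that by (simp add: S_def cinner_simps)
  have S_scale: "r *\<^sub>R x \<in> S" if "x \<in> S" for x r using that by (simp add: S_def cinner_simps)
  have up: "q x \<le> \<mu> * (norm x)\<^sup>2" if "x \<in> S" for x
  proof (cases "x = 0")
    case False
    have "q ((1 / norm x) *\<^sub>R x) \<le> \<mu>" using False by (intro up1 S_scale that) simp
    moreover have "q ((1 / norm x) *\<^sub>R x) = q x / (norm x)\<^sup>2"
      by (simp add: q_def blinfun.scaleR_right cinner_simps power2_eq_square)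
    ultimately show ?thesis using False by (simp add: field_simps)
  qed (simp add: q_def)
  have aS: "blinfun_apply a x \<in> S" if "x \<in> S" for x
    using that by (simp add: S_def positive_ops_symmetric[OF pos] eig cinner_simps)
  define B where "B = \<mu> *\<^sub>R id_blinfun - a"
  have B: "blinfun_apply B x = \<mu> *\<^sub>R x - blinfun_apply a x" for x
    by (simp add: B_def blinfun.diff_left blinfun.scaleR_left)
  have qB: "Re (cinner (blinfun_apply B x) x) = \<mu> * (norm x)\<^sup>2 - q x" for x
    by (simp add: B cinner_simps q_def power2_norm_eq_cinner)
  \<comment> \<open>For a unit vector the second factor on the right is its deficit from the
    supremum. The factor \<mu> + 1 stays positive even if \<mu> is 0.\<close>
  have Bbound: "(norm (blinfun_apply B x))\<^sup>2 \<le> (\<mu> + 1) * (\<mu> * (norm x)\<^sup>2 - q x)" if "x \<in> S" for x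
    unfolding qB[symmetric]
  proof (rule norm_power2_le_quadratic_form[where S = S])
    show "cinner (blinfun_apply B x) y = cinner x (blinfun_apply B y)" for x y
      by (simp add: B cinner_simps positive_ops_symmetric[OF pos])
    show "blinfun_apply B x \<in> S" if "x \<in> S" for x
      using S_diff[OF S_scale[OF that, of \<mu>] aS[OF that], of 1] by (simp add: B)
    show "0 \<le> Re (cinner (blinfun_apply B x) x)" if "x \<in> S" for x using up[OF that] by (simp add: qB)
    show "Re (cinner (blinfun_apply B x) x) \<le> (\<mu> + 1) * (norm x)\<^sup>2" if "x \<in> S" for x
      using q0[of x] by (simp add: qB distrib_right add_increasing2)
  qed (use S_diff that \<mu>0 in auto)
  have "\<exists>v\<in>S. norm v = 1 \<and> blinfun_apply a v = \<mu> *\<^sub>R v"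
  \<comment> \<open>Recovering \<open>x\<close> from \<open>\<mu> *\<^sub>R x\<close> needs a
    division by \<mu>. For \<mu> = 0 the estimate shows directly that \<open>a\<close> vanishes at
    \<open>v0\<close>.\<close>
  proof (cases "\<mu> = 0")
    case True
    have "(norm (blinfun_apply B v0))\<^sup>2 \<le> - q v0" using Bbound[OF v0(2)] True by simp
    also have "\<dots> \<le> 0" using q0[of v0] by simp
    finally have "blinfun_apply a v0 = \<mu> *\<^sub>R v0" by (simp add: B)
    then show ?thesis using v0 by blast
  next
    case False
    then have \<mu>: "\<mu> > 0" using \<mu>0 by simp
    have "\<exists>x\<in>S. norm x = 1 \<and> \<mu> - 1 / real (Suc n) < q x" for n
    proof -
      have "\<mu> - 1 / real (Suc n) < Sup R" by (simp add: \<mu>_def)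
      then show ?thesis using less_cSup_iff[OF Rne bdd] unfolding R_def by blast
    qed
    then obtain x where xS: "\<And>n. x n \<in> S" and x1: "\<And>n. norm (x n) = 1"
      and qx: "\<And>n. \<mu> - 1 / real (Suc n) < q (x n)" by metis
    have Bx: "(\<lambda>n. (norm (blinfun_apply B (x n)))\<^sup>2) \<longlonglongrightarrow> 0"
    proof (rule tendsto_sandwich[of "\<lambda>_. 0" _ _ "\<lambda>n. (\<mu> + 1) * (1 / real (Suc n))"])
      show "(\<lambda>n. (\<mu> + 1) * (1 / real (Suc n))) \<longlonglongrightarrow> 0"
        using tendsto_mult_right_zero[OF LIMSEQ_inverse_real_of_nat, of "\<mu> + 1"] by (simp add: inverse_eq_divide)
      have "(norm (blinfun_apply B (x n)))\<^sup>2 \<le> (\<mu> + 1) * (1 / real (Suc n))" for n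
      proof -
        have "\<mu> * (norm (x n))\<^sup>2 - q (x n) \<le> 1 / real (Suc n)"
          using qx[of n] x1[of n] by (simp del: of_nat_Suc)
        then have "(\<mu> + 1) * (\<mu> * (norm (x n))\<^sup>2 - q (x n)) \<le> (\<mu> + 1) * (1 / real (Suc n))"
          using \<mu>0 by (intro mult_left_mono) auto
        then show ?thesis using Bbound[OF xS, of n] by linarith
      qed
      then show "\<forall>\<^sub>F n in sequentially. (norm (blinfun_apply B (x n)))\<^sup>2 \<le> (\<mu> + 1) * (1 / real (Suc n))"
        by (intro always_eventually) blast
    qed auto
    have "(\<lambda>n. norm (blinfun_apply B (x n))) \<longlonglongrightarrow> 0"
      using tendsto_real_sqrt[OF Bx] by simp
    then have Bx0: "(\<lambda>n. blinfun_apply B (x n)) \<longlonglongrightarrow> 0" by (simp add: tendsto_norm_zero_iff)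
    have "blinfun_apply a (x n) \<in> closure (blinfun_apply a ` cball 0 1)" for n
      using x1[of n] by (intro subsetD[OF closure_subset] imageI) simp
    moreover have "seq_compact (closure (blinfun_apply a ` cball 0 1))"
      using a by (simp add: compact_positive_ops_def compact_imp_seq_compact)
    ultimately obtain y r where r: "strict_mono r" and y: "((\<lambda>n. blinfun_apply a (x n)) \<circ> r) \<longlonglongrightarrow> y"
      unfolding seq_compact_def by metis
    have "(\<lambda>n. blinfun_apply B (x (r n)) + blinfun_apply a (x (r n))) \<longlonglongrightarrow> 0 + y"
      using LIMSEQ_subseq_LIMSEQ[OF Bx0 r] y by (intro tendsto_add) (simp_all add: o_def)
    then have "(\<lambda>n. (1 / \<mu>) *\<^sub>R (\<mu> *\<^sub>R x (r n))) \<longlonglongrightarrow> (1 / \<mu>) *\<^sub>R y"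
      by (intro tendsto_scaleR tendsto_const) (simp add: B)
    then have lim: "(\<lambda>n. x (r n)) \<longlonglongrightarrow> (1 / \<mu>) *\<^sub>R y" using False by simp
    define v where "v = (1 / \<mu>) *\<^sub>R y"
    have "(\<lambda>n. norm (x (r n))) \<longlonglongrightarrow> norm v" unfolding v_def by (intro tendsto_norm lim)
    then have "norm v = 1" by (simp add: x1 LIMSEQ_const_iff)
    moreover have "v \<in> S"
      unfolding S_def
    proof (intro CollectI ballI)
      fix i assume "i \<in> I"
      have "(\<lambda>n. cinner (x (r n)) (e i)) \<longlonglongrightarrow> cinner v (e i)" unfolding v_def
        by (intro tendsto_cinner lim tendsto_const)
      moreover have "cinner (x n) (e i) = 0" for n using xS[of n] \<open>i \<in> I\<close> by (simp add: S_def)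
      ultimately show "cinner v (e i) = 0" by (simp add: LIMSEQ_const_iff)
    qed
    moreover have "(\<lambda>n. blinfun_apply B (x (r n))) \<longlonglongrightarrow> blinfun_apply B v" unfolding v_def
      by (intro bounded_linear.tendsto[OF blinfun.bounded_linear_right] lim)
    then have "blinfun_apply B v = 0"
      using LIMSEQ_subseq_LIMSEQ[OF Bx0 r] LIMSEQ_unique by (fastforce simp: o_def)
    then have "blinfun_apply a v = \<mu> *\<^sub>R v" by (simp add: B)
    ultimately show ?thesis by blast
  qed
  then obtain v where "v \<in> S" "norm v = 1" "blinfun_apply a v = \<mu> *\<^sub>R v" by blast
  then show ?thesis
    using that[of v \<mu>] \<mu>0 up by (auto simp: S_def q_def)
qed

text \<open>Eigenvectors are chosen one after another, each maximising the form on the complement of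
  its predecessors; once a finite rank is exhausted, kernel vectors with eigenvalue 0 continue the
  sequence. Maximality yields both the decrease of \<open>l\<close> and the smallness of the
  remainder.\<close>

theorem spectral_theorem_compact_positive:
  fixes a :: "'h::complex_hilbert \<Rightarrow>\<^sub>L 'h"
  assumes inf: "\<nexists>B::'h set. finite B \<and> complex_vector.span B = UNIV"
    and a: "a \<in> compact_positive_ops"
  obtains e l where "orthonormal e" "decseq l" "l \<longlonglongrightarrow> 0" "a = diag_op e l"
proof -
  have pos: "a \<in> positive_ops" using a by (simp add: compact_positive_ops_def)
  \<comment> \<open>The choice at stage \<open>n\<close> is a pair of an eigenvector and its
    eigenvalue and refers to earlier choices only. The last conjunct records maximality.\<close>
  define P where "P f n r \<longleftrightarrow> norm (fst r) = 1 \<and> (\<forall>i<n. cinner (fst r) (fst (f i)) = 0) \<and> 0 \<le> snd r \<and>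
      blinfun_apply a (fst r) = snd r *\<^sub>R fst r \<and>
      (\<forall>x. (\<forall>i<n. cinner x (fst (f i)) = 0) \<longrightarrow> Re (cinner (blinfun_apply a x) x) \<le> snd r * (norm x)\<^sup>2)"
    for f :: "nat \<Rightarrow> 'h \<times> real" and n :: nat and r :: "'h \<times> real"
  have orth: "orthonormal_on {..<n} (\<lambda>i. fst (f i))" if "\<And>i. i < n \<Longrightarrow> P f i (f i)" for f n
    unfolding orthonormal_on_def
  proof (intro ballI)
    fix i j assume ij: "i \<in> {..<n}" "j \<in> {..<n}"
    then have P: "P f i (f i)" "P f j (f j)" using that by auto
    consider "i < j" | "i = j" | "j < i" by linarith
    then show "cinner (fst (f i)) (fst (f j)) = (if i = j then 1 else 0)"
    proof cases
      case 1
      then have "cinner (fst (f j)) (fst (f i)) = 0" using P(2) by (simp add: P_def)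
      then show ?thesis using 1 cinner_commute[of "fst (f i)"] by simp
    next
      case 2
      then show ?thesis using P by (simp add: P_def cinner_self)
    next
      case 3
      then show ?thesis using P(1) by (simp add: P_def)
    qed
  qed
  have "\<exists>f. \<forall>n. P f n (f n)"
  proof (rule dependent_wellorder_choice)
    show "P f n r = P g n r" if "\<And>i. i < n \<Longrightarrow> f i = g i" for r f g n
      using that by (auto simp: P_def)
    show "\<exists>r. P f n r" if f: "\<And>i. i < n \<Longrightarrow> P f i (f i)" for n f
    proof (rule maximal_eigenvector_on_complement[OF inf a orth[OF f], of n "\<lambda>i. snd (f i)"])
      show "blinfun_apply a (fst (f i)) = snd (f i) *\<^sub>R fst (f i)" if "i \<in> {..<n}" for i
        using f[of i] that by (simp add: P_def)
    next
      fix v \<mu>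
      assume "norm v = 1" "\<And>i. i \<in> {..<n} \<Longrightarrow> cinner v (fst (f i)) = 0" "0 \<le> \<mu>"
        "blinfun_apply a v = \<mu> *\<^sub>R v"
        "\<And>x. (\<And>i. i \<in> {..<n} \<Longrightarrow> cinner x (fst (f i)) = 0) \<Longrightarrow>
          Re (cinner (blinfun_apply a x) x) \<le> \<mu> * (norm x)\<^sup>2"
      then show "\<exists>r. P f n r" by (intro exI[of _ "(v, \<mu>)"]) (auto simp: P_def)
    qed auto
  qed
  then obtain f where f: "\<And>n. P f n (f n)" by blast
  define e where "e n = fst (f n)" for n
  define l where "l n = snd (f n)" for n
  have e: "orthonormal e"
    unfolding orthonormal_on_def
  proof (intro ballI)
    fix i j :: nat
    show "cinner (e i) (e j) = (if i = j then 1 else 0)"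
      using orthonormal_onD[OF orth[OF f, of "Suc (max i j)"], of i j] by (simp add: e_def)
  qed
  have l0: "0 \<le> l n" and eig: "blinfun_apply a (e n) = l n *\<^sub>R e n" for n
    using f[of n] by (simp_all add: P_def e_def l_def)
  have up: "Re (cinner (blinfun_apply a x) x) \<le> l n * (norm x)\<^sup>2"
    if "\<And>i. i < n \<Longrightarrow> cinner x (e i) = 0" for x n
    using f[of n] that by (simp add: P_def e_def l_def)
  have n1: "norm (e n) = 1" for n using orthonormal_on_norm[OF e, of n] by simp
  have dec: "decseq l"
    unfolding decseq_Suc_iff
  proof
    fix n
    have "Re (cinner (blinfun_apply a (e (Suc n))) (e (Suc n))) \<le> l n * (norm (e (Suc n)))\<^sup>2"
      by (rule up) (use orthonormal_onD[OF e] in simp)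
    then show "l (Suc n) \<le> l n" by (simp add: eig cinner_simps cinner_self n1)
  qed
  obtain L where L: "l \<longlonglongrightarrow> L" "\<And>n. L \<le> l n" using decseq_convergent[OF dec, of 0] l0 by blast
  \<comment> \<open>Otherwise the vectors \<open>a (e n)\<close> would keep mutual distance at least
    \<open>L\<close>, and no subsequence of them could converge.\<close>
  have "L = 0"
  proof (rule ccontr)
    assume "L \<noteq> 0"
    moreover have "0 \<le> L" using LIMSEQ_le_const[OF L(1)] l0 by blast
    ultimately have Lp: "0 < L" by simp
    have "blinfun_apply a (e n) \<in> closure (blinfun_apply a ` cball 0 1)" for n
      using n1[of n] by (intro subsetD[OF closure_subset] imageI) simp
    moreover have "seq_compact (closure (blinfun_apply a ` cball 0 1))"
      using a by (simp add: compact_positive_ops_def compact_imp_seq_compact)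
    ultimately obtain y r where r: "strict_mono r" and y: "((\<lambda>n. blinfun_apply a (e n)) \<circ> r) \<longlonglongrightarrow> y"
      unfolding seq_compact_def by metis
    have y': "(\<lambda>n. l (r n) *\<^sub>R e (r n)) \<longlonglongrightarrow> y" using y by (simp add: o_def eig)
    have "(\<lambda>n. l (r (Suc n)) *\<^sub>R e (r (Suc n)) - l (r n) *\<^sub>R e (r n)) \<longlonglongrightarrow> y - y"
      by (intro tendsto_diff y' LIMSEQ_Suc[OF y'])
    then have "(\<lambda>n. norm (l (r (Suc n)) *\<^sub>R e (r (Suc n)) - l (r n) *\<^sub>R e (r n))) \<longlonglongrightarrow> 0"
      by (simp add: tendsto_norm_zero_iff)
    from order_tendstoD(2)[OF this Lp] obtain n
      where n: "norm (l (r (Suc n)) *\<^sub>R e (r (Suc n)) - l (r n) *\<^sub>R e (r n)) < L"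
      by (auto simp: eventually_sequentially)
    have "r (Suc n) \<noteq> r n" using r by (metis lessI less_irrefl strict_monoD)
    then have "(norm (l (r (Suc n)) *\<^sub>R e (r (Suc n)) - l (r n) *\<^sub>R e (r n)))\<^sup>2 = (l (r (Suc n)))\<^sup>2 + (l (r n))\<^sup>2"
      by (simp add: power2_norm_diff cinner_simps orthonormal_onD[OF e] n1 power_mult_distrib)
    moreover have "L\<^sup>2 \<le> (l (r n))\<^sup>2" using L(2) Lp by (intro power_mono) auto
    moreover have "(norm (l (r (Suc n)) *\<^sub>R e (r (Suc n)) - l (r n) *\<^sub>R e (r n)))\<^sup>2 < L\<^sup>2"
      using n by (intro power_strict_mono) auto
    ultimately show False using zero_le_power2[of "l (r (Suc n))"] by linarith
  qed
  then have lim: "l \<longlonglongrightarrow> 0" using L by simp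
  \<comment> \<open>The remainder acts as \<open>a\<close> on the residual of \<open>x\<close>,
    where maximality bounds the form by \<open>l n\<close>. The square root comes from passing from
    the form to the norm and is harmless for convergence.\<close>
  have bound: "norm (a - (\<Sum>i<n. l i *\<^sub>R proj1 (e i))) \<le> sqrt ((norm a + 1) * l n)" for n
  proof (rule norm_blinfun_bound)
    show "0 \<le> sqrt ((norm a + 1) * l n)" using l0[of n] by simp
    fix x
    define y where "y = x - (\<Sum>i<n. cinner x (e i) *\<^sub>C e i)"
    have en: "orthonormal_on {..<n} e" by (rule orthonormal_on_subset[OF e]) simp
    have "a \<in> bounded_ops" using pos by (simp add: positive_ops_def)
    then have *: "blinfun_apply (a - (\<Sum>i<n. l i *\<^sub>R proj1 (e i))) x = blinfun_apply a y"
      by (simp add: y_def blinfun.diff_left blinfun.diff_right blinfun.sum_left blinfun.sum_right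
          blinfun.scaleR_left bounded_opsD eig scaleC_scaleR)
    have "(norm (blinfun_apply a y))\<^sup>2 \<le> (norm a + 1) * Re (cinner (blinfun_apply a y) y)"
      by (rule positive_ops_norm_power2_le[OF pos])
    also have "\<dots> \<le> (norm a + 1) * (l n * (norm y)\<^sup>2)"
      using orthonormal_residual[OF en, of _ x] by (intro mult_left_mono up) (auto simp: y_def)
    also have "\<dots> \<le> (norm a + 1) * (l n * (norm x)\<^sup>2)"
      using Bessel_inequality(2)[OF en, of x] l0 by (intro mult_left_mono power_mono) (auto simp: y_def)
    also have "\<dots> = (sqrt ((norm a + 1) * l n) * norm x)\<^sup>2"
      using l0[of n] by (simp add: power_mult_distrib)
    finally show "norm (blinfun_apply (a - (\<Sum>i<n. l i *\<^sub>R proj1 (e i))) x) \<le> sqrt ((norm a + 1) * l n) * norm x"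
      unfolding * by (rule power2_le_imp_le) (use l0[of n] in simp)
  qed
  have "(\<lambda>n. sqrt ((norm a + 1) * l n)) \<longlonglongrightarrow> sqrt ((norm a + 1) * 0)"
    by (intro tendsto_intros lim)
  then have "(\<lambda>n. a - (\<Sum>i<n. l i *\<^sub>R proj1 (e i))) \<longlonglongrightarrow> 0"
    using Lim_null_comparison[OF always_eventually[OF allI[OF bound]]] by simp
  then have "(\<lambda>n. a - (a - (\<Sum>i<n. l i *\<^sub>R proj1 (e i)))) \<longlonglongrightarrow> a - 0"
    by (intro tendsto_diff tendsto_const)
  then have "(\<lambda>n. l n *\<^sub>R proj1 (e n)) sums a" by (simp add: sums_def)
  then have "a = diag_op e l" by (rule diag_op_eqI[symmetric])
  then show ?thesis using that e dec lim by blast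
qed

section \<open>Eigenvalue sequences\<close>

text \<open>\<open>p x\<close> is a multiple of a unit vector \<open>v\<close> spanning the range,
  and self-adjointness with \<open>p v = v\<close> identifies the multiple as
  \<open>cinner x v\<close>.\<close>

lemma one_dim_projections_iff: "p \<in> one_dim_projections \<longleftrightarrow> (\<exists>v. norm v = 1 \<and> p = proj1 v)"
proof
  assume p: "p \<in> one_dim_projections"
  then have b: "p \<in> bounded_ops" and idem: "\<And>x. blinfun_apply p (blinfun_apply p x) = blinfun_apply p x"
    and adj: "adjoint_op p = p" and dim: "complex_vector.dim (range (blinfun_apply p)) = 1"
    by (auto simp: one_dim_projections_def simp flip: blinfun_apply_blinfun_compose)
  obtain B where B: "B \<subseteq> range (blinfun_apply p)" "complex_vector.independent B"
    "range (blinfun_apply p) \<subseteq> complex_vector.span B" "card B = 1"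
    using complex_vector.basis_exists[of "range (blinfun_apply p)"] dim by metis
  then obtain w where w: "B = {w}" by (auto simp: card_1_singleton_iff)
  have w0: "w \<noteq> 0" using B(2) w by (auto simp: complex_vector.dependent_zero)
  have pw: "blinfun_apply p w = w" using B(1) w idem by auto
  define v where "v = (1 / norm w) *\<^sub>R w"
  have pv: "blinfun_apply p v = v" by (simp add: v_def blinfun.scaleR_right pw)
  have v1: "norm v = 1" using w0 by (simp add: v_def)
  have "blinfun_apply p x = cinner x v *\<^sub>C v" for x
  proof -
    have "blinfun_apply p x \<in> complex_vector.span {w}" using B(3) w by blast
    then obtain k where "blinfun_apply p x = k *\<^sub>C w" by (auto simp: complex_vector.span_singleton)
    moreover have "w = of_real (norm w) *\<^sub>C v" using w0 by (simp add: v_def scaleC_of_real)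
    ultimately obtain k' where k: "blinfun_apply p x = k' *\<^sub>C v" by (metis scaleC_scaleC)
    have "cinner (blinfun_apply p x) v = cinner x v" using cinner_adjoint_op[OF b, of x v] adj pv by simp
    moreover have "cinner (blinfun_apply p x) v = k'" by (simp add: k cinner_simps cinner_self v1)
    ultimately show ?thesis using k by simp
  qed
  then have "p = proj1 v" by (intro blinfun_eqI) simp
  then show "\<exists>v. norm v = 1 \<and> p = proj1 v" using v1 by blast
next
  assume "\<exists>v. norm v = 1 \<and> p = proj1 v"
  then obtain v where v: "norm v = 1" and p: "p = proj1 v" by blast
  have vv: "cinner v v = 1" using v by (simp add: cinner_self)
  have "proj1 v o\<^sub>L proj1 v = proj1 v"
    by (rule blinfun_eqI) (simp add: cinner_simps vv scaleC_scaleC)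
  moreover have "adjoint_op (proj1 v) = proj1 v"
    by (rule adjoint_op_eqI) (simp add: cinner_simps cinner_commute[of v])
  moreover have "complex_vector.dim (range (blinfun_apply (proj1 v))) = 1"
  proof (rule complex_vector.dim_unique[of "{v}"])
    show "{v} \<subseteq> range (blinfun_apply (proj1 v))"
      using range_eqI[of v "blinfun_apply (proj1 v)" v] by (simp add: vv scaleC_one)
    show "range (blinfun_apply (proj1 v)) \<subseteq> complex_vector.span {v}"
      by (auto simp: complex_vector.span_singleton)
    have "v \<noteq> 0" using v by auto
    then show "complex_vector.independent {v}" by simp
  qed simp
  ultimately show "p \<in> one_dim_projections"
    unfolding p one_dim_projections_def by (simp add: bounded_ops_proj1)
qed

text \<open>Brings the definition into the form delivered by the spectral theorem, which settles
  existence. Orthogonality of the vectors is read off by evaluating \<open>p j o\<^sub>L p i\<close>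
  at \<open>e i\<close>.\<close>

lemma eigenvalue_sequence_iff:
  "eigenvalue_sequence a l \<longleftrightarrow> decseq l \<and> l \<longlonglongrightarrow> 0 \<and> (\<exists>e. orthonormal e \<and> a = diag_op e l)"
proof safe
  assume ev: "eigenvalue_sequence a l"
  then show "decseq l" "l \<longlonglongrightarrow> 0" by (auto simp: eigenvalue_sequence_def)
  from ev obtain p where p: "\<And>n. p n \<in> one_dim_projections" "\<And>m n. m \<noteq> n \<Longrightarrow> p m o\<^sub>L p n = 0"
    "(\<lambda>n. l n *\<^sub>R p n) sums a"
    by (auto simp: eigenvalue_sequence_def)
  from p(1) obtain e where e: "\<And>n. norm (e n) = 1" "\<And>n. p n = proj1 (e n)"
    unfolding one_dim_projections_iff by metis
  have "orthonormal e"
    unfolding orthonormal_on_def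
  proof (intro ballI)
    fix i j :: nat
    show "cinner (e i) (e j) = (if i = j then 1 else 0)"
    proof (cases "i = j")
      case False
      then have "blinfun_apply (p j o\<^sub>L p i) (e i) = 0" using p(2)[of j i] by simp
      then have "cinner (e i) (e j) *\<^sub>C e j = 0" by (simp add: e cinner_self scaleC_one)
      moreover have "e j \<noteq> 0" using e(1)[of j] by auto
      ultimately show ?thesis using False by simp
    qed (simp add: cinner_self e)
  qed
  moreover have "a = diag_op e l" by (rule diag_op_eqI[symmetric]) (use p(3) e in simp)
  ultimately show "\<exists>e. orthonormal e \<and> a = diag_op e l" by blast
next
  fix e :: "nat \<Rightarrow> 'a"
  assume l: "decseq l" "l \<longlonglongrightarrow> 0" and e: "orthonormal e"
  have "proj1 (e m) o\<^sub>L proj1 (e n) = 0" if "m \<noteq> n" for m n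
    by (rule blinfun_eqI) (use that in \<open>simp add: cinner_simps orthonormal_onD[OF e]\<close>)
  moreover have "proj1 (e n) \<in> one_dim_projections" for n
    using orthonormal_on_norm[OF e, of n] by (auto simp: one_dim_projections_iff)
  ultimately show "eigenvalue_sequence (diag_op e l) l"
    using l diag_op_sums[OF e l(2)]
    by (auto simp: eigenvalue_sequence_def intro!: exI[of _ "\<lambda>n. proj1 (e n)"])
qed

section \<open>Counting eigenvalues by the minimax principle\<close>

text \<open>The dimension is witnessed by an independent set, which avoids the default value of
  \<open>dim\<close>. For \<open>k = 0\<close> the empty set is a witness, hence the
  \<open>Suc k\<close> in the count below.\<close>

definition form_ge_on_dim :: "('h::complex_hilbert \<Rightarrow>\<^sub>L 'h) \<Rightarrow> real \<Rightarrow> nat \<Rightarrow> bool" where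
  "form_ge_on_dim a t k \<longleftrightarrow> (\<exists>B. finite B \<and> card B = k \<and> complex_vector.independent B \<and>
     (\<forall>x\<in>complex_vector.span B. t * (norm x)\<^sup>2 \<le> Re (cinner (blinfun_apply a x) x)))"

text \<open>For \<open>t > 0\<close> and \<open>a\<close> positive compact the admissible dimensions form an initial segment, so
  counting the positive ones gives the largest.\<close>

definition spectral_count :: "('h::complex_hilbert \<Rightarrow>\<^sub>L 'h) \<Rightarrow> real \<Rightarrow> nat" where
  "spectral_count a t = card {k. form_ge_on_dim a t (Suc k)}"

lemma finite_superlevel:
  fixes c :: "nat \<Rightarrow> real"
  assumes "c \<longlonglongrightarrow> 0" "0 < t"
  shows "finite {n. t \<le> c n}"
proof -
  from order_tendstoD(2)[OF assms] obtain N where "\<And>n. n \<ge> N \<Longrightarrow> c n < t"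
    by (auto simp: eventually_sequentially)
  then have "n < N" if "t \<le> c n" for n using that by (metis linorder_not_le)
  then have "{n. t \<le> c n} \<subseteq> {..<N}" by blast
  then show ?thesis using finite_subset by blast
qed

lemma independent_orthonormal:
  assumes "orthonormal_on I e" "finite I"
  shows "complex_vector.independent (e ` I)" "card (e ` I) = card I"
proof -
  have inj: "inj_on e I"
  proof (rule inj_onI)
    fix i j assume ij: "i \<in> I" "j \<in> I" "e i = e j"
    then have "cinner (e i) (e j) = 1" using orthonormal_onD[OF assms(1), of i i] by simp
    then show "i = j" using orthonormal_onD[OF assms(1) ij(1,2)] by (auto split: if_splits)
  qed
  then show "card (e ` I) = card I" by (rule card_image)
  have "u (e j) = 0" if "(\<Sum>v\<in>e ` I. u v *\<^sub>C v) = 0" "j \<in> I" for u j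
    using cinner_orthonormal_sum[OF assms that(2), of "\<lambda>i. u (e i)"] that(1)
    by (simp add: sum.reindex[OF inj] o_def)
  then show "complex_vector.independent (e ` I)"
    using assms(2) by (subst complex_vector.dependent_finite) auto
qed

text \<open>The two halves of the minimax principle: the basis vectors with coefficient at least
  \<open>t\<close> span an admissible subspace, and one of larger dimension would contain a nonzero
  vector orthogonal to all of them. The order of \<open>c\<close> is left open because
  \<open>c\<close> will also be \<open>\<lambda>n. f (l n)\<close>.\<close>

lemma form_ge_on_dim_diag_op:
  assumes e: "orthonormal e" and c: "c \<longlonglongrightarrow> 0" and c0: "\<And>n. 0 \<le> c n" and t: "0 < t"
  shows "form_ge_on_dim (diag_op e c) t k \<longleftrightarrow> k \<le> card {n. t \<le> c n}"
proof
  assume "k \<le> card {n. t \<le> c n}"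
  then obtain J where J: "J \<subseteq> {n. t \<le> c n}" "card J = k" "finite J"
    by (meson obtain_subset_with_card_n)
  have eJ: "orthonormal_on J e" by (rule orthonormal_on_subset[OF e]) simp
  have "t * (norm x)\<^sup>2 \<le> Re (cinner (blinfun_apply (diag_op e c) x) x)"
    if x: "x \<in> complex_vector.span (e ` J)" for x
  proof -
    have "t * (norm x)\<^sup>2 = (\<Sum>n\<in>J. t * (cmod (cinner x (e n)))\<^sup>2)"
      using norm_orthonormal_sum[OF eJ J(3), of "\<lambda>i. cinner x (e i)"] orthonormal_span_expansion[OF eJ J(3) x]
      by (simp add: sum_distrib_left)
    also have "\<dots> \<le> (\<Sum>n\<in>J. c n * (cmod (cinner x (e n)))\<^sup>2)"
      using J(1) by (intro sum_mono mult_right_mono) auto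
    also have "\<dots> \<le> Re (cinner (blinfun_apply (diag_op e c) x) x)"
      using sums_Re[OF diag_op_quadratic_form_sums[OF e c, of x]] c0 J(3)
      by (simp add: sums_iff) (metis (no_types, lifting) c0 mult_nonneg_nonneg sum_le_suminf zero_le_power2)
    finally show ?thesis .
  qed
  then show "form_ge_on_dim (diag_op e c) t k"
    unfolding form_ge_on_dim_def using independent_orthonormal[OF eJ J(3)] J by blast
next
  define S where "S = {n. t \<le> c n}"
  have fin: "finite S" unfolding S_def by (rule finite_superlevel[OF c t])
  assume "form_ge_on_dim (diag_op e c) t k"
  then obtain B where B: "card B = k" "complex_vector.independent B"
    "\<And>x. x \<in> complex_vector.span B \<Longrightarrow> t * (norm x)\<^sup>2 \<le> Re (cinner (blinfun_apply (diag_op e c) x) x)"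
    by (auto simp: form_ge_on_dim_def)
  have eS: "orthonormal_on S e" by (rule orthonormal_on_subset[OF e]) simp
  show "k \<le> card {n. t \<le> c n}"
  proof (rule ccontr)
    assume "\<not> k \<le> card {n. t \<le> c n}"
    then have card: "card (e ` S) < card B"
      using independent_orthonormal(2)[OF eS fin] B by (simp add: S_def)
    let ?f = "\<lambda>x. \<Sum>n\<in>S. cinner x (e n) *\<^sub>C e n"
    obtain v where v: "v \<in> complex_vector.span B" "v \<noteq> 0" "?f v = 0"
    proof (rule complex_linear_kernel_nontrivial[of ?f B "e ` S"])
      show "?f (x + y) = ?f x + ?f y" for x y
        by (simp add: cinner_simps scaleC_add_left sum.distrib)
      show "?f (c *\<^sub>C x) = c *\<^sub>C ?f x" for c x
        by (simp add: cinner_simps complex_vector.scale_sum_right scaleC_scaleC)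
      show "?f ` B \<subseteq> complex_vector.span (e ` S)" by (intro image_subsetI orthonormal_sum_in_span)
    qed (use B fin card in auto)
    have vS: "cinner v (e n) = 0" if "n \<in> S" for n
      using cinner_orthonormal_sum[OF eS fin that, of "\<lambda>n. cinner v (e n)"] v(3) by simp
    \<comment> \<open>A bound strictly below \<open>t\<close> for all coefficients outside
      \<open>S\<close>: only finitely many lie between \<open>t/2\<close> and \<open>t\<close>, so
      the maximum of these and \<open>t/2\<close> serves.\<close>
    define T where "T = insert (t/2) (c ` {n. t/2 \<le> c n \<and> c n < t})"
    have "finite {n. t/2 \<le> c n}" using finite_superlevel[OF c, of "t/2"] t by simp
    then have finT: "finite T" unfolding T_def by (auto intro: finite_subset[rotated])
    then have Mt: "Max T < t" using t by (auto simp: T_def)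
    have cM: "c n \<le> Max T" if "n \<notin> S" for n
    proof (cases "t/2 \<le> c n")
      case True
      then show ?thesis using that finT by (intro Max_ge) (auto simp: T_def S_def)
    next
      case False
      then have "c n \<le> t/2" by simp
      also have "t/2 \<le> Max T" using finT by (intro Max_ge) (auto simp: T_def)
      finally show ?thesis .
    qed
    have M0: "0 \<le> Max T" using Max_ge[OF finT, of "t/2"] t by (auto simp: T_def)
    have s: "(\<lambda>n. c n * (cmod (cinner v (e n)))\<^sup>2) sums Re (cinner (blinfun_apply (diag_op e c) v) v)"
      using sums_Re[OF diag_op_quadratic_form_sums[OF e c, of v]] by simp
    have "(\<Sum>n<N. c n * (cmod (cinner v (e n)))\<^sup>2) \<le> Max T * (norm v)\<^sup>2" for N
    proof -
      have "(\<Sum>n<N. c n * (cmod (cinner v (e n)))\<^sup>2) \<le> (\<Sum>n<N. Max T * (cmod (cinner v (e n)))\<^sup>2)"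
      proof (rule sum_mono)
        show "c n * (cmod (cinner v (e n)))\<^sup>2 \<le> Max T * (cmod (cinner v (e n)))\<^sup>2" for n
          using vS[of n] cM[of n] by (cases "n \<in> S") (auto intro: mult_right_mono)
      qed
      also have "\<dots> \<le> Max T * (norm v)\<^sup>2"
        unfolding sum_distrib_left[symmetric] using M0 orthonormal_on_subset[OF e]
        by (intro mult_left_mono Bessel_inequality(1)) auto
      finally show ?thesis .
    qed
    then have "Re (cinner (blinfun_apply (diag_op e c) v) v) \<le> Max T * (norm v)\<^sup>2"
      using s unfolding sums_def by (intro LIMSEQ_le_const2[of _ "Re (cinner (blinfun_apply (diag_op e c) v) v)"]) auto
    moreover have "Max T * (norm v)\<^sup>2 < t * (norm v)\<^sup>2" using Mt v(2) by simp
    ultimately show False using B(3)[OF v(1)] by linarith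
  qed
qed

lemma spectral_count_diag_op:
  assumes "orthonormal e" "c \<longlonglongrightarrow> 0" "\<And>n. 0 \<le> c n" "0 < t"
  shows "spectral_count (diag_op e c) t = card {n. t \<le> c n}"
proof -
  have "{k. form_ge_on_dim (diag_op e c) t (Suc k)} = {..<card {n. t \<le> c n}}"
    unfolding form_ge_on_dim_diag_op[OF assms] Suc_le_eq lessThan_def ..
  then show ?thesis by (simp add: spectral_count_def)
qed

text \<open>A superlevel set of a decreasing sequence is an initial segment, and its cardinality is
  the first index outside it. Since \<open>l\<close> starts at index 0, \<open>l i\<close> is
  eigenvalue number \<open>i + 1\<close>.\<close>

lemma less_card_superlevel_iff:
  fixes l :: "nat \<Rightarrow> real"
  assumes "decseq l" "l \<longlonglongrightarrow> 0" "0 < t"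
  shows "i < card {n. t \<le> l n} \<longleftrightarrow> t \<le> l i"
proof
  assume "t \<le> l i"
  then have "{..i} \<subseteq> {n. t \<le> l n}" using decseqD[OF assms(1)] by fastforce
  then have "card {..i} \<le> card {n. t \<le> l n}" by (intro card_mono finite_superlevel assms)
  then show "i < card {n. t \<le> l n}" by simp
next
  assume i: "i < card {n. t \<le> l n}"
  show "t \<le> l i"
  proof (rule ccontr)
    assume "\<not> t \<le> l i"
    then have "n < i" if "t \<le> l n" for n
      using that decseqD[OF assms(1), of i n] by (cases "n < i") auto
    then have "{n. t \<le> l n} \<subseteq> {..<i}" by blast
    then have "card {n. t \<le> l n} \<le> card {..<i}" by (intro card_mono) auto
    then show False using i by simp
  qed
qed

lemma decseq_null_nonneg: "decseq l \<Longrightarrow> l \<longlonglongrightarrow> (0::real) \<Longrightarrow> 0 \<le> l n"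
  by (rule decseq_ge)

text \<open>The count depends on the operator alone. If \<open>l i\<close> exceeded
  \<open>l' i\<close>, the positive threshold \<open>l i\<close> would be counted differently by the
  two sequences. This gives the \<open>THE\<close> in \<open>eigval\<close> its meaning.\<close>

lemma eigenvalue_sequence_unique:
  assumes "eigenvalue_sequence a l" "eigenvalue_sequence a l'"
  shows "l = l'"
proof -
  have *: "l i \<le> l' i" if ev: "eigenvalue_sequence a l" "eigenvalue_sequence a l'" for l l' i
  proof (rule ccontr)
    assume less: "\<not> l i \<le> l' i"
    from ev obtain e e' where l: "decseq l" "l \<longlonglongrightarrow> 0" "orthonormal e" "a = diag_op e l"
      and l': "decseq l'" "l' \<longlonglongrightarrow> 0" "orthonormal e'" "a = diag_op e' l'"
      by (auto simp: eigenvalue_sequence_iff)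
    have t: "0 < l i" using less decseq_null_nonneg[OF l'(1,2), of i] by simp
    have "card {n. l i \<le> l n} = card {n. l i \<le> l' n}"
      using spectral_count_diag_op[OF l(3,2) decseq_null_nonneg[OF l(1,2)] t]
        spectral_count_diag_op[OF l'(3,2) decseq_null_nonneg[OF l'(1,2)] t] l l' by simp
    then show False
      using less_card_superlevel_iff[OF l(1,2) t, of i] less_card_superlevel_iff[OF l'(1,2) t, of i] less
      by simp
  qed
  show ?thesis using *[OF assms] *[OF assms(2,1)] by (intro ext antisym)
qed

lemma eigval_eq:
  assumes "eigenvalue_sequence a l"
  shows "eigval a n = l (n - 1)"
proof -
  have "(THE l. eigenvalue_sequence a l) = l"
    using assms eigenvalue_sequence_unique by (intro the_equality) blast+
  then show ?thesis by (simp add: eigval_def)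
qed

section \<open>Spectrum and functional calculus of diagonal operators\<close>

text \<open>0 belongs to the spectrum even if no \<open>c n\<close> vanishes: the unit vectors
  \<open>e n\<close> have images tending to 0, which rules out a bounded inverse.\<close>

lemma real_spectrum_diag_op:
  fixes e :: "nat \<Rightarrow> 'h::complex_hilbert"
  assumes e: "orthonormal e" and c: "c \<longlonglongrightarrow> 0"
  shows "real_spectrum (diag_op e c) = insert 0 (range c)"
proof -
  let ?A = "diag_op e c"
  have n1: "norm (e n) = 1" for n using orthonormal_on_norm[OF e, of n] by simp
  \<comment> \<open>It is enough to exclude left inverses, here among all bounded real-linear
    maps.\<close>
  have spec: "t \<in> real_spectrum ?A" if "\<And>b. \<not> (\<forall>x. blinfun_apply b (blinfun_apply ?A x - t *\<^sub>R x) = x)" for t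
    using that unfolding real_spectrum_def op_spectrum_def by (auto simp: scaleC_of_real)
  have "c m \<in> real_spectrum ?A" for m
  proof (rule spec, rule notI)
    fix b assume "\<forall>x. blinfun_apply b (blinfun_apply ?A x - c m *\<^sub>R x) = x"
    then have "blinfun_apply b (blinfun_apply ?A (e m) - c m *\<^sub>R e m) = e m" by blast
    then have "e m = 0" by (simp add: diag_op_basis[OF e c])
    then show False using n1[of m] by simp
  qed
  moreover have "0 \<in> real_spectrum ?A"
  proof (rule spec, rule notI)
    fix b assume "\<forall>x. blinfun_apply b (blinfun_apply ?A x - 0 *\<^sub>R x) = x"
    then have b: "blinfun_apply b (blinfun_apply ?A x) = x" for x by simp
    have pos: "0 < 1 / (norm b + 1)" by (simp add: add_nonneg_pos)
    from LIMSEQ_D[OF c pos] obtain n where n: "\<bar>c n\<bar> < 1 / (norm b + 1)" by auto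
    have "1 = norm (blinfun_apply b (c n *\<^sub>R e n))"
      using b[of "e n"] n1[of n] by (simp add: diag_op_basis[OF e c])
    also have "\<dots> \<le> norm b * norm (c n *\<^sub>R e n)" by (rule norm_blinfun)
    also have "\<dots> = norm b * \<bar>c n\<bar>" by (simp add: n1)
    also have "\<dots> \<le> norm b * (1 / (norm b + 1))" using n by (intro mult_left_mono) auto
    also have "\<dots> < 1" by (simp add: add_nonneg_pos)
    finally show False by simp
  qed
  moreover have "t \<in> insert 0 (range c)" if "t \<in> real_spectrum ?A" for t
  proof (rule ccontr)
    assume t: "t \<notin> insert 0 (range c)"
    then have t0: "t \<noteq> 0" and tc: "c n \<noteq> t" for n by auto
    \<comment> \<open>The resolvent has coefficients \<open>1 / (c n - t)\<close>, which tend to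
      \<open>- 1 / t\<close>. Adding \<open>1 / t\<close> makes them a null sequence, and
      \<open>b\<close> subtracts that multiple of the identity again. The identity \<open>cd\<close>
      below is the resolvent equation for coefficients.\<close>
    define d where "d n = 1 / (c n - t) + 1 / t" for n
    have "(\<lambda>n. 1 / (c n - t) + 1 / t) \<longlonglongrightarrow> 1 / (0 - t) + 1 / t"
      using t0 by (intro tendsto_intros c) auto
    then have d: "d \<longlonglongrightarrow> 0" by (simp add: d_def[abs_def])
    have lim: "(\<lambda>n. t * d n) \<longlonglongrightarrow> 0" "(\<lambda>n. (1 / t) * c n) \<longlonglongrightarrow> 0"
      using tendsto_mult_right_zero[OF d, of t] tendsto_mult_right_zero[OF c, of "1/t"] by auto
    have cd: "c n * d n = t * d n + (1 / t) * c n" for n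
      using t0 tc[of n] by (simp add: d_def field_simps)
    have "diag_op e (\<lambda>n. c n * d n) = t *\<^sub>R diag_op e d + (1 / t) *\<^sub>R ?A"
      unfolding cd diag_op_add[OF e lim] diag_op_scaleR[OF e d] diag_op_scaleR[OF e c] ..
    then have "?A o\<^sub>L diag_op e d = t *\<^sub>R diag_op e d + (1 / t) *\<^sub>R ?A"
      "diag_op e d o\<^sub>L ?A = t *\<^sub>R diag_op e d + (1 / t) *\<^sub>R ?A"
      unfolding diag_op_compose[OF e c d] diag_op_compose[OF e d c] by (simp_all add: mult.commute)
    from this[THEN arg_cong[where f = blinfun_apply]]
    have AD: "blinfun_apply ?A (blinfun_apply (diag_op e d) x)
        = t *\<^sub>R blinfun_apply (diag_op e d) x + (1 / t) *\<^sub>R blinfun_apply ?A x"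
      and DA: "blinfun_apply (diag_op e d) (blinfun_apply ?A x)
        = t *\<^sub>R blinfun_apply (diag_op e d) x + (1 / t) *\<^sub>R blinfun_apply ?A x" for x
      by (simp_all add: fun_eq_iff blinfun.add_left blinfun.scaleR_left)
    define b where "b = diag_op e d - (1 / t) *\<^sub>R id_blinfun"
    have b: "blinfun_apply b x = blinfun_apply (diag_op e d) x - (1 / t) *\<^sub>R x" for x
      by (simp add: b_def blinfun.diff_left blinfun.scaleR_left)
    have "b \<in> bounded_ops" unfolding b_def
      by (intro bounded_ops_diff bounded_ops_scaleR bounded_ops_id bounded_ops_diag_op e d)
    moreover have "blinfun_apply b (blinfun_apply ?A x - complex_of_real t *\<^sub>C x) = x" for x
      using t0 by (simp add: b scaleC_of_real blinfun.diff_right blinfun.scaleR_right DA scaleR_diff_right)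
    moreover have "blinfun_apply ?A (blinfun_apply b x) - complex_of_real t *\<^sub>C blinfun_apply b x = x" for x
      using t0 by (simp add: b scaleC_of_real blinfun.diff_right blinfun.scaleR_right AD scaleR_diff_right)
    ultimately show False using that unfolding real_spectrum_def op_spectrum_def by blast
  qed
  ultimately show ?thesis by auto
qed

section \<open>Polynomials and continuous functions of a diagonal operator\<close>

lemma poly_op_0: "poly_op 0 a = 0"
  by (simp add: poly_op_def)

lemma poly_op_pCons: "poly_op (pCons k p) a = k *\<^sub>R id_blinfun + (a o\<^sub>L poly_op p a)"
proof -
  let ?w = "\<lambda>i. ((\<lambda>b. a o\<^sub>L b) ^^ i) id_blinfun"
  \<comment> \<open>For \<open>p = 0\<close> the degree does not grow, so the range of summation is
    extended by a vanishing term.\<close>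
  have "poly_op (pCons k p) a = (\<Sum>i\<le>Suc (degree p). coeff (pCons k p) i *\<^sub>R ?w i)"
    unfolding poly_op_def
    by (rule sum.mono_neutral_left) (auto simp: degree_pCons_eq_if coeff_eq_0 coeff_pCons split: nat.split)
  also have "\<dots> = k *\<^sub>R id_blinfun + (\<Sum>i\<le>degree p. coeff p i *\<^sub>R (a o\<^sub>L ?w i))"
    by (simp add: sum.atMost_Suc_shift del: sum.atMost_Suc)
  also have "(\<Sum>i\<le>degree p. coeff p i *\<^sub>R (a o\<^sub>L ?w i)) = a o\<^sub>L poly_op p a"
    unfolding poly_op_def
    by (simp add: bounded_bilinear.sum_right[OF bounded_bilinear_blinfun_compose]
        bounded_bilinear.scaleR_right[OF bounded_bilinear_blinfun_compose])
  finally show ?thesis .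
qed

lemma tendsto_poly_diff:
  assumes "c \<longlonglongrightarrow> (0::real)"
  shows "(\<lambda>n. poly p (c n) - poly p 0) \<longlonglongrightarrow> 0"
  using tendsto_diff[OF tendsto_poly[OF assms] tendsto_const, of p "poly p 0"] by simp

text \<open>The identity has no normal form along \<open>e\<close>: a nonzero constant is not null,
  and \<open>e\<close> may be incomplete. Hence the constant term is kept apart.\<close>

lemma poly_op_diag_op:
  assumes e: "orthonormal e" and c: "c \<longlonglongrightarrow> 0"
  shows "poly_op p (diag_op e c) = poly p 0 *\<^sub>R id_blinfun + diag_op e (\<lambda>n. poly p (c n) - poly p 0)"
proof (induction p)
  case 0
  then show ?case by (simp add: poly_op_0 diag_op_zero)
next
  case (pCons k p)
  let ?d = "\<lambda>n. poly p (c n) - poly p 0"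
  have d: "?d \<longlonglongrightarrow> 0" by (rule tendsto_poly_diff[OF c])
  have lim: "(\<lambda>n. poly p 0 * c n) \<longlonglongrightarrow> 0" "(\<lambda>n. c n * ?d n) \<longlonglongrightarrow> 0"
    using tendsto_mult_right_zero[OF c] tendsto_mult_zero[OF c d] by auto
  have "poly_op (pCons k p) (diag_op e c)
      = k *\<^sub>R id_blinfun + (poly p 0 *\<^sub>R diag_op e c + (diag_op e c o\<^sub>L diag_op e ?d))"
    unfolding poly_op_pCons pCons.IH
    by (simp add: bounded_bilinear.add_right[OF bounded_bilinear_blinfun_compose]
        bounded_bilinear.scaleR_right[OF bounded_bilinear_blinfun_compose] blinfun_eqI)
  also have "poly p 0 *\<^sub>R diag_op e c + (diag_op e c o\<^sub>L diag_op e ?d)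
      = diag_op e (\<lambda>n. poly p 0 * c n + c n * ?d n)"
    unfolding diag_op_compose[OF e c d] diag_op_add[OF e lim] diag_op_scaleR[OF e c] ..
  also have "(\<lambda>n. poly p 0 * c n + c n * ?d n) = (\<lambda>n. poly (pCons k p) (c n) - poly (pCons k p) 0)"
    by (auto simp: algebra_simps)
  finally show ?case by simp
qed

lemma real_poly_approximation:
  fixes f :: "real \<Rightarrow> real"
  assumes "compact S" "continuous_on S f" "0 < r"
  obtains p where "\<And>x. x \<in> S \<Longrightarrow> \<bar>f x - poly p x\<bar> < r"
proof -
  obtain g where g: "real_polynomial_function g" "\<And>x. x \<in> S \<Longrightarrow> \<bar>f x - g x\<bar> < r"
    using Stone_Weierstrass_real_polynomial_function[OF assms] by blast
  then obtain a n where "g = (\<lambda>x. \<Sum>i\<le>n. a i * x ^ i)"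
    by (auto simp: real_polynomial_function_iff_sum)
  then have "poly (\<Sum>i\<le>n. monom (a i) i) x = g x" for x by (simp add: poly_sum poly_monom)
  then show ?thesis using that g(2) by metis
qed

lemma fun_calc_tendsto:
  assumes "orthonormal e" "c \<longlonglongrightarrow> 0" "continuous_on (real_spectrum (diag_op e c)) f" "f 0 = 0"
  shows "(\<lambda>n. f (c n)) \<longlonglongrightarrow> 0"
proof -
  have "(\<lambda>n. f (c n)) \<longlonglongrightarrow> f 0"
    using assms by (intro continuous_on_tendsto_compose[OF assms(3,2)]) (auto simp: real_spectrum_diag_op)
  then show ?thesis by (simp add: assms)
qed

text \<open>For the \<open>THE\<close> in \<open>fun_calc\<close>, existence needs polynomial
  approximation on the compact spectrum; uniqueness holds because every uniformly approximating
  sequence of polynomials leads to the same diagonal operator.\<close>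

lemma fun_calc_diag_op:
  assumes e: "orthonormal e" and c: "c \<longlonglongrightarrow> 0"
    and f: "continuous_on (real_spectrum (diag_op e c)) f" and f0: "f 0 = 0"
  shows "fun_calc f (diag_op e c) = diag_op e (\<lambda>n. f (c n))"
proof -
  let ?A = "diag_op e c" and ?S = "real_spectrum (diag_op e c)"
  have S: "?S = insert 0 (range c)" by (rule real_spectrum_diag_op[OF e c])
  have fc: "(\<lambda>n. f (c n)) \<longlonglongrightarrow> 0" by (rule fun_calc_tendsto[OF assms])
  \<comment> \<open>As \<open>f 0 = 0\<close>, the constant \<open>poly p 0\<close> is at most
    \<open>r\<close> in absolute value. It enters once through the identity and once in each
    coefficient, besides the error of \<open>p\<close> at \<open>c n\<close>.\<close>
  have bound: "norm (poly_op p ?A - diag_op e (\<lambda>n. f (c n))) \<le> 3 * r"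
    if p: "\<And>x. x \<in> ?S \<Longrightarrow> \<bar>poly p x - f x\<bar> \<le> r" for p r
  proof -
    have "poly_op p ?A - diag_op e (\<lambda>n. f (c n))
        = poly p 0 *\<^sub>R id_blinfun + diag_op e (\<lambda>n. poly p (c n) - poly p 0 - f (c n))"
      unfolding poly_op_diag_op[OF e c] diag_op_diff[OF e tendsto_poly_diff[OF c] fc] by simp
    also have "norm \<dots> \<le> norm (poly p 0 *\<^sub>R (id_blinfun :: 'a \<Rightarrow>\<^sub>L 'a))
        + norm (diag_op e (\<lambda>n. poly p (c n) - poly p 0 - f (c n)))"
      by (rule norm_triangle_ineq)
    also have "norm (diag_op e (\<lambda>n. poly p (c n) - poly p 0 - f (c n))) \<le> 2 * r"
    proof (rule norm_diag_op_le[OF e])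
      show "(\<lambda>n. poly p (c n) - poly p 0 - f (c n)) \<longlonglongrightarrow> 0"
        using tendsto_diff[OF tendsto_poly_diff[OF c] fc] by simp
      show "\<bar>poly p (c n) - poly p 0 - f (c n)\<bar> \<le> 2 * r" for n
        using p[of "c n"] p[of 0] f0 by (simp add: S)
    qed
    also have "norm (poly p 0 *\<^sub>R (id_blinfun :: 'a \<Rightarrow>\<^sub>L 'a)) \<le> r"
    proof -
      have "\<bar>poly p 0\<bar> * norm (id_blinfun :: 'a \<Rightarrow>\<^sub>L 'a) \<le> \<bar>poly p 0\<bar> * 1"
        by (intro mult_left_mono norm_blinfun_id_le) auto
      also have "\<dots> \<le> r" using p[of 0] f0 by (simp add: S)
      finally show ?thesis by simp
    qed
    finally show ?thesis by simp
  qed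
  have conv: "(\<lambda>n. poly_op (p n) ?A) \<longlonglongrightarrow> diag_op e (\<lambda>n. f (c n))"
    if "uniform_limit ?S (\<lambda>n. poly (p n)) f sequentially" for p
  proof (rule metric_LIMSEQ_I)
    fix r :: real assume r: "0 < r"
    then have "\<forall>\<^sub>F n in sequentially. \<forall>x\<in>?S. dist (poly (p n) x) (f x) < r / 4"
      using that by (auto dest: uniform_limitD[of _ _ _ _ "r / 4"])
    then obtain N where N: "\<And>n x. n \<ge> N \<Longrightarrow> x \<in> ?S \<Longrightarrow> dist (poly (p n) x) (f x) < r / 4"
      by (auto simp: eventually_sequentially)
    have "dist (poly_op (p n) ?A) (diag_op e (\<lambda>n. f (c n))) < r" if "n \<ge> N" for n
    proof -
      have "norm (poly_op (p n) ?A - diag_op e (\<lambda>n. f (c n))) \<le> 3 * (r / 4)"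
        using N[OF that] by (intro bound) (auto simp: dist_real_def less_imp_le)
      then show ?thesis using r by (simp add: dist_norm)
    qed
    then show "\<exists>N. \<forall>n\<ge>N. dist (poly_op (p n) ?A) (diag_op e (\<lambda>n. f (c n))) < r" by blast
  qed
  have "compact ?S" unfolding S by (rule compact_sequence_with_limit[OF c])
  then have "\<exists>p. \<forall>x\<in>?S. \<bar>f x - poly p x\<bar> < 1 / real (Suc n)" for n
    using real_poly_approximation[OF _ f, of "1 / real (Suc n)"] by (metis of_nat_0_less_iff zero_less_Suc zero_less_divide_1_iff)
  then obtain p where p: "\<And>n x. x \<in> ?S \<Longrightarrow> \<bar>f x - poly (p n) x\<bar> < 1 / real (Suc n)" by metis
  have "uniform_limit ?S (\<lambda>n. poly (p n)) f sequentially"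
  proof (rule uniform_limitI)
    fix r :: real assume "0 < r"
    then obtain N where N: "1 / real (Suc N) < r" using nat_approx_posE by blast
    have "dist (poly (p n) x) (f x) < r" if "n \<ge> N" "x \<in> ?S" for n x
    proof -
      have "1 / real (Suc n) \<le> 1 / real (Suc N)" using that(1) by (intro divide_left_mono) auto
      then show ?thesis using p[OF that(2), of n] N by (simp add: dist_real_def abs_minus_commute)
    qed
    then show "\<forall>\<^sub>F n in sequentially. \<forall>x\<in>?S. dist (poly (p n) x) (f x) < r"
      by (auto simp: eventually_sequentially)
  qed
  then show ?thesis
    unfolding fun_calc_def
  proof (intro the_equality)
    show "b = diag_op e (\<lambda>n. f (c n))"
      if "\<exists>p. uniform_limit ?S (\<lambda>n. poly (p n)) f sequentially \<and> (\<lambda>n. poly_op (p n) ?A) \<longlonglongrightarrow> b" for b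
      using that conv LIMSEQ_unique by blast
  qed (use conv in blast)
qed

section \<open>Unitary conjugation\<close>

lemma id_unitary: "id_blinfun \<in> unitary_ops"
proof -
  have "adjoint_op (id_blinfun :: 'a \<Rightarrow>\<^sub>L 'a) = id_blinfun" by (rule adjoint_op_eqI) simp
  then show ?thesis by (simp add: unitary_ops_def bounded_ops_id blinfun_eqI)
qed

lemma unitary_opsI:
  assumes "u \<in> bounded_ops" and adj: "\<And>x y. cinner (blinfun_apply u x) y = cinner x (blinfun_apply v y)"
    and "\<And>x. blinfun_apply u (blinfun_apply v x) = x" "\<And>x. blinfun_apply v (blinfun_apply u x) = x"
  shows "u \<in> unitary_ops"
  using assms by (simp add: unitary_ops_def adjoint_op_eqI[OF adj] blinfun_eqI)

lemma unitary_ops_adjoint_apply: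
  assumes "u \<in> unitary_ops"
  shows "blinfun_apply u (blinfun_apply (adjoint_op u) x) = x"
    "blinfun_apply (adjoint_op u) (blinfun_apply u x) = x"
proof -
  have "u o\<^sub>L adjoint_op u = id_blinfun" "adjoint_op u o\<^sub>L u = id_blinfun"
    using assms by (simp_all add: unitary_ops_def)
  from this[THEN arg_cong[where f = "\<lambda>a. blinfun_apply a x"]]
  show "blinfun_apply u (blinfun_apply (adjoint_op u) x) = x"
    "blinfun_apply (adjoint_op u) (blinfun_apply u x) = x" by simp_all
qed

lemma unitary_ops_bounded: "u \<in> unitary_ops \<Longrightarrow> u \<in> bounded_ops"
  by (simp add: unitary_ops_def)

lemma cinner_unitary:
  assumes "u \<in> unitary_ops"
  shows "cinner (blinfun_apply u x) (blinfun_apply u y) = cinner x y"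
  by (simp add: cinner_adjoint_op[OF unitary_ops_bounded[OF assms]] unitary_ops_adjoint_apply[OF assms])

lemma unitary_ops_compose:
  assumes u: "u \<in> unitary_ops" and v: "v \<in> unitary_ops"
  shows "u o\<^sub>L v \<in> unitary_ops"
proof (rule unitary_opsI[where v = "adjoint_op v o\<^sub>L adjoint_op u"])
  show "cinner (blinfun_apply (u o\<^sub>L v) x) y = cinner x (blinfun_apply (adjoint_op v o\<^sub>L adjoint_op u) y)" for x y
    using u v by (simp add: cinner_adjoint_op unitary_ops_bounded)
qed (use u v in \<open>simp_all add: bounded_ops_compose unitary_ops_bounded unitary_ops_adjoint_apply\<close>)

lemma orthonormal_unitary:
  "u \<in> unitary_ops \<Longrightarrow> orthonormal_on I e \<Longrightarrow> orthonormal_on I (\<lambda>i. blinfun_apply u (e i))"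
  by (simp add: orthonormal_on_def cinner_unitary)

lemma unitary_conjugate_proj1:
  assumes u: "u \<in> unitary_ops"
  shows "u o\<^sub>L proj1 v o\<^sub>L adjoint_op u = proj1 (blinfun_apply u v)"
proof (rule blinfun_eqI)
  fix x
  have "cinner (blinfun_apply (adjoint_op u) x) v = cinner x (blinfun_apply u v)"
    using cinner_unitary[OF u, of "blinfun_apply (adjoint_op u) x" v] by (simp add: unitary_ops_adjoint_apply[OF u])
  then show "blinfun_apply (u o\<^sub>L proj1 v o\<^sub>L adjoint_op u) x = blinfun_apply (proj1 (blinfun_apply u v)) x"
    by (simp add: bounded_opsD[OF unitary_ops_bounded[OF u]])
qed

lemma unitary_conjugate_diag_op:
  assumes u: "u \<in> unitary_ops" and e: "orthonormal e" and c: "c \<longlonglongrightarrow> 0"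
  shows "u o\<^sub>L diag_op e c o\<^sub>L adjoint_op u = diag_op (\<lambda>n. blinfun_apply u (e n)) c"
proof -
  have "bounded_linear (\<lambda>a. u o\<^sub>L a o\<^sub>L adjoint_op u)"
    by (rule bounded_linear_compose[OF
          bounded_bilinear.bounded_linear_left[OF bounded_bilinear_blinfun_compose]
          bounded_bilinear.bounded_linear_right[OF bounded_bilinear_blinfun_compose]])
  from bounded_linear.sums[OF this diag_op_sums[OF e c]]
  have "(\<lambda>n. c n *\<^sub>R proj1 (blinfun_apply u (e n))) sums (u o\<^sub>L diag_op e c o\<^sub>L adjoint_op u)"
    by (simp add: bounded_bilinear.scaleR_right[OF bounded_bilinear_blinfun_compose]
        bounded_bilinear.scaleR_left[OF bounded_bilinear_blinfun_compose] unitary_conjugate_proj1[OF u])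
  then show ?thesis by (rule diag_op_eqI[symmetric])
qed

text \<open>The complex Householder map \<open>x \<mapsto> x - \<langle>x,w\<rangle>/\<langle>g,w\<rangle> w\<close> with \<open>w = g - h\<close> is unitary
  because \<open>\<langle>g,w\<rangle> + cnj \<langle>g,w\<rangle> = norm w ^ 2\<close> for unit vectors \<open>g\<close>, \<open>h\<close>.\<close>

lemma unitary_mapping_unit_vector:
  fixes g h :: "'h::complex_hilbert"
  assumes g: "norm g = 1" and h: "norm h = 1"
  obtains u where "u \<in> unitary_ops" "blinfun_apply u g = h"
    "\<And>x. cinner x g = cinner x h \<Longrightarrow> blinfun_apply u x = x"
proof (cases "g = h")
  case True
  then show ?thesis using that[OF id_unitary] by simp
next
  case False
  define w where "w = g - h"
  define c where "c = cinner g w"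
  define R where "R k = Blinfun (\<lambda>x. x - (k * cinner x w) *\<^sub>C w)" for k
  have R: "blinfun_apply (R k) x = x - (k * cinner x w) *\<^sub>C w" for k x
  proof -
    have "bounded_linear (\<lambda>x. x - (k * cinner x w) *\<^sub>C w)"
      by (intro bounded_linear_sub bounded_linear_ident
          bounded_linear_compose[OF bounded_linear_scaleC_left]
          bounded_linear_compose[OF bounded_linear_mult_right] bounded_linear_cinner_left)
    then show ?thesis by (simp add: R_def bounded_linear_Blinfun_apply)
  qed
  have c: "c = 1 - cinner g h" by (simp add: c_def w_def cinner_diff_right cinner_self g)
  have ww: "cinner w w = c + cnj c"
  proof -
    have "cinner g g = 1" "cinner h h = 1" using g h by (simp_all add: cinner_self)
    then show ?thesis using cinner_commute[of h g] by (simp add: c w_def cinner_simps)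
  qed
  have c0: "c \<noteq> 0"
  proof
    assume "c = 0"
    then have "w = 0" using ww cinner_self_eq_0_iff[of w] by simp
    then show False using False by (simp add: w_def)
  qed
  have RR: "blinfun_apply (R k) (blinfun_apply (R m) x) = x - ((k + m - k * m * cinner w w) * cinner x w) *\<^sub>C w" for k m x
    by (simp add: R cinner_simps scaleC_add_left complex_vector.scale_left_diff_distrib algebra_simps)
  have inv: "1 / c + 1 / cnj c - 1 / c * (1 / cnj c) * cinner w w = 0"
    "1 / cnj c + 1 / c - 1 / cnj c * (1 / c) * cinner w w = 0"
    using c0 by (simp_all add: ww field_simps)
  have "R (1 / c) \<in> unitary_ops"
  proof (rule unitary_opsI[where v = "R (1 / cnj c)"])
    show "R (1 / c) \<in> bounded_ops"
      by (simp add: bounded_ops_def R cinner_simps complex_vector.scale_right_diff_distrib scaleC_scaleC mult.left_commute)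
    show "cinner (blinfun_apply (R (1 / c)) x) y = cinner x (blinfun_apply (R (1 / cnj c)) y)" for x y
      using cinner_commute[of w y] by (simp add: R cinner_simps)
    show "blinfun_apply (R (1 / c)) (blinfun_apply (R (1 / cnj c)) x) = x" for x
      unfolding RR inv by simp
    show "blinfun_apply (R (1 / cnj c)) (blinfun_apply (R (1 / c)) x) = x" for x
      unfolding RR inv by simp
  qed
  moreover have "blinfun_apply (R (1 / c)) g = h"
    using c0 by (simp add: R c_def[symmetric] scaleC_one) (simp add: w_def)
  moreover have "blinfun_apply (R (1 / c)) x = x" if "cinner x g = cinner x h" for x
    using that by (simp add: R w_def cinner_diff_right)
  ultimately show ?thesis by (rule that)
qed

text \<open>In the induction step a second unitary carries \<open>u (e N)\<close> to
  \<open>f N\<close>. The earlier \<open>f i\<close> are orthogonal to both vectors, so its fixed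
  point clause leaves them in place.\<close>

lemma unitary_mapping_orthonormal:
  fixes e f :: "nat \<Rightarrow> 'h::complex_hilbert"
  assumes "orthonormal_on {..<N} e" "orthonormal_on {..<N} f"
  obtains u where "u \<in> unitary_ops" "\<And>i. i < N \<Longrightarrow> blinfun_apply u (e i) = f i"
  using assms
proof (induction N arbitrary: thesis)
  case 0
  then show ?case using id_unitary by blast
next
  case (Suc N)
  have "orthonormal_on {..<N} e" "orthonormal_on {..<N} f"
    using Suc.prems by (auto intro: orthonormal_on_subset)
  then obtain u where u: "u \<in> unitary_ops" "\<And>i. i < N \<Longrightarrow> blinfun_apply u (e i) = f i"
    using Suc.IH by blast
  have "norm (blinfun_apply u (e N)) = 1"
    using cinner_unitary[OF u(1), of "e N" "e N"] orthonormal_onD[OF Suc.prems(2), of N N]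
    by (simp add: norm_eq_sqrt_cinner)
  then obtain v where v: "v \<in> unitary_ops" "blinfun_apply v (blinfun_apply u (e N)) = f N"
    "\<And>x. cinner x (blinfun_apply u (e N)) = cinner x (f N) \<Longrightarrow> blinfun_apply v x = x"
    using unitary_mapping_unit_vector orthonormal_on_norm[OF Suc.prems(3), of N] by (metis lessThan_iff lessI)
  have "blinfun_apply (v o\<^sub>L u) (e i) = f i" if "i < Suc N" for i
  proof (cases "i = N")
    case False
    then have i: "i < N" using that by simp
    have "cinner (f i) (blinfun_apply u (e N)) = cinner (e i) (e N)"
      unfolding u(2)[OF i, symmetric] by (rule cinner_unitary[OF u(1)])
    also have "\<dots> = cinner (f i) (f N)"
      using i orthonormal_onD[OF Suc.prems(2), of i N] orthonormal_onD[OF Suc.prems(3), of i N] by simp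
    finally show ?thesis by (simp add: u(2)[OF i] v(3))
  qed (simp add: v(2))
  then show ?case using Suc.prems(1) unitary_ops_compose[OF v(1) u(1)] by blast
qed

section \<open>Sugeno traces\<close>

text \<open>The trace is handled through the statements \<open>r < sugeno_trace \<alpha> a\<close>
  with nonnegative \<open>r\<close>; this and the next lemma turn them back into equalities and
  inequalities.\<close>

lemma eq_if_same_strict_lower_bounds:
  fixes x y :: real
  assumes "0 \<le> x" "0 \<le> y" "\<And>r. 0 \<le> r \<Longrightarrow> r < x \<longleftrightarrow> r < y"
  shows "x = y"
  using assms(3)[of x] assms(3)[of y] assms(1,2) by (meson less_irrefl linorder_less_linear)

lemma le_if_strict_lower_bounds:
  fixes x y :: real
  assumes "0 \<le> y" "\<And>r. 0 \<le> r \<Longrightarrow> r < x \<Longrightarrow> r < y"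
  shows "x \<le> y"
  using assms(2)[of y] assms(1) by (meson less_irrefl linorder_not_le)

lemma compact_positive_ops_scaleR:
  fixes a :: "'h::complex_hilbert \<Rightarrow>\<^sub>L 'h"
  assumes inf: "\<nexists>B::'h set. finite B \<and> complex_vector.span B = UNIV"
    and a: "a \<in> compact_positive_ops" and r: "0 \<le> r"
  shows "r *\<^sub>R a \<in> compact_positive_ops"
proof -
  obtain e l where l: "orthonormal e" "decseq l" "l \<longlonglongrightarrow> 0" "a = diag_op e l"
    using spectral_theorem_compact_positive[OF inf a] .
  have "r *\<^sub>R a = diag_op e (\<lambda>n. r * l n)" using diag_op_scaleR[OF l(1,3)] l(4) by simp
  then show ?thesis
    using compact_positive_diag_op[OF l(1) tendsto_mult_right_zero[OF l(3), of r]] r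
      decseq_null_nonneg[OF l(2,3)] by simp
qed

text \<open>Two separate thresholds let one lemma cover order, norm perturbation, rescaling and
  lowering of the threshold. Compactness of \<open>b\<close> makes the larger set finite, where
  otherwise \<open>card\<close> would default to 0.\<close>

lemma spectral_count_le:
  fixes b :: "'h::complex_hilbert \<Rightarrow>\<^sub>L 'h"
  assumes inf: "\<nexists>B::'h set. finite B \<and> complex_vector.span B = UNIV"
    and b: "b \<in> compact_positive_ops" and t: "0 < t"
    and le: "\<And>x. s * (norm x)\<^sup>2 \<le> Re (cinner (blinfun_apply a x) x) \<Longrightarrow>
      t * (norm x)\<^sup>2 \<le> Re (cinner (blinfun_apply b x) x)"
  shows "spectral_count a s \<le> spectral_count b t"
proof -
  obtain e l where l: "orthonormal e" "decseq l" "l \<longlonglongrightarrow> 0" "b = diag_op e l"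
    using spectral_theorem_compact_positive[OF inf b] .
  have "{k. form_ge_on_dim b t (Suc k)} = {..<card {n. t \<le> l n}}"
    unfolding l(4) form_ge_on_dim_diag_op[OF l(1,3) decseq_null_nonneg[OF l(2,3)] t] Suc_le_eq lessThan_def ..
  then have "finite {k. form_ge_on_dim b t (Suc k)}" by simp
  moreover have "{k. form_ge_on_dim a s (Suc k)} \<subseteq> {k. form_ge_on_dim b t (Suc k)}"
    using le by (auto simp: form_ge_on_dim_def)
  ultimately show ?thesis unfolding spectral_count_def by (rule card_mono)
qed

text \<open>An eigenvector for an eigenvalue \<open>l n > 0\<close> lies in the range of
  \<open>a\<close>, being \<open>a (e n)\<close> divided by \<open>l n\<close>.\<close>

lemma finite_rank_spectral_count_bounded:
  fixes a :: "'h::complex_hilbert \<Rightarrow>\<^sub>L 'h"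
  assumes inf: "\<nexists>B::'h set. finite B \<and> complex_vector.span B = UNIV"
    and a: "a \<in> finite_rank_positive_ops"
  obtains K where "\<And>t. 0 < t \<Longrightarrow> spectral_count a t \<le> K"
proof -
  from a obtain B where B: "finite B" "range (blinfun_apply a) \<subseteq> complex_vector.span B"
    by (auto simp: finite_rank_positive_ops_def)
  obtain e l where l: "orthonormal e" "decseq l" "l \<longlonglongrightarrow> 0" "a = diag_op e l"
    using spectral_theorem_compact_positive[OF inf finite_rank_positive_imp_compact[OF a]] .
  have "spectral_count a t \<le> card B" if t: "0 < t" for t
  proof -
    let ?J = "{n. t \<le> l n}"
    have fin: "finite ?J" by (rule finite_superlevel[OF l(3) t])
    have eJ: "orthonormal_on ?J e" by (rule orthonormal_on_subset[OF l(1)]) simp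
    have "e n \<in> complex_vector.span B" if "n \<in> ?J" for n
    proof -
      have "complex_of_real (1 / l n) *\<^sub>C blinfun_apply a (e n) = e n"
        unfolding scaleC_of_real using that t by (simp add: l(4) diag_op_basis[OF l(1,3)])
      moreover have "complex_of_real (1 / l n) *\<^sub>C blinfun_apply a (e n) \<in> complex_vector.span B"
        using B(2) by (intro complex_vector.span_scale) blast
      ultimately show ?thesis by simp
    qed
    then have "card (e ` ?J) \<le> card B"
      using complex_vector.independent_span_bound[OF B(1) independent_orthonormal(1)[OF eJ fin]] by blast
    then show ?thesis
      using independent_orthonormal(2)[OF eJ fin]
        spectral_count_diag_op[OF l(1,3) decseq_null_nonneg[OF l(2,3)] t] l(4) by simp
  qed
  then show ?thesis by (rule that)
qed

section \<open>The defining properties verified for the Sugeno trace\<close>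

context
  fixes \<alpha> :: "nat \<Rightarrow> real"
  assumes inf: "\<nexists>B::'h::complex_hilbert set. finite B \<and> complex_vector.span B = UNIV"
    and mono: "mono \<alpha>" and nonneg: "\<And>n. 0 \<le> \<alpha> n" and zero: "\<alpha> 0 = 0"
begin

text \<open>The term at index \<open>i\<close> exceeds \<open>r\<close> when the eigenvalue and
  \<alpha>(i) both do. That eigenvalue, taken as threshold, has a count of at least
  \<open>i\<close>; conversely the count of a threshold serves as the index.\<close>

lemma less_sugeno_trace_iff:
  fixes a :: "'h \<Rightarrow>\<^sub>L 'h"
  assumes a: "a \<in> compact_positive_ops" and r: "0 \<le> r"
  shows "r < sugeno_trace \<alpha> a \<longleftrightarrow> (\<exists>t>r. r < \<alpha> (spectral_count a t))"
proof -
  obtain e l where l: "orthonormal e" "decseq l" "l \<longlonglongrightarrow> 0" "a = diag_op e l"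
    using spectral_theorem_compact_positive[OF inf a] .
  have "eigenvalue_sequence a l" using l by (auto simp: eigenvalue_sequence_iff)
  note ev = eigval_eq[OF this]
  have count: "i < spectral_count a t \<longleftrightarrow> t \<le> l i" if "0 < t" for i t
    unfolding l(4) spectral_count_diag_op[OF l(1,3) decseq_null_nonneg[OF l(2,3)] that]
    by (rule less_card_superlevel_iff[OF l(2,3) that])
  have "bdd_above ((\<lambda>i. min (eigval a i) (\<alpha> i)) ` {1..})"
    using decseqD[OF l(2), of 0] by (intro bdd_aboveI[of _ "l 0"]) (auto simp: ev min.coboundedI1)
  then have "r < sugeno_trace \<alpha> a \<longleftrightarrow> (\<exists>i\<in>{1..}. r < min (l (i - 1)) (\<alpha> i))"
    unfolding sugeno_trace_def by (subst less_cSUP_iff) (auto simp: ev)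
  also have "\<dots> \<longleftrightarrow> (\<exists>t>r. r < \<alpha> (spectral_count a t))"
  proof safe
    fix i :: nat assume i: "1 \<le> i" "r < min (l (i - 1)) (\<alpha> i)"
    then have "i - 1 < spectral_count a (l (i - 1))" using count[of "l (i - 1)" "i - 1"] r by simp
    then have "\<alpha> i \<le> \<alpha> (spectral_count a (l (i - 1)))" using i by (intro monoD[OF mono]) simp
    then show "\<exists>t>r. r < \<alpha> (spectral_count a t)" using i by (intro exI[of _ "l (i - 1)"]) simp
  next
    fix t assume t: "r < t" "r < \<alpha> (spectral_count a t)"
    \<comment> \<open>Indices of the supremum start at 1; a count of 0 is excluded by \<alpha>(0) =
      0.\<close>
    then have "spectral_count a t \<noteq> 0" using zero r by (cases "spectral_count a t = 0") auto
    then have "spectral_count a t - 1 < spectral_count a t" by simp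
    then have "t \<le> l (spectral_count a t - 1)" using count[of t] t r by simp
    then show "\<exists>i\<in>{1..}. r < min (l (i - 1)) (\<alpha> i)"
      using t \<open>spectral_count a t \<noteq> 0\<close> by (intro bexI[of _ "spectral_count a t"]) auto
  qed
  finally show ?thesis .
qed

lemma sugeno_trace_nonneg:
  fixes a :: "'h \<Rightarrow>\<^sub>L 'h"
  assumes a: "a \<in> compact_positive_ops"
  shows "0 \<le> sugeno_trace \<alpha> a"
proof -
  obtain e l where l: "orthonormal e" "decseq l" "l \<longlonglongrightarrow> 0" "a = diag_op e l"
    using spectral_theorem_compact_positive[OF inf a] .
  have "eigenvalue_sequence a l" using l by (auto simp: eigenvalue_sequence_iff)
  note ev = eigval_eq[OF this]
  have "bdd_above ((\<lambda>i. min (eigval a i) (\<alpha> i)) ` {1..})"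
    using decseqD[OF l(2), of 0] by (intro bdd_aboveI[of _ "l 0"]) (auto simp: ev min.coboundedI1)
  then have "min (eigval a 1) (\<alpha> 1) \<le> sugeno_trace \<alpha> a"
    unfolding sugeno_trace_def by (rule cSUP_upper[rotated]) simp
  moreover have "0 \<le> min (eigval a 1) (\<alpha> 1)"
    using nonneg decseq_null_nonneg[OF l(2,3)] by (simp add: ev)
  ultimately show ?thesis by linarith
qed

lemma monotone_sugeno_trace: "monotone_functional (sugeno_trace \<alpha> :: ('h \<Rightarrow>\<^sub>L 'h) \<Rightarrow> real)"
  unfolding monotone_functional_def
proof (intro ballI impI)
  fix a b :: "'h \<Rightarrow>\<^sub>L 'h"
  assume a: "a \<in> compact_positive_ops" and b: "b \<in> compact_positive_ops" and ab: "op_le a b"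
  show "sugeno_trace \<alpha> a \<le> sugeno_trace \<alpha> b"
  proof (rule le_if_strict_lower_bounds[OF sugeno_trace_nonneg[OF b]])
    fix r assume r: "0 \<le> r" "r < sugeno_trace \<alpha> a"
    then obtain t where t: "r < t" "r < \<alpha> (spectral_count a t)"
      using less_sugeno_trace_iff[OF a] by blast
    have "Re (cinner (blinfun_apply a x) x) \<le> Re (cinner (blinfun_apply b x) x)" for x
      using positive_ops_Re_nonneg[of "b - a" x] ab
      by (simp add: op_le_def blinfun.diff_left cinner_simps)
    then have "spectral_count a t \<le> spectral_count b t"
      using t r by (intro spectral_count_le[OF inf b]) (auto intro: order_trans)
    then have "\<alpha> (spectral_count a t) \<le> \<alpha> (spectral_count b t)" by (rule monoD[OF mono])
    then show "r < sugeno_trace \<alpha> b" using t less_sugeno_trace_iff[OF b r(1)] by force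
  qed
qed

text \<open>A perturbation of norm \<open>d\<close> moves the form by at most
  \<open>d * (norm v)\<^sup>2\<close>, so lowering the threshold by \<open>d\<close> compensates for
  it. Lower semicontinuity follows with \<delta> = \<epsilon>.\<close>

lemma sugeno_trace_norm_perturbation:
  fixes a x :: "'h \<Rightarrow>\<^sub>L 'h"
  assumes a: "a \<in> compact_positive_ops" and x: "x \<in> compact_positive_ops"
  shows "sugeno_trace \<alpha> a - norm (x - a) \<le> sugeno_trace \<alpha> x"
proof (rule ccontr)
  define d where "d = norm (x - a)"
  have d0: "0 \<le> d" by (simp add: d_def)
  note s0 = sugeno_trace_nonneg[OF x]
  assume "\<not> sugeno_trace \<alpha> a - norm (x - a) \<le> sugeno_trace \<alpha> x"
  then have "sugeno_trace \<alpha> x + d < sugeno_trace \<alpha> a" by (simp add: d_def)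
  then obtain t where t: "sugeno_trace \<alpha> x + d < t" "sugeno_trace \<alpha> x + d < \<alpha> (spectral_count a t)"
    using less_sugeno_trace_iff[OF a, of "sugeno_trace \<alpha> x + d"] s0 d0 by auto
  have "spectral_count a t \<le> spectral_count x (t - d)"
  proof (rule spectral_count_le[OF inf x])
    fix v :: 'h assume v: "t * (norm v)\<^sup>2 \<le> Re (cinner (blinfun_apply a v) v)"
    have "Re (cinner (blinfun_apply a v) v) - Re (cinner (blinfun_apply x v) v) \<le> d * (norm v)\<^sup>2"
      using Re_quadratic_form_le[of "a - x" v]
      by (simp add: d_def blinfun.diff_left cinner_simps norm_minus_commute)
    then show "(t - d) * (norm v)\<^sup>2 \<le> Re (cinner (blinfun_apply x v) v)"
      using v by (simp add: left_diff_distrib)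
  qed (use t s0 in linarith)
  then have "\<alpha> (spectral_count a t) \<le> \<alpha> (spectral_count x (t - d))" by (rule monoD[OF mono])
  \<comment> \<open>The threshold \<open>t - d\<close> would witness that the trace of
    \<open>x\<close> lies strictly below itself.\<close>
  then have "sugeno_trace \<alpha> x < t - d \<and> sugeno_trace \<alpha> x < \<alpha> (spectral_count x (t - d))"
    using t d0 by linarith
  then have "sugeno_trace \<alpha> x < sugeno_trace \<alpha> x"
    using less_sugeno_trace_iff[OF x s0] by blast
  then show False by simp
qed

lemma lower_semicontinuous_sugeno_trace:
  "lower_semicontinuous_norm (sugeno_trace \<alpha> :: ('h \<Rightarrow>\<^sub>L 'h) \<Rightarrow> real)"
  unfolding lower_semicontinuous_norm_def
proof (intro ballI allI impI)
  fix a :: "'h \<Rightarrow>\<^sub>L 'h" and \<epsilon> :: real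
  assume a: "a \<in> compact_positive_ops" and \<epsilon>: "0 < \<epsilon>"
  show "\<exists>\<delta>>0. \<forall>x\<in>compact_positive_ops. norm (x - a) < \<delta> \<longrightarrow> sugeno_trace \<alpha> a - \<epsilon> < sugeno_trace \<alpha> x"
    using \<epsilon> sugeno_trace_norm_perturbation[OF a] by (intro exI[of _ \<epsilon>]) fastforce
qed

lemma unitarily_invariant_sugeno_trace:
  "unitarily_invariant (sugeno_trace \<alpha> :: ('h \<Rightarrow>\<^sub>L 'h) \<Rightarrow> real)"
  unfolding unitarily_invariant_def
proof (intro ballI)
  fix a u :: "'h \<Rightarrow>\<^sub>L 'h"
  assume a: "a \<in> compact_positive_ops" and u: "u \<in> unitary_ops"
  obtain e l where l: "orthonormal e" "decseq l" "l \<longlonglongrightarrow> 0" "a = diag_op e l"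
    using spectral_theorem_compact_positive[OF inf a] .
  have "eigenvalue_sequence a l" using l by (auto simp: eigenvalue_sequence_iff)
  moreover have "eigenvalue_sequence (u o\<^sub>L a o\<^sub>L adjoint_op u) l"
    unfolding l(4) unitary_conjugate_diag_op[OF u l(1,3)]
    using l(2,3) orthonormal_unitary[OF u l(1)] by (auto simp: eigenvalue_sequence_iff)
  ultimately show "sugeno_trace \<alpha> (u o\<^sub>L a o\<^sub>L adjoint_op u) = sugeno_trace \<alpha> a"
    unfolding sugeno_trace_def by (simp add: eigval_eq)
qed

lemma positively_F_homogeneous_sugeno_trace:
  "positively_F_homogeneous (sugeno_trace \<alpha> :: ('h \<Rightarrow>\<^sub>L 'h) \<Rightarrow> real)"
  unfolding positively_F_homogeneous_def
proof (intro ballI allI impI)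
  fix a :: "'h \<Rightarrow>\<^sub>L 'h" and k :: real
  assume a: "a \<in> compact_positive_ops" and k: "0 \<le> k"
  obtain e l where l: "orthonormal e" "decseq l" "l \<longlonglongrightarrow> 0" "a = diag_op e l"
    using spectral_theorem_compact_positive[OF inf a] .
  have l0: "0 \<le> l n" for n by (rule decseq_null_nonneg[OF l(2,3)])
  let ?b = "diag_op e (\<lambda>n. min k (l n))"
  have cont: "continuous_on (real_spectrum (diag_op e l)) (\<lambda>x. min k x)" by (intro continuous_intros)
  have b: "fun_calc (\<lambda>x. min k x) a = ?b"
    unfolding l(4) by (rule fun_calc_diag_op[OF l(1,3) cont]) (use k in simp)
  have lim: "(\<lambda>n. min k (l n)) \<longlonglongrightarrow> 0"
    by (rule fun_calc_tendsto[OF l(1,3) cont]) (use k in simp)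
  have bc: "?b \<in> compact_positive_ops" by (rule compact_positive_diag_op[OF l(1) lim]) (use k l0 in simp)
  \<comment> \<open>Truncation at \<open>k\<close> keeps the counts at thresholds up to
    \<open>k\<close> and leaves nothing above.\<close>
  have count: "spectral_count ?b t = (if t \<le> k then spectral_count a t else 0)" if t: "0 < t" for t
    using spectral_count_diag_op[OF l(1) lim _ t] spectral_count_diag_op[OF l(1,3) l0 t] l0 k l(4) by simp
  show "sugeno_trace \<alpha> (fun_calc (\<lambda>x. min k x) a) = min k (sugeno_trace \<alpha> a)"
    unfolding b
  proof (rule eq_if_same_strict_lower_bounds)
    show "0 \<le> sugeno_trace \<alpha> ?b" by (rule sugeno_trace_nonneg[OF bc])
    show "0 \<le> min k (sugeno_trace \<alpha> a)" using k sugeno_trace_nonneg[OF a] by simp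
    fix r :: real assume r: "0 \<le> r"
    show "r < sugeno_trace \<alpha> ?b \<longleftrightarrow> r < min k (sugeno_trace \<alpha> a)"
    proof
      assume "r < sugeno_trace \<alpha> ?b"
      then obtain t where t: "r < t" "r < \<alpha> (spectral_count ?b t)"
        using less_sugeno_trace_iff[OF bc r] by blast
      then have "t \<le> k" "r < \<alpha> (spectral_count a t)" using count[of t] r zero by (auto split: if_splits)
      then show "r < min k (sugeno_trace \<alpha> a)" using t less_sugeno_trace_iff[OF a r] by auto
    next
      assume "r < min k (sugeno_trace \<alpha> a)"
      then obtain t where rk: "r < k" and t: "r < t" "r < \<alpha> (spectral_count a t)"
        using less_sugeno_trace_iff[OF a r] by auto
      \<comment> \<open>A threshold above \<open>k\<close> counts nothing after truncation. Lowering
        it to \<open>k\<close> cannot reduce the count for \<open>a\<close>, and it stays above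
        \<open>r\<close>.\<close>
      let ?t = "min t k"
      have "spectral_count a t \<le> spectral_count a ?t"
      proof (rule spectral_count_le[OF inf a])
        fix x :: 'h assume "t * (norm x)\<^sup>2 \<le> Re (cinner (blinfun_apply a x) x)"
        moreover have "?t * (norm x)\<^sup>2 \<le> t * (norm x)\<^sup>2" by (intro mult_right_mono) auto
        ultimately show "?t * (norm x)\<^sup>2 \<le> Re (cinner (blinfun_apply a x) x)" by linarith
      qed (use t rk r in simp)
      then have "\<alpha> (spectral_count a t) \<le> \<alpha> (spectral_count ?b ?t)"
        using count[of ?t] t rk r by (intro monoD[OF mono]) simp
      then have "r < ?t \<and> r < \<alpha> (spectral_count ?b ?t)" using t rk by simp
      then show "r < sugeno_trace \<alpha> ?b" using less_sugeno_trace_iff[OF bc r] by blast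
    qed
  qed
qed

text \<open>For comonotonic \<open>f\<close> and \<open>g\<close> the superlevel sets \<open>{f \<ge> t}\<close> and \<open>{g \<ge> t}\<close> are nested.\<close>

lemma comonotonic_F_additive_sugeno_trace:
  "comonotonic_F_additive (sugeno_trace \<alpha> :: ('h \<Rightarrow>\<^sub>L 'h) \<Rightarrow> real)"
  unfolding comonotonic_F_additive_def
proof (intro ballI allI impI)
  fix a :: "'h \<Rightarrow>\<^sub>L 'h" and f g :: "real \<Rightarrow> real"
  let ?S = "real_spectrum a"
  assume a: "a \<in> compact_positive_ops" and f: "nonneg_continuous_on ?S f"
    and g: "nonneg_continuous_on ?S g" and co: "comonotonic_on ?S f g" and f0: "f 0 = 0" and g0: "g 0 = 0"
  obtain e l where l: "orthonormal e" "decseq l" "l \<longlonglongrightarrow> 0" "a = diag_op e l"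
    using spectral_theorem_compact_positive[OF inf a] .
  have lS: "l n \<in> ?S" for n using real_spectrum_diag_op[OF l(1,3)] l(4) by auto
  have calc: "fun_calc h a = diag_op e (\<lambda>n. h (l n)) \<and> diag_op e (\<lambda>n. h (l n)) \<in> compact_positive_ops \<and>
      (\<forall>t>0. spectral_count (diag_op e (\<lambda>n. h (l n))) t = card {n. t \<le> h (l n)} \<and> finite {n. t \<le> h (l n)})"
    if h: "nonneg_continuous_on ?S h" "h 0 = 0" for h
  proof -
    have c: "continuous_on (real_spectrum (diag_op e l)) h" and n: "0 \<le> h (l n)" for n
      using h lS l(4) by (auto simp: nonneg_continuous_on_def)
    have lim: "(\<lambda>n. h (l n)) \<longlonglongrightarrow> 0" by (rule fun_calc_tendsto[OF l(1,3) c h(2)])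
    show ?thesis
      using fun_calc_diag_op[OF l(1,3) c h(2)] compact_positive_diag_op[OF l(1) lim n]
        spectral_count_diag_op[OF l(1) lim n] finite_superlevel[OF lim] l(4) by simp
  qed
  let ?h = "\<lambda>x. max (f x) (g x)"
  have h: "nonneg_continuous_on ?S ?h"
    using f g by (simp add: nonneg_continuous_on_def continuous_on_max le_max_iff_disj)
  note F = calc[OF f f0] and G = calc[OF g g0] and H = calc[OF h]
  have h0: "?h 0 = 0" using f0 g0 by simp
  let ?F = "diag_op e (\<lambda>n. f (l n))" and ?G = "diag_op e (\<lambda>n. g (l n))" and ?H = "diag_op e (\<lambda>n. ?h (l n))"
  have count: "spectral_count ?H t = max (spectral_count ?F t) (spectral_count ?G t)" if t: "0 < t" for t
  proof -
    let ?A = "{n. t \<le> f (l n)}" and ?B = "{n. t \<le> g (l n)}"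
    have fin: "finite ?A" "finite ?B" using F G t by blast+
    have nested: "?A \<subseteq> ?B \<or> ?B \<subseteq> ?A"
    proof (rule ccontr)
      assume "\<not> (?A \<subseteq> ?B \<or> ?B \<subseteq> ?A)"
      then obtain m n where mn: "t \<le> f (l m)" "g (l m) < t" "t \<le> g (l n)" "f (l n) < t" by force
      then have "(f (l m) - f (l n)) * (g (l m) - g (l n)) < 0" by (intro mult_pos_neg) auto
      moreover have "(f (l m) - f (l n)) * (g (l m) - g (l n)) \<ge> 0"
        using co lS by (simp add: comonotonic_on_def)
      ultimately show False by simp
    qed
    have "{n. t \<le> ?h (l n)} = ?A \<union> ?B" by (auto simp: le_max_iff_disj)
    moreover have "card (?A \<union> ?B) = max (card ?A) (card ?B)"
      using nested
    proof
      assume "?A \<subseteq> ?B"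
      then show ?thesis using card_mono[OF fin(2)] by (simp only: Un_absorb1 max_absorb2)
    next
      assume "?B \<subseteq> ?A"
      then show ?thesis using card_mono[OF fin(1)] by (simp only: Un_absorb2 max_absorb1)
    qed
    ultimately show ?thesis using F G H h0 t by simp
  qed
  \<comment> \<open>Monotonicity turns the \<open>max\<close> of counts into a disjunction of strict
    inequalities, over which the existential quantifier on thresholds distributes.\<close>
  have \<alpha>: "\<alpha> (max m n) = max (\<alpha> m) (\<alpha> n)" for m n using mono by (rule max_of_mono[symmetric])
  have cF: "?F \<in> compact_positive_ops" and cG: "?G \<in> compact_positive_ops" and cH: "?H \<in> compact_positive_ops"
    using F G H h0 by blast+
  have "sugeno_trace \<alpha> ?H = max (sugeno_trace \<alpha> ?F) (sugeno_trace \<alpha> ?G)"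
  proof (rule eq_if_same_strict_lower_bounds)
    show "0 \<le> sugeno_trace \<alpha> ?H" by (rule sugeno_trace_nonneg[OF cH])
    show "0 \<le> max (sugeno_trace \<alpha> ?F) (sugeno_trace \<alpha> ?G)"
      using sugeno_trace_nonneg[OF cF] by simp
    fix r :: real assume r: "0 \<le> r"
    have "(r < \<alpha> (spectral_count ?H t)) = (r < \<alpha> (spectral_count ?F t) \<or> r < \<alpha> (spectral_count ?G t))"
      if "r < t" for t
      using count[of t] r that by (simp add: \<alpha> less_max_iff_disj)
    then show "r < sugeno_trace \<alpha> ?H \<longleftrightarrow> r < max (sugeno_trace \<alpha> ?F) (sugeno_trace \<alpha> ?G)"
      unfolding less_max_iff_disj less_sugeno_trace_iff[OF cF r] less_sugeno_trace_iff[OF cG r]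
        less_sugeno_trace_iff[OF cH r] by blast
  qed
  then show "sugeno_trace \<alpha> (fun_calc ?h a) = max (sugeno_trace \<alpha> (fun_calc f a)) (sugeno_trace \<alpha> (fun_calc g a))"
    using F G H h0 by simp
qed

text \<open>The value increases with \<open>c\<close> and is bounded by \<open>\<alpha> K\<close>,
  where \<open>K\<close> bounds all counts of \<open>a\<close>; so the limit is the supremum over
  positive \<open>c\<close>.\<close>

lemma finite_limit_sugeno_trace:
  "finite_limit_on_finite_rank (sugeno_trace \<alpha> :: ('h \<Rightarrow>\<^sub>L 'h) \<Rightarrow> real)"
  unfolding finite_limit_on_finite_rank_def
proof
  fix a :: "'h \<Rightarrow>\<^sub>L 'h" assume fa: "a \<in> finite_rank_positive_ops"
  have a: "a \<in> compact_positive_ops" by (rule finite_rank_positive_imp_compact[OF fa])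
  have pos: "a \<in> positive_ops" using a by (simp add: compact_positive_ops_def)
  have cpo: "c *\<^sub>R a \<in> compact_positive_ops" if "0 \<le> c" for c
    by (rule compact_positive_ops_scaleR[OF inf a that])
  obtain K where K: "\<And>t. 0 < t \<Longrightarrow> spectral_count a t \<le> K"
    using finite_rank_spectral_count_bounded[OF inf fa] by blast
  let ?g = "\<lambda>c. sugeno_trace \<alpha> (c *\<^sub>R a)"
  have bound: "?g c \<le> \<alpha> K" if c: "0 < c" for c
  proof (rule le_if_strict_lower_bounds[OF nonneg])
    fix r assume r: "0 \<le> r" "r < ?g c"
    then obtain t where t: "r < t" "r < \<alpha> (spectral_count (c *\<^sub>R a) t)"
      using less_sugeno_trace_iff[OF cpo] c by fastforce
    \<comment> \<open>Rescaling the operator only rescales the threshold, so the bound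
      \<open>K\<close> does not depend on \<open>c\<close>.\<close>
    have "spectral_count (c *\<^sub>R a) t \<le> spectral_count a (t / c)"
    proof (rule spectral_count_le[OF inf a])
      fix x :: 'h assume "t * (norm x)\<^sup>2 \<le> Re (cinner (blinfun_apply (c *\<^sub>R a) x) x)"
      then show "t / c * (norm x)\<^sup>2 \<le> Re (cinner (blinfun_apply a x) x)"
        using c by (simp add: blinfun.scaleR_left cinner_simps field_simps)
    qed (use t r c in simp)
    also have "\<dots> \<le> K" using t r c by (intro K) simp
    finally have "\<alpha> (spectral_count (c *\<^sub>R a) t) \<le> \<alpha> K" by (rule monoD[OF mono])
    then show "r < \<alpha> K" using t by simp
  qed
  have inc: "?g c \<le> ?g d" if "0 < c" "c \<le> d" for c d
  proof -
    have "op_le (c *\<^sub>R a) (d *\<^sub>R a)"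
      using cpo[of "d - c"] that by (simp add: op_le_def compact_positive_ops_def scaleR_diff_left)
    then show ?thesis using monotone_sugeno_trace cpo that by (simp add: monotone_functional_def)
  qed
  have bdd: "bdd_above (?g ` {0<..})" using bound by (auto intro!: bdd_aboveI)
  have "(?g \<longlongrightarrow> (SUP c\<in>{0<..}. ?g c)) at_top"
  proof (rule order_tendstoI)
    fix y assume "y < (SUP c\<in>{0<..}. ?g c)"
    then obtain c where c: "0 < c" "y < ?g c"
      using less_cSUP_iff[OF _ bdd, of y] by auto
    show "\<forall>\<^sub>F d in at_top. y < ?g d"
      using eventually_ge_at_top[of c] by eventually_elim (use c inc in \<open>fastforce intro: less_le_trans\<close>)
  next
    fix y assume y: "(SUP c\<in>{0<..}. ?g c) < y"
    show "\<forall>\<^sub>F d in at_top. ?g d < y"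
      using eventually_gt_at_top[of 0]
    proof eventually_elim
      case (elim d)
      then have "?g d \<le> (SUP c\<in>{0<..}. ?g c)" by (intro cSUP_upper bdd) simp
      then show ?case using y by simp
    qed
  qed
  then show "\<exists>L. (?g \<longlongrightarrow> L) at_top" by blast
qed

end

section \<open>Transfer to functionals that agree with a Sugeno trace\<close>

lemma mono_imp_comonotonic_on:
  fixes S :: "'a::linorder set"
  assumes "mono_on S f" "mono_on S g"
  shows "comonotonic_on S f g"
  unfolding comonotonic_on_def
proof (intro ballI)
  fix s t assume st: "s \<in> S" "t \<in> S"
  show "0 \<le> (f s - f t) * (g s - g t)"
  proof (cases "s \<le> t")
    case True
    then show ?thesis using mono_onD[OF assms(1) st] mono_onD[OF assms(2) st]
      by (intro mult_nonpos_nonpos) auto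
  next
    case False
    then have "t \<le> s" by simp
    then show ?thesis using mono_onD[OF assms(1) st(2,1)] mono_onD[OF assms(2) st(2,1)] by simp
  qed
qed

lemma comonotonic_imp_monotonic_F_additive:
  "comonotonic_F_additive \<psi> \<Longrightarrow> monotonic_increasing_F_additive \<psi>"
  unfolding comonotonic_F_additive_def monotonic_increasing_F_additive_def
  using mono_imp_comonotonic_on by blast

text \<open>Agreement with the trace is known on the positive compact operators only, so arguments
  formed by the functional calculus must be shown to stay there.\<close>

lemma fun_calc_compact_positive:
  fixes a :: "'h::complex_hilbert \<Rightarrow>\<^sub>L 'h"
  assumes inf: "\<nexists>B::'h set. finite B \<and> complex_vector.span B = UNIV"
    and a: "a \<in> compact_positive_ops" and f: "nonneg_continuous_on (real_spectrum a) f" "f 0 = 0"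
  shows "fun_calc f a \<in> compact_positive_ops"
proof -
  obtain e l where l: "orthonormal e" "decseq l" "l \<longlonglongrightarrow> 0" "a = diag_op e l"
    using spectral_theorem_compact_positive[OF inf a] .
  have c: "continuous_on (real_spectrum (diag_op e l)) f" and n: "0 \<le> f (l n)" for n
    using f l(4) real_spectrum_diag_op[OF l(1,3)] by (auto simp: nonneg_continuous_on_def)
  show ?thesis
    unfolding l(4) fun_calc_diag_op[OF l(1,3) c f(2)]
    by (rule compact_positive_diag_op[OF l(1) fun_calc_tendsto[OF l(1,3) c f(2)] n])
qed

text \<open>For truncation: \<open>min k x\<close> is nonnegative only at nonnegative
  \<open>x\<close>.\<close>

lemma real_spectrum_nonneg:
  fixes a :: "'h::complex_hilbert \<Rightarrow>\<^sub>L 'h"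
  assumes inf: "\<nexists>B::'h set. finite B \<and> complex_vector.span B = UNIV"
    and a: "a \<in> compact_positive_ops" and t: "t \<in> real_spectrum a"
  shows "0 \<le> t"
proof -
  obtain e l where l: "orthonormal e" "decseq l" "l \<longlonglongrightarrow> 0" "a = diag_op e l"
    using spectral_theorem_compact_positive[OF inf a] .
  then show ?thesis using t real_spectrum_diag_op[OF l(1,3)] decseq_null_nonneg[OF l(2,3)] by auto
qed

lemma unitary_conjugate_compact_positive:
  fixes a :: "'h::complex_hilbert \<Rightarrow>\<^sub>L 'h"
  assumes inf: "\<nexists>B::'h set. finite B \<and> complex_vector.span B = UNIV"
    and a: "a \<in> compact_positive_ops" and u: "u \<in> unitary_ops"
  shows "u o\<^sub>L a o\<^sub>L adjoint_op u \<in> compact_positive_ops"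
proof -
  obtain e l where l: "orthonormal e" "decseq l" "l \<longlonglongrightarrow> 0" "a = diag_op e l"
    using spectral_theorem_compact_positive[OF inf a] .
  show ?thesis
    unfolding l(4) unitary_conjugate_diag_op[OF u l(1,3)]
    by (rule compact_positive_diag_op[OF orthonormal_unitary[OF u l(1)] l(3) decseq_null_nonneg[OF l(2,3)]])
qed

text \<open>The properties only concern values on the positive compact operators, so they pass from
  \<open>sugeno_trace \<alpha>\<close> to every functional that agrees with it there.\<close>

lemma sugeno_type_properties:
  fixes \<psi> :: "('h::complex_hilbert \<Rightarrow>\<^sub>L 'h) \<Rightarrow> real"
  assumes inf: "\<nexists>B::'h set. finite B \<and> complex_vector.span B = UNIV"
    and \<alpha>: "mono \<alpha>" "\<And>n. 0 \<le> \<alpha> n" "\<alpha> 0 = 0"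
    and eq: "\<And>a. a \<in> compact_positive_ops \<Longrightarrow> \<psi> a = sugeno_trace \<alpha> a"
  shows "comonotonic_F_additive \<psi>" "unitarily_invariant \<psi>" "monotone_functional \<psi>"
    "positively_F_homogeneous \<psi>" "lower_semicontinuous_norm \<psi>" "finite_limit_on_finite_rank \<psi>"
proof -
  show "comonotonic_F_additive \<psi>"
    unfolding comonotonic_F_additive_def
  proof (intro ballI allI impI)
    fix a :: "'h \<Rightarrow>\<^sub>L 'h" and f g :: "real \<Rightarrow> real"
    assume *: "a \<in> compact_positive_ops" "nonneg_continuous_on (real_spectrum a) f"
      "nonneg_continuous_on (real_spectrum a) g" "comonotonic_on (real_spectrum a) f g" "f 0 = 0" "g 0 = 0"
    have "nonneg_continuous_on (real_spectrum a) (\<lambda>x. max (f x) (g x))"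
      using *(2,3) by (simp add: nonneg_continuous_on_def continuous_on_max le_max_iff_disj)
    then have "fun_calc (\<lambda>x. max (f x) (g x)) a \<in> compact_positive_ops"
      using * by (intro fun_calc_compact_positive[OF inf]) auto
    then show "\<psi> (fun_calc (\<lambda>x. max (f x) (g x)) a) = max (\<psi> (fun_calc f a)) (\<psi> (fun_calc g a))"
      using comonotonic_F_additive_sugeno_trace[OF inf \<alpha>] * fun_calc_compact_positive[OF inf *(1)]
      by (simp add: eq comonotonic_F_additive_def)
  qed
  show "unitarily_invariant \<psi>"
    using unitarily_invariant_sugeno_trace[OF inf \<alpha>] unitary_conjugate_compact_positive[OF inf]
    by (simp add: unitarily_invariant_def eq)
  show "monotone_functional \<psi>"
    using monotone_sugeno_trace[OF inf \<alpha>] by (simp add: monotone_functional_def eq)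
  show "positively_F_homogeneous \<psi>"
    unfolding positively_F_homogeneous_def
  proof (intro ballI allI impI)
    fix a :: "'h \<Rightarrow>\<^sub>L 'h" and k :: real
    assume *: "a \<in> compact_positive_ops" "0 \<le> k"
    then have "nonneg_continuous_on (real_spectrum a) (\<lambda>x. min k x)"
      using real_spectrum_nonneg[OF inf] by (auto simp: nonneg_continuous_on_def intro!: continuous_intros)
    then have "fun_calc (\<lambda>x. min k x) a \<in> compact_positive_ops"
      using * by (intro fun_calc_compact_positive[OF inf]) auto
    then show "\<psi> (fun_calc (\<lambda>x. min k x) a) = min k (\<psi> a)"
      using positively_F_homogeneous_sugeno_trace[OF inf \<alpha>] * by (simp add: eq positively_F_homogeneous_def)
  qed
  show "lower_semicontinuous_norm \<psi>"
    using lower_semicontinuous_sugeno_trace[OF inf \<alpha>] by (simp add: lower_semicontinuous_norm_def eq)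
  show "finite_limit_on_finite_rank \<psi>"
    unfolding finite_limit_on_finite_rank_def
  proof
    fix a :: "'h \<Rightarrow>\<^sub>L 'h" assume a: "a \<in> finite_rank_positive_ops"
    then obtain L where lim: "((\<lambda>c. sugeno_trace \<alpha> (c *\<^sub>R a)) \<longlongrightarrow> L) at_top"
      using finite_limit_sugeno_trace[OF inf \<alpha>] by (auto simp: finite_limit_on_finite_rank_def)
    have "\<forall>\<^sub>F c in at_top. sugeno_trace \<alpha> (c *\<^sub>R a) = \<psi> (c *\<^sub>R a)"
      using eventually_ge_at_top[of 0]
      by eventually_elim
        (simp add: eq compact_positive_ops_scaleR[OF inf finite_rank_positive_imp_compact[OF a]])
    from Lim_transform_eventually[OF lim this] show "\<exists>L. ((\<lambda>c. \<psi> (c *\<^sub>R a)) \<longlongrightarrow> L) at_top" ..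
  qed
qed

section \<open>Reconstructing the weight function\<close>

lemma zero_compact_positive: "0 \<in> compact_positive_ops"
proof -
  have "blinfun_apply (0 :: 'a \<Rightarrow>\<^sub>L 'a) ` cball 0 1 = {0}" by (auto simp: image_def intro: exI[of _ 0])
  then show ?thesis by (simp add: compact_positive_ops_def positive_ops_def bounded_ops_zero)
qed

lemma finite_support_tendsto_zero: "(\<lambda>n. if n < N then c else 0) \<longlonglongrightarrow> (0::real)"
  by (rule tendsto_eventually, rule eventually_sequentiallyI[of N]) simp

lemma initial_segment_diag_op:
  fixes e :: "nat \<Rightarrow> 'h::complex_hilbert"
  assumes e: "orthonormal e" and c: "0 \<le> c"
  shows "diag_op e (\<lambda>n. if n < N then c else 0) \<in> compact_positive_ops"
    and "diag_op e (\<lambda>n. if n < N then c else 0) \<in> finite_rank_positive_ops"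
proof -
  let ?q = "diag_op e (\<lambda>n. if n < N then c else 0)"
  show "?q \<in> compact_positive_ops"
    by (rule compact_positive_diag_op[OF e finite_support_tendsto_zero]) (use c in simp)
  then have "?q \<in> positive_ops" by (simp add: compact_positive_ops_def)
  moreover have "range (blinfun_apply ?q) \<subseteq> complex_vector.span (e ` {..<N})"
  proof (intro image_subsetI)
    fix x
    have "blinfun_apply ?q x = (\<Sum>n<N. (of_real c * cinner x (e n)) *\<^sub>C e n)"
      unfolding diag_op_finite[of N "\<lambda>n. if n < N then c else 0" e, simplified]
      by (simp add: blinfun.sum_left blinfun.scaleR_left scaleC_scaleC flip: scaleC_of_real)
    then show "blinfun_apply ?q x \<in> complex_vector.span (e ` {..<N})"
      using orthonormal_sum_in_span by metis
  qed
  ultimately show "?q \<in> finite_rank_positive_ops"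
    unfolding finite_rank_positive_ops_def by blast
qed

text \<open>A step function at an eigenvalue is replaced by a continuous ramp that rises inside the
  spectral gap just below it.\<close>

lemma spectral_step_function:
  fixes l :: "nat \<Rightarrow> real"
  assumes l: "decseq l" "l \<longlonglongrightarrow> 0" and s: "0 < s"
  obtains f N where "continuous_on UNIV f" "mono f" "f 0 = 0" "\<And>x. 0 \<le> f x"
    "\<And>n. f (l n) = (if n < N then s else 0)" "\<And>n. n < N \<longleftrightarrow> s \<le> l n"
proof -
  define N where "N = card {n. s \<le> l n}"
  have N: "n < N \<longleftrightarrow> s \<le> l n" for n unfolding N_def by (rule less_card_superlevel_iff[OF l s])
  \<comment> \<open>The first value of \<open>l\<close> below \<open>s\<close>; no eigenvalue lies
    strictly between the two ends of the ramp.\<close>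
  define t where "t = l N"
  have t: "0 \<le> t" "t < s" using N[of N] decseq_null_nonneg[OF l] by (auto simp: t_def)
  define f where "f x = s * max 0 (min 1 ((x - t) / (s - t)))" for x
  have "continuous_on UNIV f" unfolding f_def using t by (intro continuous_intros) auto
  moreover have "mono f"
  proof (rule monoI)
    fix x y :: real assume "x \<le> y"
    then have "(x - t) / (s - t) \<le> (y - t) / (s - t)" using t by (intro divide_right_mono) auto
    then show "f x \<le> f y" unfolding f_def using s by (intro mult_left_mono) auto
  qed
  moreover have "(0 - t) / (s - t) \<le> 0" using t by (intro divide_nonpos_pos) auto
  then have "f 0 = 0" by (simp add: f_def)
  moreover have "0 \<le> f x" for x using s by (simp add: f_def)
  moreover have "f (l n) = (if n < N then s else 0)" for n
  proof (cases "n < N")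
    case True
    then have "1 \<le> (l n - t) / (s - t)" using N t by (simp add: field_simps)
    then show ?thesis using True by (simp add: f_def)
  next
    case False
    then have "l n \<le> t" using decseqD[OF l(1), of N n] by (simp add: t_def)
    then have "(l n - t) / (s - t) \<le> 0" using t by (intro divide_nonpos_pos) auto
    then show ?thesis using False by (simp add: f_def)
  qed
  ultimately show ?thesis using that N by blast
qed

lemma Sugeno_type_of_properties:
  fixes \<psi> :: "('h::complex_hilbert \<Rightarrow>\<^sub>L 'h) \<Rightarrow> real"
  assumes inf: "\<nexists>B::'h set. finite B \<and> complex_vector.span B = UNIV"
    and nn: "\<And>a. a \<in> compact_positive_ops \<Longrightarrow> 0 \<le> \<psi> a"
    and add: "monotonic_increasing_F_additive \<psi>" and unit: "unitarily_invariant \<psi>"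
    and mono: "monotone_functional \<psi>" and hom: "positively_F_homogeneous \<psi>"
    and lsc: "lower_semicontinuous_norm \<psi>" and fin: "finite_limit_on_finite_rank \<psi>"
  obtains \<alpha> :: "nat \<Rightarrow> real" where "mono \<alpha>" "\<And>n. 0 \<le> \<alpha> n" "\<alpha> 0 = 0"
    "\<And>a. a \<in> compact_positive_ops \<Longrightarrow> \<psi> a = sugeno_trace \<alpha> a"
proof -
  \<comment> \<open>The spectral theorem for the zero operator supplies an orthonormal
    sequence.\<close>
  obtain d :: "nat \<Rightarrow> 'h" where d: "orthonormal d"
    using spectral_theorem_compact_positive[OF inf zero_compact_positive] by blast
  \<comment> \<open>\<open>diag_op e (seg N c)\<close> is \<open>c\<close> times the projection onto
    the first \<open>N\<close> vectors of \<open>e\<close>.\<close>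
  define seg where "seg N c n = (if n < N then c else 0)" for N n :: nat and c :: real
  have seg0: "seg N c \<longlonglongrightarrow> 0" for N c using finite_support_tendsto_zero unfolding seg_def .
  have seg_cpo: "diag_op e (seg N c) \<in> compact_positive_ops"
    if "orthonormal e" "0 \<le> c" for e :: "nat \<Rightarrow> 'h" and N c
    using initial_segment_diag_op(1)[OF that, of N] unfolding seg_def .
  have seg_scale: "c *\<^sub>R diag_op d (seg N 1) = diag_op d (seg N c)" for N c
    using diag_op_scaleR[OF d seg0, of c N 1] by (simp add: seg_def[abs_def] if_distrib cong: if_cong)
  have "\<exists>L. ((\<lambda>c. \<psi> (diag_op d (seg N c))) \<longlongrightarrow> L) at_top" for N
  proof -
    have "diag_op d (seg N 1) \<in> finite_rank_positive_ops"
      using initial_segment_diag_op(2)[OF d zero_le_one, of N] unfolding seg_def .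
    then have "\<exists>L. ((\<lambda>c. \<psi> (c *\<^sub>R diag_op d (seg N 1))) \<longlongrightarrow> L) at_top"
      using fin by (simp add: finite_limit_on_finite_rank_def)
    then show ?thesis by (simp add: seg_scale)
  qed
  then obtain \<alpha> where \<alpha>: "\<And>N. ((\<lambda>c. \<psi> (diag_op d (seg N c))) \<longlongrightarrow> \<alpha> N) at_top" by metis
  \<comment> \<open>Homogeneity with \<open>k = 0\<close> gives the upper bound 0, and nonnegativity
    of \<psi> the lower one.\<close>
  have psi0: "\<psi> 0 = 0"
  proof -
    have "fun_calc (min 0) (diag_op d (\<lambda>n. 0)) = diag_op d (\<lambda>n. min 0 0)"
      by (rule fun_calc_diag_op[OF d]) (auto intro!: continuous_intros)
    then have "fun_calc (min 0) (0 :: 'h \<Rightarrow>\<^sub>L 'h) = 0" by (simp add: diag_op_zero)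
    moreover have "\<psi> (fun_calc (min 0) 0) = min 0 (\<psi> 0)"
      using hom zero_compact_positive unfolding positively_F_homogeneous_def by fastforce
    ultimately show ?thesis using nn[OF zero_compact_positive] by simp
  qed
  have \<alpha>_nonneg: "0 \<le> \<alpha> N" for N
  proof (rule tendsto_lowerbound[OF \<alpha>])
    show "\<forall>\<^sub>F c in at_top. 0 \<le> \<psi> (diag_op d (seg N c))"
      using eventually_ge_at_top[of 0] by eventually_elim (intro nn seg_cpo d)
  qed simp
  have \<alpha>0: "\<alpha> 0 = 0"
  proof -
    have "diag_op d (seg 0 c) = 0" for c using diag_op_zero by (simp add: seg_def[abs_def])
    then have "((\<lambda>c::real. 0::real) \<longlongrightarrow> \<alpha> 0) at_top" using \<alpha>[of 0] psi0 by simp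
    then show ?thesis by (simp add: tendsto_const_iff)
  qed
  have \<alpha>_mono: "mono \<alpha>"
  proof (rule monoI)
    fix M N :: nat assume MN: "M \<le> N"
    show "\<alpha> M \<le> \<alpha> N"
    proof (rule tendsto_le[OF _ \<alpha> \<alpha>])
      show "\<forall>\<^sub>F c in at_top. \<psi> (diag_op d (seg M c)) \<le> \<psi> (diag_op d (seg N c))"
        using eventually_ge_at_top[of 0]
      proof eventually_elim
        case (elim c)
        have "(\<lambda>n. seg N c n - seg M c n) \<longlonglongrightarrow> 0" using tendsto_diff[OF seg0 seg0] by simp
        then have "diag_op d (\<lambda>n. seg N c n - seg M c n) \<in> positive_ops"
          by (rule positive_ops_diag_op[OF d]) (use elim MN in \<open>simp add: seg_def\<close>)
        then have "op_le (diag_op d (seg M c)) (diag_op d (seg N c))"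
          by (simp add: op_le_def diag_op_diff[OF d seg0 seg0])
        then show ?case using mono seg_cpo[OF d elim] by (simp add: monotone_functional_def)
      qed
    qed simp
  qed
  \<comment> \<open>For every \<open>c \<ge> k\<close>, truncating \<open>c\<close> times the
    projection at \<open>k\<close> leaves \<open>k\<close> times the projection; letting
    \<open>c\<close> grow replaces \<psi> by \<alpha>(N).\<close>
  have psi_seg: "\<psi> (diag_op d (seg N k)) = min k (\<alpha> N)" if k: "0 \<le> k" for N k
  proof -
    have "min k (\<psi> (diag_op d (seg N c))) = \<psi> (diag_op d (seg N k))" if c: "k \<le> c" for c
    proof -
      have "fun_calc (min k) (diag_op d (seg N c)) = diag_op d (\<lambda>n. min k (seg N c n))"
        by (rule fun_calc_diag_op[OF d seg0]) (use k in \<open>auto intro!: continuous_intros\<close>)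
      also have "(\<lambda>n. min k (seg N c n)) = seg N k" using k c by (auto simp: seg_def)
      finally have "\<psi> (diag_op d (seg N k)) = \<psi> (fun_calc (\<lambda>x. min k x) (diag_op d (seg N c)))" by simp
      then show ?thesis using hom k c seg_cpo[OF d, of c N] by (simp add: positively_F_homogeneous_def)
    qed
    then have "\<forall>\<^sub>F c in at_top. min k (\<psi> (diag_op d (seg N c))) = \<psi> (diag_op d (seg N k))"
      by (rule eventually_mono[OF eventually_ge_at_top[of k]])
    moreover have "((\<lambda>c. min k (\<psi> (diag_op d (seg N c)))) \<longlongrightarrow> min k (\<alpha> N)) at_top"
      by (intro tendsto_min tendsto_const \<alpha>)
    ultimately have "((\<lambda>c::real. \<psi> (diag_op d (seg N k))) \<longlongrightarrow> min k (\<alpha> N)) at_top"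
      by (rule Lim_transform_eventually[rotated])
    then show ?thesis by (simp add: tendsto_const_iff)
  qed
  \<comment> \<open>Instantiated with the trace itself, agreement being \<open>refl\<close>: now
    both functionals have the same list of properties.\<close>
  note sugeno = sugeno_type_properties[OF inf \<alpha>_mono \<alpha>_nonneg \<alpha>0 refl]
  \<comment> \<open>The operator is a finite sum over the first \<open>N\<close> vectors, so a
    unitary matching only these carries one segment to the other.\<close>
  have psi_seg': "\<psi> (diag_op e (seg N k)) = min k (\<alpha> N)" if e: "orthonormal e" and k: "0 \<le> k" for e N k
  proof -
    have "orthonormal_on {..<N} d" "orthonormal_on {..<N} e"
      using orthonormal_on_subset[OF d] orthonormal_on_subset[OF e] by auto
    then obtain u where u: "u \<in> unitary_ops" "\<And>i. i < N \<Longrightarrow> blinfun_apply u (d i) = e i"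
      using unitary_mapping_orthonormal by blast
    have *: "diag_op f (seg N k) = (\<Sum>n<N. k *\<^sub>R proj1 (f n))" for f :: "nat \<Rightarrow> 'h"
      by (subst diag_op_finite[of N]) (auto simp: seg_def)
    have "u o\<^sub>L diag_op d (seg N k) o\<^sub>L adjoint_op u = diag_op e (seg N k)"
      unfolding unitary_conjugate_diag_op[OF u(1) d seg0] by (simp add: * u(2))
    then show ?thesis
      using unit u(1) seg_cpo[OF d k, of N] psi_seg[OF k, of N] by (metis unitarily_invariant_def)
  qed
  have sug_seg: "sugeno_trace \<alpha> (diag_op e (seg N k)) = min k (\<alpha> N)"
    if e: "orthonormal e" and k: "0 \<le> k" for e :: "nat \<Rightarrow> 'h" and N k
  proof -
    have "decseq (seg N k)" using k by (auto simp: seg_def decseq_def)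
    then have "eigenvalue_sequence (diag_op e (seg N k)) (seg N k)"
      using e seg0 by (auto simp: eigenvalue_sequence_iff)
    note ev = eigval_eq[OF this]
    show ?thesis
      unfolding sugeno_trace_def
    proof (rule cSup_eq_maximum)
      show "min k (\<alpha> N) \<in> (\<lambda>i. min (eigval (diag_op e (seg N k)) i) (\<alpha> i)) ` {1..}"
      \<comment> \<open>The supremum is attained at index \<open>N\<close>, the end of the segment.
        For \<open>N = 0\<close> index 1 is taken, where the eigenvalue and hence the term is
        0.\<close>
      proof (rule image_eqI[of _ _ "max 1 N"])
        show "min k (\<alpha> N) = min (eigval (diag_op e (seg N k)) (max 1 N)) (\<alpha> (max 1 N))"
          unfolding ev using \<alpha>0 \<alpha>_nonneg[of 1] k by (cases "N = 0") (simp_all add: seg_def)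
      qed simp
      fix x assume "x \<in> (\<lambda>i. min (eigval (diag_op e (seg N k)) i) (\<alpha> i)) ` {1..}"
      then obtain i where i: "i \<ge> 1" "x = min (seg N k (i - 1)) (\<alpha> i)" by (auto simp: ev)
      show "x \<le> min k (\<alpha> N)"
      proof (cases "i \<le> N")
        case True
        then show ?thesis using monoD[OF \<alpha>_mono True] i by (auto simp: seg_def)
      next
        case False
        then show ?thesis using i k \<alpha>_nonneg[of N] by (auto simp: seg_def)
      qed
    qed
  qed
  \<comment> \<open>Approximants from below on which both functionals already have the same
    value.\<close>
  have agree: "\<exists>b\<in>compact_positive_ops. norm (b - a) \<le> r \<and> op_le b a \<and> \<psi> b = sugeno_trace \<alpha> b"
    if a: "a \<in> compact_positive_ops" and r: "0 < r" for a r
  proof -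
    obtain e l where l: "orthonormal e" "decseq l" "l \<longlonglongrightarrow> 0" "a = diag_op e l"
      using spectral_theorem_compact_positive[OF inf a] .
    have l0: "0 \<le> l n" for n by (rule decseq_null_nonneg[OF l(2,3)])
    have calc: "fun_calc f a = diag_op e (\<lambda>n. f (l n))" "nonneg_continuous_on (real_spectrum a) f"
      "(\<lambda>n. f (l n)) \<longlonglongrightarrow> 0"
      if "continuous_on UNIV f" "f 0 = 0" "\<And>x. 0 \<le> f x" for f
    proof -
      have "continuous_on (real_spectrum (diag_op e l)) f"
        by (rule continuous_on_subset[OF that(1)]) simp
      then show "fun_calc f a = diag_op e (\<lambda>n. f (l n))" "nonneg_continuous_on (real_spectrum a) f"
        "(\<lambda>n. f (l n)) \<longlonglongrightarrow> 0"
        using fun_calc_diag_op[OF l(1,3)] fun_calc_tendsto[OF l(1,3)] that l(4)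
        by (auto simp: nonneg_continuous_on_def)
    qed
    \<comment> \<open>\<open>T\<close> is a finite set of levels. On the eigenvalues
      \<open>g\<close> stays below the identity and attains at least each level of \<open>T\<close>
      that the eigenvalue reaches; every new level adds one step through \<open>max\<close>.\<close>
    have "\<exists>g. continuous_on UNIV g \<and> mono g \<and> g 0 = 0 \<and> (\<forall>x. 0 \<le> g x) \<and>
        (\<forall>n. g (l n) \<le> l n \<and> (\<forall>s\<in>T. s \<le> l n \<longrightarrow> s \<le> g (l n))) \<and>
        \<psi> (fun_calc g a) = sugeno_trace \<alpha> (fun_calc g a)"
      if "finite T" "T \<subseteq> {0<..}" for T
      using that
    proof (induction T)
      case empty
      have "fun_calc (\<lambda>x. 0) a = 0" using calc(1)[of "\<lambda>x. 0"] by (simp add: diag_op_zero)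
      moreover have "\<psi> 0 = sugeno_trace \<alpha> (0 :: 'h \<Rightarrow>\<^sub>L 'h)"
        using psi_seg'[OF d order_refl, of 0] sug_seg[OF d order_refl, of 0]
        by (simp add: seg_def[abs_def] diag_op_zero)
      ultimately show ?case using l0 by (intro exI[of _ "\<lambda>x. 0"]) (auto simp: mono_def)
    next
      case (insert s T)
      then obtain g where g: "continuous_on UNIV g" "mono g" "g 0 = 0" "\<And>x. 0 \<le> g x"
        "\<And>n. g (l n) \<le> l n" "\<And>n s. s \<in> T \<Longrightarrow> s \<le> l n \<Longrightarrow> s \<le> g (l n)"
        "\<psi> (fun_calc g a) = sugeno_trace \<alpha> (fun_calc g a)"
        by auto
      have s: "0 < s" using insert.prems by simp
      obtain f N where f: "continuous_on UNIV f" "mono f" "f 0 = 0" "\<And>x. 0 \<le> f x"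
        "\<And>n. f (l n) = (if n < N then s else 0)" "\<And>n. n < N \<longleftrightarrow> s \<le> l n"
        using spectral_step_function[OF l(2,3) s] by blast
      let ?h = "\<lambda>x. max (g x) (f x)"
      have psi_f: "\<psi> (fun_calc f a) = sugeno_trace \<alpha> (fun_calc f a)"
      proof -
        have "fun_calc f a = diag_op e (seg N s)"
          using calc(1)[of f] f by (simp add: seg_def[abs_def])
        then show ?thesis using psi_seg'[OF l(1), of s N] sug_seg[OF l(1), of s N] s by simp
      qed
      \<comment> \<open>Stated for a general functional because it is applied both to \<psi> and to
        the trace.\<close>
      have F_max: "\<phi> (fun_calc ?h a) = max (\<phi> (fun_calc g a)) (\<phi> (fun_calc f a))"
        if "monotonic_increasing_F_additive \<phi>" for \<phi> :: "('h \<Rightarrow>\<^sub>L 'h) \<Rightarrow> real"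
        using that a calc(2)[OF g(1,3,4)] calc(2)[OF f(1,3,4)] f(3) g(3)
          mono_on_subset[OF f(2)] mono_on_subset[OF g(2)]
        by (simp add: monotonic_increasing_F_additive_def)
      have "\<psi> (fun_calc ?h a) = sugeno_trace \<alpha> (fun_calc ?h a)"
        using F_max[OF add] F_max[OF comonotonic_imp_monotonic_F_additive[OF sugeno(1)]] psi_f g(7) by simp
      moreover have "continuous_on UNIV ?h" by (intro continuous_on_max f(1) g(1))
      moreover have "mono ?h"
        using monoD[OF f(2)] monoD[OF g(2)] by (intro monoI max.mono)
      moreover have "?h (l n) \<le> l n" for n using g(5)[of n] f(5,6)[of n] l0[of n] by simp
      moreover have "t \<le> ?h (l n)" if "t \<in> insert s T" "t \<le> l n" for t n
        using that g(6)[of t n] f(5,6)[of n] by (auto simp: le_max_iff_disj)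
      ultimately show ?case
        using f(3) g(3,4) by (intro exI[of _ ?h]) (simp add: le_max_iff_disj)
    qed
    \<comment> \<open>The levels are the eigenvalues that are at least \<open>r\<close>, finitely
      many as \<open>l\<close> is null. These are fixed by \<open>g\<close>, and below
      \<open>r\<close> the bounds between 0 and the identity keep the error below
      \<open>r\<close>.\<close>
    from this[of "l ` {n. r \<le> l n}"] finite_superlevel[OF l(3) r] r
    obtain g where g: "continuous_on UNIV g" "g 0 = 0" "\<And>x. 0 \<le> g x"
      "\<And>n. g (l n) \<le> l n" "\<And>n. r \<le> l n \<Longrightarrow> l n \<le> g (l n)"
      "\<psi> (fun_calc g a) = sugeno_trace \<alpha> (fun_calc g a)"
      by fastforce
    let ?b = "diag_op e (\<lambda>n. g (l n))"
    have lim: "(\<lambda>n. g (l n)) \<longlonglongrightarrow> 0" by (rule calc(3)[OF g(1-3)])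
    have diff0: "(\<lambda>n. l n - g (l n)) \<longlonglongrightarrow> 0" using tendsto_diff[OF l(3) lim] by simp
    have diff: "a - ?b = diag_op e (\<lambda>n. l n - g (l n))" unfolding l(4) diag_op_diff[OF l(1,3) lim] ..
    have "op_le ?b a"
      unfolding op_le_def diff by (rule positive_ops_diag_op[OF l(1) diff0]) (use g(4) in simp)
    moreover have "\<bar>l n - g (l n)\<bar> \<le> r" for n
      using g(3)[of "l n"] g(4,5)[of n] r by (cases "r \<le> l n") auto
    then have "norm (a - ?b) \<le> r" unfolding diff by (rule norm_diag_op_le[OF l(1) diff0])
    moreover have "?b \<in> compact_positive_ops" by (rule compact_positive_diag_op[OF l(1) lim g(3)])
    ultimately show ?thesis using g(6) calc(1)[OF g(1-3)] by (metis norm_minus_commute)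
  qed
  \<comment> \<open>Used twice, with \<psi> and the trace in either role: \<phi> contributes
    semicontinuity at \<open>a\<close>, and \<theta> monotonicity from the approximant up to
    \<open>a\<close>.\<close>
  have le: "\<phi> a \<le> \<theta> a"
    if a: "a \<in> compact_positive_ops" and l: "lower_semicontinuous_norm \<phi>" and m: "monotone_functional \<theta>"
      and eq: "\<And>b. \<psi> b = sugeno_trace \<alpha> b \<Longrightarrow> \<phi> b = \<theta> b" for \<phi> \<theta> :: "('h \<Rightarrow>\<^sub>L 'h) \<Rightarrow> real" and a
  proof (rule field_le_epsilon)
    fix \<epsilon> :: real assume "0 < \<epsilon>"
    then obtain \<delta> where \<delta>: "0 < \<delta>"
      "\<And>x. x \<in> compact_positive_ops \<Longrightarrow> norm (x - a) < \<delta> \<Longrightarrow> \<phi> a - \<epsilon> < \<phi> x"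
      using l a unfolding lower_semicontinuous_norm_def by meson
    obtain b where b: "b \<in> compact_positive_ops" "norm (b - a) \<le> \<delta> / 2" "op_le b a" "\<psi> b = sugeno_trace \<alpha> b"
      using agree[OF a, of "\<delta> / 2"] \<delta>(1) by auto
    have "\<phi> a - \<epsilon> < \<phi> b" using b(2) \<delta>(1) by (intro \<delta>(2) b(1)) simp
    also have "\<phi> b = \<theta> b" by (rule eq[OF b(4)])
    also have "\<theta> b \<le> \<theta> a" using m a b(1,3) by (simp add: monotone_functional_def)
    finally show "\<phi> a \<le> \<theta> a + \<epsilon>" by simp
  qed
  have "\<psi> a = sugeno_trace \<alpha> a" if "a \<in> compact_positive_ops" for a
    using le[OF that lsc sugeno(3)] le[OF that sugeno(5) mono] by (intro antisym) auto
  then show ?thesis using that \<alpha>_mono \<alpha>_nonneg \<alpha>0 by blast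
qed

theorem theorem5p6:
  fixes \<psi> :: "('h::complex_hilbert \<Rightarrow>\<^sub>L 'h) \<Rightarrow> real"
  assumes "separable_infinite_dimensional TYPE('h)"
    and "\<forall>a\<in>compact_positive_ops. 0 \<le> \<psi> a"
  defines "cond1 \<equiv> \<exists>\<alpha>::nat \<Rightarrow> real. mono \<alpha> \<and> (\<forall>n. 0 \<le> \<alpha> n) \<and> \<alpha> 0 = 0 \<and>
              (\<forall>a\<in>compact_positive_ops. \<psi> a = sugeno_trace \<alpha> a)"
    and "cond2 \<equiv> monotonic_increasing_F_additive \<psi> \<and> unitarily_invariant \<psi> \<and>
              monotone_functional \<psi> \<and> positively_F_homogeneous \<psi> \<and>
              lower_semicontinuous_norm \<psi> \<and> finite_limit_on_finite_rank \<psi>"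
    and "cond3 \<equiv> comonotonic_F_additive \<psi> \<and> unitarily_invariant \<psi> \<and>
              monotone_functional \<psi> \<and> positively_F_homogeneous \<psi> \<and>
              lower_semicontinuous_norm \<psi> \<and> finite_limit_on_finite_rank \<psi>"
  shows "(cond1 \<longleftrightarrow> cond2) \<and> (cond2 \<longleftrightarrow> cond3)"
proof -
  have inf: "\<nexists>B::'h set. finite B \<and> complex_vector.span B = UNIV"
    using assms(1) by (simp add: separable_infinite_dimensional_def)
  \<comment> \<open>The equivalences follow from the cycle \<open>cond1\<close>,
    \<open>cond3\<close>, \<open>cond2\<close>, \<open>cond1\<close>.\<close>
  have "cond3" if cond1
  proof -
    from that obtain \<alpha> :: "nat \<Rightarrow> real" where "mono \<alpha>" "\<And>n. 0 \<le> \<alpha> n" "\<alpha> 0 = 0"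
      "\<And>a. a \<in> compact_positive_ops \<Longrightarrow> \<psi> a = sugeno_trace \<alpha> a"
      unfolding cond1_def by blast
    from sugeno_type_properties[OF inf this] show ?thesis unfolding cond3_def by (intro conjI)
  qed
  moreover have "cond3 \<Longrightarrow> cond2"
    unfolding cond2_def cond3_def using comonotonic_imp_monotonic_F_additive by blast
  moreover have "cond1" if c2: cond2
  proof -
    obtain \<alpha> :: "nat \<Rightarrow> real" where "mono \<alpha>" "\<And>n. 0 \<le> \<alpha> n" "\<alpha> 0 = 0"
      "\<And>a. a \<in> compact_positive_ops \<Longrightarrow> \<psi> a = sugeno_trace \<alpha> a"
      by (rule Sugeno_type_of_properties[OF inf, of \<psi>]) (use c2 assms(2) in \<open>simp_all add: cond2_def\<close>)
    then show ?thesis unfolding cond1_def by blast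
  qed
  ultimately show ?thesis by blast
qed

end
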